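(* Let $N,p,q,\sigma$ be real numbers with $q>p-1>0$ and $p<-\sigma<N$. Consider the positive solutions of $$-(|w'|^{p-2}w')'-\frac{N-1}{r}|w'|^{p-2}w'=\varepsilon r^{\sigma}w^{q},\qquad \varepsilon=\pm1 .$$ Then there exists no $C^0$-regular solution. For $\varepsilon=\pm1$ there exist local (nonglobal) solutions near $\infty$ of two types: $$\lim_{r\to\infty}w=C>0,\qquad \lim_{r\to\infty}r^{-\frac{\sigma+1}{p-1}}w'=-\varepsilon D,\quad D>0;$$ $$\lim_{r\to\infty}w=0,\qquad \lim_{r\to\infty}r^{\frac{N-p}{p-1}}w=k>0,\qquad \lim_{r\to\infty}r^{\frac{N-1}{p-1}}w'=-c(k)<0.$$ For $\varepsilon=-1$ there exist two types of global solutions in $(0,\infty)$: • $w^*(r)=a^*r^{-\frac{p+\sigma}{q+1-p}}$, which is a cusp-solution; • solutions such that $w\sim w^*$ as $r\to0$, $\lim_{r\to\infty}w=C>0$, $\lim_{r\to\infty}r^{-\frac{\sigma+1}{p-1}}w'=D>0$; and there exist also solutions on $(r_0,\infty)$ such that $w(r_0)=0$, and others such that $\lim_{r\to r_0}w=\infty$, with $w\sim w^*$ as $r\to\infty$; and nonglobal solutions on $(0,r_0)$ such that $w\sim w^*$ as $r\to0$ and $\lim_{r\to r_0}w=\infty$. For $\varepsilon=1$ there is no local solution in $(0,r_0)$.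
   Context: $N$ is not necessarily an integer. A positive solution $w$ on an interval $(0,\rho)$ is called $C^0$-regular if $w\in C^2(0,\rho)\cap C^0([0,\rho))$, that is, $\lim_{r\to0}w=c\ge0$. A cusp-solution is a solution with $\lim_{r\to0}w=c\in\mathbb{R}$ and $\lim_{r\to0}|w'|=\infty$. With $\gamma=\frac{p+\sigma}{q+1-p}$, $a^*>0$ is defined by $(a^* )^{q-p+1}=\varepsilon|\gamma|^{p-2}\gamma\,(N-p-(p-1)\gamma)$ with $\varepsilon=-1$. A local solution near $0$ (resp. near $\infty$) is a positive solution on $(0,r_0)$ (resp. $(r_0,\infty)$) for some $r_0>0$; a solution is global if it is a positive solution on $(0,\infty)$. $c(k)$ denotes a positive constant depending on $k$. $f\sim g$ means $f/g\to1$.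
   Formalization: For ε=−1, w* is itself C⁰-regular (c=0), so "no C⁰-regular solution" becomes: every C⁰-regular solution has c=0 and w∼w* as r→0 (for ε=1 there is none). "w* is a cusp-solution" is claimed only if −γ<1, since otherwise |w*'| does not tend to ∞. *)

theory Defs
  imports "HOL-Analysis.Analysis" "HOL-Library.Landau_Symbols"
begin

text \<open>The value at a critical point is \<open>0\<close> (as \<open>0 powr a = 0\<close>), the continuous extension for \<open>p > 1\<close>.\<close>

definition flux :: "real \<Rightarrow> (real \<Rightarrow> real) \<Rightarrow> real \<Rightarrow> real" where
  "flux p w r = \<bar>deriv w r\<bar> powr (p - 2) * deriv w r"

text \<open>Solutions are classical in the sense usual for the \<open>p\<close>-Laplacian: \<open>w\<close> and \<open>flux p w\<close> are
  differentiable and the equation holds pointwise. For \<open>p > 1\<close> it follows that \<open>w\<close> and \<open>flux p w\<close>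
  are \<open>C\<^sup>1\<close>. \<open>C\<^sup>2\<close> is not required: for \<open>p > 2\<close> it fails at a zero of \<open>w'\<close>.\<close>

definition pos_solution ::
    "real \<Rightarrow> real \<Rightarrow> real \<Rightarrow> real \<Rightarrow> real \<Rightarrow> real set \<Rightarrow> (real \<Rightarrow> real) \<Rightarrow> bool" where
  "pos_solution N p q \<sigma> \<epsilon> I w \<longleftrightarrow>
     (\<forall>r\<in>I. w r > 0 \<and> w differentiable (at r) \<and> flux p w differentiable (at r) \<and>
        - deriv (flux p w) r - (N - 1) / r * flux p w r = \<epsilon> * r powr \<sigma> * w r powr q)"

text \<open>A solution on \<open>I\<close> is nonglobal if it is not the restriction of a positive solution on
  \<open>(0,\<infinity>)\<close>.\<close>

definition nonglobal ::
    "real \<Rightarrow> real \<Rightarrow> real \<Rightarrow> real \<Rightarrow> real \<Rightarrow> real set \<Rightarrow> (real \<Rightarrow> real) \<Rightarrow> bool" where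
  "nonglobal N p q \<sigma> \<epsilon> I w \<longleftrightarrow>
     \<not> (\<exists>v. pos_solution N p q \<sigma> \<epsilon> {0<..} v \<and> (\<forall>r\<in>I. v r = w r))"

definition C2_on :: "real set \<Rightarrow> (real \<Rightarrow> real) \<Rightarrow> bool" where
  "C2_on I w \<longleftrightarrow>
     (\<forall>r\<in>I. w differentiable (at r) \<and> deriv w differentiable (at r)) \<and>
     continuous_on I (deriv (deriv w))"

definition C0_regular ::
    "real \<Rightarrow> real \<Rightarrow> real \<Rightarrow> real \<Rightarrow> real \<Rightarrow> real \<Rightarrow> real \<Rightarrow> (real \<Rightarrow> real) \<Rightarrow> bool" where
  "C0_regular N p q \<sigma> \<epsilon> \<rho> c w \<longleftrightarrow>
     pos_solution N p q \<sigma> \<epsilon> {0<..<\<rho>} w \<and> C2_on {0<..<\<rho>} w \<and>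
     c \<ge> 0 \<and> (w \<longlongrightarrow> c) (at_right 0)"

definition cusp_solution ::
    "real \<Rightarrow> real \<Rightarrow> real \<Rightarrow> real \<Rightarrow> real \<Rightarrow> real \<Rightarrow> (real \<Rightarrow> real) \<Rightarrow> bool" where
  "cusp_solution N p q \<sigma> \<epsilon> \<rho> w \<longleftrightarrow>
     pos_solution N p q \<sigma> \<epsilon> {0<..<\<rho>} w \<and>
     (\<exists>c. (w \<longlongrightarrow> c) (at_right 0)) \<and>
     filterlim (\<lambda>r. \<bar>deriv w r\<bar>) at_top (at_right 0)"

definition gam :: "real \<Rightarrow> real \<Rightarrow> real \<Rightarrow> real" where
  "gam p q \<sigma> = (p + \<sigma>) / (q + 1 - p)"

text \<open>The factor \<open>-1\<close> is \<open>\<epsilon>\<close>: the constant is used for \<open>\<epsilon> = -1\<close> only, where the right-hand side is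
  positive.\<close>

definition a_star :: "real \<Rightarrow> real \<Rightarrow> real \<Rightarrow> real \<Rightarrow> real" where
  "a_star N p q \<sigma> = (THE a. a > 0 \<and>
     a powr (q - p + 1) =
       (-1) * \<bar>gam p q \<sigma>\<bar> powr (p - 2) * gam p q \<sigma> * (N - p - (p - 1) * gam p q \<sigma>))"

definition w_star :: "real \<Rightarrow> real \<Rightarrow> real \<Rightarrow> real \<Rightarrow> real \<Rightarrow> real" where
  "w_star N p q \<sigma> r = a_star N p q \<sigma> * r powr (- gam p q \<sigma>)"

end

theory Submission
  imports Defs
begin

text \<open>
  Put \<open>\<kappa> = (N - p) / (p - 1)\<close> and \<open>s = r powr (- \<kappa>)\<close>, the radial \<open>p\<close>-harmonic function that vanishes at
  infinity. In this variable the first-order term disappears: with \<open>psi\<close> the inverse of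
  \<open>t \<mapsto> \<bar>t\<bar> powr (p - 2) * t\<close> the equation reads
  \<open>w' = psi G\<close>, \<open>G' = e * c * s powr m * w powr q\<close>, where \<open>e = - \<epsilon>\<close>, \<open>c = \<kappa> powr (- p)\<close> and
  \<open>m = - 1 - (N + \<sigma>) / \<kappa>\<close>. The hypotheses \<open>p < - \<sigma> < N\<close> say that \<open>- p < m < - 1\<close>.
  The end \<open>r \<rightarrow> \<infinity>\<close> becomes \<open>s \<rightarrow> 0\<close>, the end \<open>r \<rightarrow> 0\<close> becomes \<open>s \<rightarrow> \<infinity>\<close>, and
  \<open>w\<^sup>*\<close> becomes a negative power of \<open>s\<close>. For \<open>\<epsilon> = - 1\<close> (absorption) positive solutions are convex in \<open>s\<close> and
  satisfy a comparison principle; for \<open>\<epsilon> = 1\<close> (source) they are concave.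

  \<^emph>\<open>Near \<open>r = 0\<close>.\<close> For the source equation a positive solution for large \<open>s\<close> is concave, hence nondecreasing,
  so its flux at \<open>s\<close> is at least the mass of the source beyond \<open>s\<close> computed with \<open>w\<close> frozen at \<open>w s\<close>. This
  differential inequality forces a power of \<open>w\<close> to become negative in finite time (\<open>no_source_solution\<close>).
  For the absorption equation the Keller--Osserman bound gives \<open>w \<le> C * w\<^sup>*\<close>, so \<open>w\<close> tends to \<open>0\<close> and decreases in
  \<open>s\<close>; the same flux estimate, now read as an upper bound, gives \<open>k * w\<^sup>* \<le> w\<close>. The ratio \<open>w / w\<^sup>*\<close> tends to \<open>1\<close>
  for two reasons. The multiples \<open>l * w\<^sup>*\<close> are supersolutions for \<open>l \<ge> 1\<close> and subsolutions for \<open>l \<le> 1\<close>, so the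
  ratio has no bump above \<open>1\<close> and no dip below \<open>1\<close>. And a bound \<open>w \<ge> l * w\<^sup>*\<close> near infinity, integrated
  twice, becomes \<open>w \<ge> l powr (q / (p - 1)) * w\<^sup>*\<close>; as \<open>q / (p - 1) > 1\<close>, iterating it for some \<open>l > 1\<close> would
  contradict the upper bound, and symmetrically below \<open>1\<close> (\<open>ratio_tendsto_1\<close>). This settles the
  \<open>C\<^sup>0\<close>-regular solutions and the behaviour at \<open>r = 0\<close> of every solution constructed for \<open>\<epsilon> = - 1\<close>.

  \<^emph>\<open>Existence for \<open>\<epsilon> = - 1\<close>.\<close> Perron's method (\<open>perron\<close>): on intervals exhausting the domain solve Dirichlet
  problems whose boundary values are those of a subsolution, or increase to the value wanted at a fixed end.
  By comparison these solutions increase, the Keller--Osserman bound keeps them finite, and the limit is a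
  solution. The type of the limit is read off from barriers: an explicit regular subsolution and constants
  (global solution), the same subsolution and a line (local solution with \<open>w \<rightarrow> C\<close>), \<open>w\<^sup>* - w\<^sup>* 1\<close>, \<open>w\<^sup>*\<close> and a
  line (solution vanishing at \<open>r\<^sub>0\<close>), \<open>w\<^sup>*\<close> with boundary values tending to infinity (the two blowing-up
  solutions), and \<open>k * (s + s powr (1 + \<delta>))\<close> and a line (solution comparable with \<open>s\<close>). The Dirichlet
  problem itself (\<open>dirichlet_problem\<close>) is solved by shooting.

  \<^emph>\<open>Existence for \<open>\<epsilon> = 1\<close>.\<close> Near \<open>s = 0\<close> the integrated equation, with the flux prescribed at the right end,
  is a fixed-point equation for an order-preserving operator, and an explicit upper bound is mapped below
  itself (\<open>source_local_solution\<close>).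

  \<^emph>\<open>Nonglobality.\<close> For \<open>\<epsilon> = 1\<close> it is the nonexistence near \<open>r = 0\<close>. For \<open>\<epsilon> = - 1\<close> a global solution is
  nonincreasing in \<open>s\<close>, whereas the local solutions near \<open>r = \<infinity>\<close> are constructed
  so as to increase somewhere; and a solution that blows up at \<open>r\<^sub>0\<close> has no continuous extension.
\<close>

section \<open>Signed powers\<close>

text \<open>The map \<open>t \<mapsto> \<bar>t\<bar> powr (a - 1) * t\<close>: for \<open>a = p - 1\<close> the flux of the \<open>p\<close>-Laplacian, for
  \<open>a = 1 / (p - 1)\<close> its inverse.\<close>

definition spow :: "real \<Rightarrow> real \<Rightarrow> real" where
  "spow a x = sgn x * \<bar>x\<bar> powr a"

lemma spow_0 [simp]: "spow a 0 = 0"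
  by (simp add: spow_def)

lemma spow_pos: "x > 0 \<Longrightarrow> spow a x = x powr a"
  by (simp add: spow_def)

lemma spow_nonneg: "x \<ge> 0 \<Longrightarrow> spow a x = x powr a"
  by (cases "x = 0") (auto simp add: spow_def)

lemma spow_minus: "spow a (- x) = - spow a x"
  by (simp add: spow_def sgn_minus)

lemma spow_spow: "a \<noteq> 0 \<Longrightarrow> spow a (spow (1 / a) x) = x"
  by (cases "x = 0") (auto simp: spow_def abs_mult sgn_mult powr_powr abs_sgn_eq mult_sgn_abs)

lemma spow_spow': "a \<noteq> 0 \<Longrightarrow> spow (1 / a) (spow a x) = x"
  using spow_spow[of "1 / a" x] by simp

lemma spow_mult: "k \<ge> 0 \<Longrightarrow> spow a (k * x) = k powr a * spow a x"
  by (cases "k = 0") (auto simp: spow_def abs_mult sgn_mult powr_mult)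

lemma strict_mono_spow:
  assumes "a > 0" shows "strict_mono (spow a)"
proof (rule strict_monoI)
  fix x y :: real assume xy: "x < y"
  consider "x \<ge> 0" | "x < 0" "y \<le> 0" | "x < 0" "y > 0" by linarith
  then show "spow a x < spow a y"
  proof cases
    case 1 then show ?thesis using xy assms by (simp add: spow_nonneg powr_less_mono2)
  next
    case 2
    then have "spow a (- y) < spow a (- x)" using xy assms by (simp add: spow_nonneg powr_less_mono2)
    then show ?thesis by (simp add: spow_minus)
  next
    case 3
    then have "spow a x < 0" "0 < spow a y" by (auto simp: spow_def)
    then show ?thesis by simp
  qed
qed

lemma spow_less_iff: "a > 0 \<Longrightarrow> spow a x < spow a y \<longleftrightarrow> x < y"
  by (simp add: strict_mono_spow strict_mono_less)

lemma spow_le_iff: "a > 0 \<Longrightarrow> spow a x \<le> spow a y \<longleftrightarrow> x \<le> y"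
  by (simp add: strict_mono_spow strict_mono_less_eq)

lemma continuous_on_spow [continuous_intros]:
  assumes "a > 0" "continuous_on S f" shows "continuous_on S (\<lambda>x. spow a (f x))"
proof -
  have *: "spow a = (\<lambda>x. max x 0 powr a - max (- x) 0 powr a)"
    using assms(1) by (auto simp: fun_eq_iff spow_def sgn_if max_def)
  have "continuous_on S (\<lambda>x. max (f x) 0 powr a - max (- f x) 0 powr a)"
    by (intro continuous_on_diff continuous_on_powr' continuous_on_max continuous_on_const
        continuous_on_minus assms(2)) (use assms(1) in auto)
  then show ?thesis by (simp add: *)
qed

lemma isCont_spow: "a > 0 \<Longrightarrow> isCont (spow a) x"
  using continuous_on_spow[of a UNIV "\<lambda>x. x"] by (simp add: continuous_on_eq_continuous_at)

lemma tendsto_spow: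
  "a > 0 \<Longrightarrow> (f \<longlongrightarrow> l) F \<Longrightarrow> ((\<lambda>x. spow a (f x)) \<longlongrightarrow> spow a l) F"
  using isCont_tendsto_compose[OF isCont_spow] .

text \<open>Primitives of signed powers. The point \<open>0\<close> has to be included, because fluxes may change sign.\<close>

lemma DERIV_abs_powr:
  assumes "a > 0"
  shows "((\<lambda>x. \<bar>x\<bar> powr (a + 1)) has_real_derivative (a + 1) * spow a x) (at x)"
proof -
  consider "x > 0" | "x < 0" | "x = 0" by linarith
  then show ?thesis
  proof cases
    case 1
    have "((\<lambda>x. x powr (a + 1)) has_real_derivative (a + 1) * x powr a) (at x)"
      using 1 by (auto intro!: derivative_eq_intros)
    then show ?thesis
      by (rule DERIV_cong_ev[THEN iffD1, rotated 3])
         (use 1 in \<open>auto simp: spow_pos intro: eventually_mono[OF eventually_nhds_in_open[of "{0<..}" x]]\<close>)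
  next
    case 2
    have "((\<lambda>x. (- x) powr (a + 1)) has_real_derivative (a + 1) * spow a x) (at x)"
      using 2 by (auto intro!: derivative_eq_intros simp: spow_def)
    then show ?thesis
      by (rule DERIV_cong_ev[THEN iffD1, rotated 3])
         (use 2 in \<open>auto intro: eventually_mono[OF eventually_nhds_in_open[of "{..<0}" x]]\<close>)
  next
    case 3
    have "((\<lambda>h. spow a h) \<longlongrightarrow> spow a 0) (at 0)"
      using isCont_spow[OF assms, of 0] by (simp add: isCont_def)
    moreover have "spow a h = \<bar>h\<bar> powr (a + 1) / h" if "h \<noteq> 0" for h :: real
      using that by (auto simp: spow_def sgn_if powr_add abs_if)
    ultimately have "((\<lambda>h. \<bar>h\<bar> powr (a + 1) / h) \<longlongrightarrow> 0) (at 0)"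
      by (subst tendsto_cong[where g = "spow a"]) (auto simp: eventually_at_filter)
    then show ?thesis using 3 by (simp add: has_field_derivative_iff)
  qed
qed

lemma nonneg_derivative_imp_mono:
  fixes f f' :: "real \<Rightarrow> real"
  assumes "a \<le> b" and c: "continuous_on {a..b} f"
    and d: "\<And>x. a < x \<Longrightarrow> x < b \<Longrightarrow> (f has_real_derivative f' x) (at x)"
    and nn: "\<And>x. a < x \<Longrightarrow> x < b \<Longrightarrow> 0 \<le> f' x"
  shows "f a \<le> f b"
proof (cases "a < b")
  case True
  obtain l z where z: "a < z" "z < b" "(f has_real_derivative l) (at z)" "f b - f a = (b - a) * l"
    using MVT[OF True c] d by (auto simp: real_differentiable_def)
  have "l = f' z" using DERIV_unique[OF z(3) d[OF z(1,2)]] .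
  then have "0 \<le> (b - a) * l" using nn[OF z(1,2)] True by simp
  then show ?thesis using z(4) by simp
qed (use assms in auto)

lemma nonpos_derivative_imp_antimono:
  fixes f f' :: "real \<Rightarrow> real"
  assumes "a \<le> b" "continuous_on {a..b} f"
    and d: "\<And>x. a < x \<Longrightarrow> x < b \<Longrightarrow> (f has_real_derivative f' x) (at x)"
    and nn: "\<And>x. a < x \<Longrightarrow> x < b \<Longrightarrow> f' x \<le> 0"
  shows "f b \<le> f a"
  using nonneg_derivative_imp_mono[of a b "\<lambda>x. - f x" "\<lambda>x. - f' x"] assms
  by (auto intro!: continuous_intros DERIV_minus)

section \<open>Comparison\<close>

text \<open>The mechanism behind every comparison below. Where \<open>u > v\<close> the difference of the fluxes is nondecreasing.
  If \<open>u - v\<close> becomes positive, then at some earlier point its slope, hence the difference of the fluxes,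
  is positive, and neither can lose its sign afterwards.\<close>

lemma difference_increases_once_positive:
  fixes u v U V U' V' psi :: "real \<Rightarrow> real"
  assumes psi: "strict_mono psi"
    and cu: "continuous_on {a..b} u" and cv: "continuous_on {a..b} v"
    and du: "\<And>s. a < s \<Longrightarrow> s < b \<Longrightarrow> (u has_real_derivative psi (U s)) (at s)"
    and dv: "\<And>s. a < s \<Longrightarrow> s < b \<Longrightarrow> (v has_real_derivative psi (V s)) (at s)"
    and dU: "\<And>s. a < s \<Longrightarrow> s < b \<Longrightarrow> (U has_real_derivative U' s) (at s)"
    and dV: "\<And>s. a < s \<Longrightarrow> s < b \<Longrightarrow> (V has_real_derivative V' s) (at s)"
    and ord: "\<And>s. a < s \<Longrightarrow> s < b \<Longrightarrow> v s < u s \<Longrightarrow> V' s \<le> U' s"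
    and ua: "u a \<le> v a" and t1: "a \<le> t1" "v t1 < u t1" and t2: "t1 < t2" "t2 \<le> b"
  shows "u t1 - v t1 \<le> u t2 - v t2"
proof -
  define d where "d = (\<lambda>s. u s - v s)"
  define e where "e = (\<lambda>s. U s - V s)"
  have cd: "continuous_on {x..y} d" if "a \<le> x" "y \<le> b" for x y
    unfolding d_def using that
    by (intro continuous_on_diff continuous_on_subset[OF cu] continuous_on_subset[OF cv]) auto
  have dd: "(d has_real_derivative psi (U s) - psi (V s)) (at s)" if "a < s" "s < b" for s
    unfolding d_def using that by (intro DERIV_diff du dv)
  have de: "(e has_real_derivative U' s - V' s) (at s)" if "a < s" "s < b" for s
    unfolding e_def using that by (intro DERIV_diff dU dV)
  have at1: "a < t1" using ua t1 by (metis less_eq_real_def not_le)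
  define Z where "Z = {s\<in>{a..t1}. d s \<le> 0}"
  have Z: "Z = {a..t1} \<inter> d -` {..0}" by (auto simp: Z_def)
  have "closed Z" unfolding Z using t2 at1 by (intro continuous_closed_preimage cd) auto
  moreover have "bounded Z" unfolding Z by (rule bounded_Int) auto
  ultimately have "compact Z" by (simp add: compact_eq_bounded_closed)
  moreover have "a \<in> Z" using at1 ua by (auto simp: Z_def d_def)
  ultimately obtain c0 where c0: "c0 \<in> Z" "\<And>s. s \<in> Z \<Longrightarrow> s \<le> c0"
    using compact_attains_sup[of Z] by auto
  have c0': "a \<le> c0" "c0 < t1" "d c0 \<le> 0"
    using c0(1) t1 by (auto simp: Z_def d_def less_eq_real_def)
  have pos1: "d s > 0" if "c0 < s" "s \<le> t1" for s
    using c0(2)[of s] that c0' by (force simp: Z_def)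
  have "\<exists>l z. c0 < z \<and> z < t1 \<and> (d has_real_derivative l) (at z) \<and> d t1 - d c0 = (t1 - c0) * l"
  proof (rule MVT[OF c0'(2)])
    show "continuous_on {c0..t1} d" using c0' t2 by (intro cd) auto
    show "d differentiable (at x)" if "c0 < x" "x < t1" for x
      using dd[of x] that c0' t2 by (auto simp: real_differentiable_def)
  qed
  then obtain l xi where xi: "c0 < xi" "xi < t1" "(d has_real_derivative l) (at xi)"
      "d t1 - d c0 = (t1 - c0) * l" by blast
  have "0 < d t1 - d c0" using c0' pos1[of t1] by linarith
  then have "0 < (t1 - c0) * l" using xi(4) by simp
  then have "l > 0" using c0'(2) by (simp add: zero_less_mult_iff)
  then have exi: "e xi > 0"
    using DERIV_unique[OF xi(3) dd[of xi]] xi c0' t2 strict_mono_less[OF psi] by (auto simp: e_def)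
  have xb: "a < xi" "xi < b" using xi c0' t2 by auto
  have inc: "d x \<le> d y" if "xi \<le> x" "x \<le> y" "y \<le> b" "\<And>s. xi < s \<Longrightarrow> s < y \<Longrightarrow> d s > 0" for x y
  proof (rule nonneg_derivative_imp_mono[OF that(2), where f = d and f' = "\<lambda>s. psi (U s) - psi (V s)"])
    fix s assume s: "x < s" "s < y"
    show "(d has_real_derivative psi (U s) - psi (V s)) (at s)" using s that xb by (intro dd) auto
    have "e xi \<le> e s"
    proof (rule nonneg_derivative_imp_mono[where f = e and f' = "\<lambda>s. U' s - V' s"])
      show "xi \<le> s" using s that by auto
      show "(e has_real_derivative U' z - V' z) (at z)" if "xi < z" "z < s" for z
        using that \<open>y \<le> b\<close> s xb by (intro de) auto
      show "0 \<le> U' z - V' z" if "xi < z" "z < s" for z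
        using ord[of z] that \<open>y \<le> b\<close> s xb \<open>\<And>s. xi < s \<Longrightarrow> s < y \<Longrightarrow> d s > 0\<close>[of z]
        by (auto simp: d_def)
      show "continuous_on {xi..s} e"
        using xb s \<open>y \<le> b\<close>
        by (intro DERIV_continuous_on[where D="\<lambda>s. U' s - V' s"])
           (auto intro!: has_field_derivative_at_within[OF de])
    qed
    then have "V s < U s" using exi by (simp add: e_def)
    then show "0 \<le> psi (U s) - psi (V s)"
      using strict_mono_less[OF psi, of "V s" "U s"] by simp
  next
    show "continuous_on {x..y} d" using cd that xb by auto
  qed
  have pos2: "d s > 0" if "xi < s" "s \<le> b" for s
  proof (rule ccontr)
    assume neg: "\<not> d s > 0"
    define Y where "Y = {z\<in>{xi..s}. d z \<le> 0}"
    have Y: "Y = {xi..s} \<inter> d -` {..0}" by (auto simp: Y_def)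
    have "closed Y" unfolding Y using that xb by (intro continuous_closed_preimage cd) auto
    moreover have "bounded Y" unfolding Y by (rule bounded_Int) auto
    ultimately have "compact Y" by (simp add: compact_eq_bounded_closed)
    moreover have "s \<in> Y" using neg that by (auto simp: Y_def)
    ultimately obtain c1 where c1: "c1 \<in> Y" "\<And>s. s \<in> Y \<Longrightarrow> c1 \<le> s"
      using compact_attains_inf[of Y] by auto
    have "d xi > 0" using pos1[of xi] xi by auto
    moreover have "d z > 0" if "xi < z" "z < c1" for z
      using c1(2)[of z] c1(1) that by (force simp: Y_def)
    then have "d xi \<le> d c1" using c1(1) that by (intro inc) (auto simp: Y_def)
    ultimately show False using c1 by (auto simp: Y_def)
  qed
  have "d t1 \<le> d t2" using t2 xi pos2 by (intro inc) auto
  then show ?thesis by (simp add: d_def)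
qed

lemma comparison_principle:
  fixes u v U V U' V' psi :: "real \<Rightarrow> real"
  assumes psi: "strict_mono psi"
    and cu: "continuous_on {a..b} u" and cv: "continuous_on {a..b} v"
    and du: "\<And>s. a < s \<Longrightarrow> s < b \<Longrightarrow> (u has_real_derivative psi (U s)) (at s)"
    and dv: "\<And>s. a < s \<Longrightarrow> s < b \<Longrightarrow> (v has_real_derivative psi (V s)) (at s)"
    and dU: "\<And>s. a < s \<Longrightarrow> s < b \<Longrightarrow> (U has_real_derivative U' s) (at s)"
    and dV: "\<And>s. a < s \<Longrightarrow> s < b \<Longrightarrow> (V has_real_derivative V' s) (at s)"
    and ord: "\<And>s. a < s \<Longrightarrow> s < b \<Longrightarrow> v s < u s \<Longrightarrow> V' s \<le> U' s"
    and ua: "u a \<le> v a" and ub: "u b \<le> v b" and t: "a \<le> t" "t \<le> b"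
  shows "u t \<le> v t"
proof (rule ccontr)
  assume n: "\<not> u t \<le> v t"
  then have "t < b" using t ub by (metis less_eq_real_def)
  then have "u t - v t \<le> u b - v b"
    using n t by (intro difference_increases_once_positive[OF psi cu cv du dv dU dV ord ua]) auto
  then show False using n ub by auto
qed

section \<open>Shooting\<close>

text \<open>Tarski's fixed-point theorem on an equicontinuous order interval. Suprema keep the modulus of
  continuity \<open>M\<close>, so the fixed point is continuous and no iteration or passage to a limit is needed.\<close>

lemma monotone_fixed_point:
  fixes T :: "('a \<Rightarrow> real) \<Rightarrow> 'a \<Rightarrow> real" and M :: "'a \<Rightarrow> 'a \<Rightarrow> real"
    and lo hi :: "'a \<Rightarrow> real" and X :: "'a set"
  defines "S \<equiv> {w. (\<forall>x\<in>X. lo x \<le> w x \<and> w x \<le> hi x) \<and> (\<forall>x\<in>X. \<forall>y\<in>X. \<bar>w x - w y\<bar> \<le> M x y)}"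
  assumes lo: "lo \<in> S"
    and maps: "\<And>w. w \<in> S \<Longrightarrow> T w \<in> S"
    and mono: "\<And>w v x. w \<in> S \<Longrightarrow> v \<in> S \<Longrightarrow> (\<And>x. x \<in> X \<Longrightarrow> w x \<le> v x) \<Longrightarrow> x \<in> X \<Longrightarrow> T w x \<le> T v x"
  obtains w where "w \<in> S" "\<And>x. x \<in> X \<Longrightarrow> T w x = w x"
proof -
  define P where "P = {w\<in>S. \<forall>x\<in>X. w x \<le> T w x}"
  define W where "W = (\<lambda>x. SUP w\<in>P. w x)"
  have loP: "lo \<in> P" using lo maps[OF lo] by (auto simp: P_def S_def)
  have bdd: "bdd_above ((\<lambda>w. w x) ` P)" if "x \<in> X" for x
    using that by (intro bdd_aboveI[of _ "hi x"]) (auto simp: P_def S_def)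
  have up: "w x \<le> W x" if "w \<in> P" "x \<in> X" for w x
    unfolding W_def using that bdd by (intro cSUP_upper) auto
  have least: "W x \<le> z" if "x \<in> X" "\<And>w. w \<in> P \<Longrightarrow> w x \<le> z" for x z
    unfolding W_def using that loP by (intro cSUP_least) auto
  have WS: "W \<in> S"
  proof -
    have "W x \<le> W y + M x y" if "x \<in> X" "y \<in> X" for x y
    proof (rule least[OF that(1)])
      fix w assume w: "w \<in> P"
      then have "\<bar>w x - w y\<bar> \<le> M x y" using that by (auto simp: P_def S_def)
      then show "w x \<le> W y + M x y" using up[OF w that(2)] by linarith
    qed
    moreover have "W y \<le> W x + M x y" if "x \<in> X" "y \<in> X" for x y
    proof (rule least[OF that(2)])
      fix w assume w: "w \<in> P"
      then have "\<bar>w x - w y\<bar> \<le> M x y" using that by (auto simp: P_def S_def)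
      then show "w y \<le> W x + M x y" using up[OF w that(1)] by linarith
    qed
    moreover have "lo x \<le> W x" "W x \<le> hi x" if "x \<in> X" for x
      using up[OF loP that] least[OF that, of "hi x"] that by (auto simp: P_def S_def)
    ultimately show ?thesis by (fastforce simp: S_def abs_le_iff)
  qed
  have le: "W x \<le> T W x" if "x \<in> X" for x
  proof (rule least[OF that])
    fix w assume w: "w \<in> P"
    have "w x \<le> T w x" using w that by (auto simp: P_def)
    also have "\<dots> \<le> T W x" using w WS up that by (intro mono) (auto simp: P_def)
    finally show "w x \<le> T W x" .
  qed
  have "T W \<in> P" using maps[OF WS] mono[OF WS maps[OF WS] le] by (auto simp: P_def)
  then have "T W x = W x" if "x \<in> X" for x using up le that by (simp add: order_antisym)
  then show ?thesis using that WS by blast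
qed

definition ivp_solution ::
    "(real \<Rightarrow> real) \<Rightarrow> (real \<Rightarrow> real \<Rightarrow> real) \<Rightarrow> real \<Rightarrow> real \<Rightarrow> (real \<Rightarrow> real) \<Rightarrow> (real \<Rightarrow> real) \<Rightarrow> bool" where
  "ivp_solution psi f a b w G \<longleftrightarrow> (\<forall>s\<in>{a..b}. (w has_real_derivative psi (G s)) (at s within {a..b}) \<and>
     (G has_real_derivative f s (w s)) (at s within {a..b}))"

text \<open>For a source that is nondecreasing in \<open>w\<close> the integrated initial value problem is an order-preserving
  fixed-point equation. A contraction argument is not available, since \<open>psi\<close> is not Lipschitz for \<open>p > 2\<close>.\<close>

lemma initial_value_problem:
  fixes f :: "real \<Rightarrow> real \<Rightarrow> real" and psi :: "real \<Rightarrow> real"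
  assumes ab: "a < b" and psi: "mono psi" "continuous_on UNIV psi"
    and cf: "\<And>w. continuous_on {a..b} w \<Longrightarrow> continuous_on {a..b} (\<lambda>s. f s (w s))"
    and fm: "\<And>s x y. s \<in> {a..b} \<Longrightarrow> x \<le> y \<Longrightarrow> f s x \<le> f s y"
    and fb: "\<And>s x. s \<in> {a..b} \<Longrightarrow> \<bar>f s x\<bar> \<le> f1"
  shows "\<exists>w G. w a = A \<and> G a = \<theta> \<and> ivp_solution psi f a b w G"
proof -
  define G where "G = (\<lambda>w s. \<theta> + integral {a..s} (\<lambda>t. f t (w t)))"
  define T where "T = (\<lambda>w s. A + integral {a..s} (\<lambda>t. psi (G w t)))"
  define R where "R = f1 * (b - a)"
  define L where "L = \<bar>psi (\<theta> - R)\<bar> + \<bar>psi (\<theta> + R)\<bar>"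
  define M where "M = (\<lambda>x y. L * \<bar>x - y\<bar>)"
  define lo where "lo = (\<lambda>x::real. A - L * (b - a))"
  define hi where "hi = (\<lambda>x::real. A + L * (b - a))"
  define S where "S = {w. (\<forall>x\<in>{a..b}. lo x \<le> w x \<and> w x \<le> hi x) \<and> (\<forall>x\<in>{a..b}. \<forall>y\<in>{a..b}. \<bar>w x - w y\<bar> \<le> M x y)}"
  have L0: "L \<ge> 0" by (simp add: L_def)
  have contS: "continuous_on {a..b} w" if "w \<in> S" for w
  proof (rule uniformly_continuous_imp_continuous, rule lipschitz_on_uniformly_continuous[of L], rule lipschitz_onI)
    show "dist (w x) (w y) \<le> L * dist x y" if "x \<in> {a..b}" "y \<in> {a..b}" for x y
      using \<open>w \<in> S\<close> that by (auto simp: S_def M_def dist_real_def)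
  qed (rule L0)
  have dG: "(G w has_real_derivative f s (w s)) (at s within {a..b})"
    if "continuous_on {a..b} w" "s \<in> {a..b}" for w s
    unfolding G_def using integral_has_real_derivative[OF cf[OF that(1)] that(2)]
    by (auto intro!: derivative_eq_intros)
  have cG: "continuous_on {a..b} (\<lambda>s. psi (G w s))" if "continuous_on {a..b} w" for w
    using DERIV_continuous_on[OF dG[OF that]] continuous_on_compose2[OF psi(2)] by blast
  have dT: "(T w has_real_derivative psi (G w s)) (at s within {a..b})"
    if "continuous_on {a..b} w" "s \<in> {a..b}" for w s
    unfolding T_def using integral_has_real_derivative[OF cG[OF that(1)] that(2)]
    by (auto intro!: derivative_eq_intros)
  have Gb: "\<bar>psi (G w s)\<bar> \<le> L" if "continuous_on {a..b} w" "s \<in> {a..b}" for w s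
  proof -
    have "norm (integral {a..s} (\<lambda>t. f t (w t))) \<le> f1 * (s - a)"
      using that fb ab by (intro integral_bound continuous_on_subset[OF cf[OF that(1)]]) auto
    also have "\<dots> \<le> R" unfolding R_def using that fb[of s 0] by (intro mult_left_mono) auto
    finally have "\<theta> - R \<le> G w s" "G w s \<le> \<theta> + R" by (auto simp: G_def abs_le_iff)
    then have "psi (\<theta> - R) \<le> psi (G w s)" "psi (G w s) \<le> psi (\<theta> + R)"
      by (auto intro!: monoD[OF psi(1)])
    then show ?thesis by (simp add: L_def)
  qed
  have maps: "T w \<in> S" if "w \<in> S" for w
  proof -
    note c = contS[OF that]
    have lip: "\<bar>T w x - T w y\<bar> \<le> L * \<bar>x - y\<bar>" if "x \<in> {a..b}" "y \<in> {a..b}" for x y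
      using field_differentiable_bound[of "{a..b}" "T w" "\<lambda>s. psi (G w s)" L x y] dT[OF c] Gb[OF c] that
      by (auto simp: abs_minus_commute)
    have "T w a = A" by (simp add: T_def)
    then have "\<bar>T w x - A\<bar> \<le> L * (b - a)" if "x \<in> {a..b}" for x
      using lip[OF that, of a] that ab mult_left_mono[OF _ L0, of "\<bar>x - a\<bar>" "b - a"] by auto
    then show ?thesis using lip unfolding S_def lo_def hi_def M_def by (auto simp: abs_le_iff) (smt (verit))+
  qed
  have "lo \<in> S" using L0 ab by (auto simp: S_def lo_def hi_def M_def)
  moreover have "T w x \<le> T v x"
    if w: "w \<in> S" and v: "v \<in> S" and le: "\<And>x. x \<in> {a..b} \<Longrightarrow> w x \<le> v x" and x: "x \<in> {a..b}" for w v x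
  proof -
    have Gle: "G w s \<le> G v s" if "s \<in> {a..b}" for s
      unfolding G_def using that le fm
      by (intro add_left_mono integral_le integrable_continuous_real
          continuous_on_subset[OF cf[OF contS[OF w]]] continuous_on_subset[OF cf[OF contS[OF v]]]) auto
    show ?thesis unfolding T_def using x Gle psi(1)
      by (intro add_left_mono integral_le integrable_continuous_real monoD[OF psi(1)]
          continuous_on_subset[OF cG[OF contS[OF w]]] continuous_on_subset[OF cG[OF contS[OF v]]]) auto
  qed
  ultimately obtain w where w: "w \<in> S" "\<And>x. x \<in> {a..b} \<Longrightarrow> T w x = w x"
    using monotone_fixed_point[of lo "{a..b}" hi M T] maps unfolding S_def by blast
  note c = contS[OF w(1)]
  have "(w has_real_derivative psi (G w s)) (at s within {a..b})" if "s \<in> {a..b}" for s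
    by (rule has_field_derivative_transform_within[OF dT[OF c that] zero_less_one that w(2)])
  moreover have "w a = A" using w(2)[of a] ab by (simp add: T_def)
  moreover have "G w a = \<theta>" by (simp add: G_def)
  ultimately show ?thesis using dG[OF c] unfolding ivp_solution_def by blast
qed

lemma has_derivative_within_Icc_imp_at:
  fixes f :: "real \<Rightarrow> real"
  assumes "(f has_real_derivative D) (at x within {a..b})" "a < x" "x < b"
  shows "(f has_real_derivative D) (at x)"
  using assms by (simp add: at_within_Icc_at)

text \<open>The final value depends in a Lipschitz way on the initial flux, although \<open>psi\<close> need not be Lipschitz (for
  \<open>p > 2\<close> it is not at \<open>0\<close>): since \<open>G' \<ge> f0 > 0\<close>, a value of \<open>G\<close> where \<open>psi\<close> is steep is passed at positive speed.
  In quantitative form, the integral of \<open>psi (G + e) - psi (G - e)\<close> is at most \<open>1 / f0\<close> times the variation of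
  \<open>P (G + e) - P (G - e)\<close>, where \<open>P\<close> is a primitive of \<open>psi\<close>, and this is of order \<open>e\<close>.\<close>

lemma shooting_dependence:
  fixes f :: "real \<Rightarrow> real \<Rightarrow> real" and psi P :: "real \<Rightarrow> real"
  assumes ab: "a < b" and psi: "mono psi" "\<And>x. psi (- x) = - psi x" "continuous_on UNIV psi"
    and P: "\<And>x. (P has_real_derivative psi x) (at x)"
    and f0: "0 < f0" "\<And>s x. s \<in> {a..b} \<Longrightarrow> f0 \<le> f s x"
    and lip: "\<And>s x y. s \<in> {a..b} \<Longrightarrow> \<bar>f s x - f s y\<bar> \<le> Lam * \<bar>x - y\<bar>"
    and B: "0 < B" and Lam: "0 < Lam"
  shows "\<exists>K. \<forall>w1 G1 w2 G2. w1 a = w2 a \<longrightarrow> ivp_solution psi f a b w1 G1 \<longrightarrow> ivp_solution psi f a b w2 G2 \<longrightarrow>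
      (\<forall>s\<in>{a..b}. \<bar>G1 s\<bar> \<le> B \<and> \<bar>G2 s\<bar> \<le> B) \<longrightarrow> \<bar>w1 b - w2 b\<bar> \<le> K * \<bar>G1 a - G2 a\<bar>"
proof -
  define k where "k = 4 * (\<bar>psi (3 * B)\<bar> + 1) / f0"
  \<comment> \<open>the exponential weight for which the contribution of \<open>D\<close> itself is halved\<close>
  define l where "l = 2 * k * Lam"
  have k0: "k > 0" using f0 by (simp add: k_def)
  have l0: "l > 0" using k0 Lam by (simp add: l_def)
  have psib: "\<bar>psi x\<bar> \<le> \<bar>psi (3 * B)\<bar> + 1" if "\<bar>x\<bar> \<le> 3 * B" for x
  proof -
    have "psi x \<le> psi (3 * B)" "psi (- (3 * B)) \<le> psi x" using that by (auto intro!: monoD[OF psi(1)])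
    then show ?thesis using psi(2)[of "3 * B"] by auto
  qed
  have Plip: "\<bar>P x - P y\<bar> \<le> (\<bar>psi (3 * B)\<bar> + 1) * \<bar>x - y\<bar>" if "\<bar>x\<bar> \<le> 3 * B" "\<bar>y\<bar> \<le> 3 * B" for x y
    using field_differentiable_bound[of "{- 3 * B..3 * B}" P psi "\<bar>psi (3 * B)\<bar> + 1" x y]
      P psib that by (auto simp: has_field_derivative_at_within abs_le_iff)
  show ?thesis
  proof (intro exI[of _ "2 * k * exp (l * (b - a))"] allI impI)
    fix w1 G1 w2 G2 :: "real \<Rightarrow> real"
    assume w12: "w1 a = w2 a"
      and sols: "ivp_solution psi f a b w1 G1" "ivp_solution psi f a b w2 G2"
        "\<forall>s\<in>{a..b}. \<bar>G1 s\<bar> \<le> B \<and> \<bar>G2 s\<bar> \<le> B"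
    have dw1: "\<And>s. s \<in> {a..b} \<Longrightarrow> (w1 has_real_derivative psi (G1 s)) (at s within {a..b})"
      and dw2: "\<And>s. s \<in> {a..b} \<Longrightarrow> (w2 has_real_derivative psi (G2 s)) (at s within {a..b})"
      and dG1: "\<And>s. s \<in> {a..b} \<Longrightarrow> (G1 has_real_derivative f s (w1 s)) (at s within {a..b})"
      and dG2: "\<And>s. s \<in> {a..b} \<Longrightarrow> (G2 has_real_derivative f s (w2 s)) (at s within {a..b})"
      and B1: "\<And>s. s \<in> {a..b} \<Longrightarrow> \<bar>G1 s\<bar> \<le> B" and B2: "\<And>s. s \<in> {a..b} \<Longrightarrow> \<bar>G2 s\<bar> \<le> B"
      using sols by (auto simp: ivp_solution_def)
    define d where "d = (\<lambda>s. w1 s - w2 s)"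
    define \<delta> where "\<delta> = \<bar>G1 a - G2 a\<bar>"
    note at1 = has_derivative_within_Icc_imp_at
    have cw: "continuous_on {a..b} w1" "continuous_on {a..b} w2" "continuous_on {a..b} G1" "continuous_on {a..b} G2"
      using DERIV_continuous_on[OF dw1] DERIV_continuous_on[OF dw2]
        DERIV_continuous_on[OF dG1] DERIV_continuous_on[OF dG2] by auto
    have "continuous_on {a..b} (\<lambda>s. \<bar>d s\<bar> * exp (- l * (s - a)))"
      unfolding d_def by (intro continuous_intros cw)
    then obtain t0 where t0: "t0 \<in> {a..b}"
        "\<And>s. s \<in> {a..b} \<Longrightarrow> \<bar>d s\<bar> * exp (- l * (s - a)) \<le> \<bar>d t0\<bar> * exp (- l * (t0 - a))"
      using continuous_attains_sup[of "{a..b}" "\<lambda>s. \<bar>d s\<bar> * exp (- l * (s - a))"] ab by auto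
    define D where "D = \<bar>d t0\<bar> * exp (- l * (t0 - a))"
    have D0: "D \<ge> 0" by (simp add: D_def)
    have dD: "\<bar>d s\<bar> \<le> D * exp (l * (s - a))" if "s \<in> {a..b}" for s
    proof -
      have "\<bar>d s\<bar> = \<bar>d s\<bar> * exp (- l * (s - a)) * exp (l * (s - a))"
        by (simp add: mult_exp_exp mult.assoc)
      also have "\<dots> \<le> D * exp (l * (s - a))" using t0(2)[OF that] by (intro mult_right_mono) (auto simp: D_def)
      finally show ?thesis .
    qed
    define E where "E = (\<lambda>s. \<delta> + Lam * D / l * exp (l * (s - a)))"
    have Gd: "\<bar>G1 s - G2 s\<bar> \<le> E s" if "s \<in> {a..b}" for s
    proof -
      have "\<sigma> * (G1 s - G2 s) \<le> E s" if sg: "\<sigma> = 1 \<or> \<sigma> = -1" for \<sigma> :: real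
      proof -
        define h where "h = (\<lambda>t. E t - \<sigma> * (G1 t - G2 t))"
        have "h a \<le> h s"
        proof (rule nonneg_derivative_imp_mono[where f = h and f' =
              "\<lambda>t. Lam * D * exp (l * (t - a)) - \<sigma> * (f t (w1 t) - f t (w2 t))"])
          show "continuous_on {a..s} h" unfolding h_def E_def using \<open>s \<in> {a..b}\<close>
            by (intro continuous_intros continuous_on_subset[OF cw(3)] continuous_on_subset[OF cw(4)]) auto
          fix t assume t: "a < t" "t < s"
          then have tb: "t \<in> {a..b}" "a < t" "t < b" using \<open>s \<in> {a..b}\<close> by auto
          show "(h has_real_derivative Lam * D * exp (l * (t - a)) - \<sigma> * (f t (w1 t) - f t (w2 t))) (at t)"
            unfolding h_def E_def using l0
            by (auto intro!: derivative_eq_intros at1[OF dG1[OF tb(1)] tb(2,3)] at1[OF dG2[OF tb(1)] tb(2,3)])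
          have "\<sigma> * (f t (w1 t) - f t (w2 t)) \<le> \<bar>f t (w1 t) - f t (w2 t)\<bar>" using sg by auto
          also have "\<dots> \<le> Lam * \<bar>d t\<bar>" using lip[OF tb(1)] by (simp add: d_def)
          also have "\<dots> \<le> Lam * (D * exp (l * (t - a)))" using dD[OF tb(1)] Lam by (intro mult_left_mono) auto
          finally show "0 \<le> Lam * D * exp (l * (t - a)) - \<sigma> * (f t (w1 t) - f t (w2 t))" by simp
        qed (use \<open>s \<in> {a..b}\<close> in auto)
        moreover have "h a \<ge> 0"
        proof -
          have "Lam * D / l \<ge> 0" using Lam D0 l0 by simp
          moreover have "\<sigma> * (G1 a - G2 a) \<le> \<delta>" using sg by (auto simp: \<delta>_def)
          ultimately show ?thesis by (simp add: h_def E_def)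
        qed
        ultimately show ?thesis by (simp add: h_def)
      qed
      from this[of 1] this[of "-1"] show ?thesis by auto
    qed
    \<comment> \<open>the second bound keeps \<open>G1 + e\<close> and \<open>G1 - e\<close> in the fixed interval where \<open>psi\<close> is bounded\<close>
    define e where "e = min (E t0) (2 * B)"
    have e0: "e \<ge> 0" using Lam D0 l0 B by (simp add: e_def E_def \<delta>_def)
    have Ge: "\<bar>G1 s - G2 s\<bar> \<le> e" if "s \<in> {a..t0}" for s
    proof -
      have sb: "s \<in> {a..b}" using that t0 by auto
      have "E s \<le> E t0" unfolding E_def using that Lam D0 l0 by (intro add_left_mono mult_left_mono) auto
      then show ?thesis using Gd[OF sb] B1[OF sb] B2[OF sb] by (auto simp: e_def abs_le_iff)
    qed
    define Q where "Q = (\<lambda>s. P (G1 s + e) - P (G1 s - e))"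
    have Qb: "\<bar>Q s\<bar> \<le> 2 * e * (\<bar>psi (3 * B)\<bar> + 1)" if "s \<in> {a..b}" for s
    proof -
      have "e \<le> 2 * B" by (simp add: e_def)
      then have "\<bar>G1 s + e\<bar> \<le> 3 * B" "\<bar>G1 s - e\<bar> \<le> 3 * B" using B1[OF that] e0 by auto
      from Plip[OF this] show ?thesis using e0 by (simp add: Q_def mult.commute)
    qed
    have cP: "continuous_on UNIV P" using P by (meson DERIV_continuous_on has_field_derivative_at_within)
    have main: "\<sigma> * d t0 * f0 \<le> Q t0 - Q a" if sg: "\<sigma> = 1 \<or> \<sigma> = -1" for \<sigma> :: real
    proof -
      define h where "h = (\<lambda>t. Q t - \<sigma> * d t * f0)"
      have "h a \<le> h t0"
      proof (rule nonneg_derivative_imp_mono[where f = h and f' =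
            "\<lambda>t. (psi (G1 t + e) - psi (G1 t - e)) * f t (w1 t) - \<sigma> * (psi (G1 t) - psi (G2 t)) * f0"])
        show "continuous_on {a..t0} h" unfolding h_def Q_def d_def using t0(1)
          by (intro continuous_intros continuous_on_compose2[OF cP] continuous_on_subset[OF cw(1)]
              continuous_on_subset[OF cw(2)] continuous_on_subset[OF cw(3)]) auto
        fix t assume t: "a < t" "t < t0"
        then have tb: "t \<in> {a..b}" "a < t" "t < b" using t0 by auto
        have c: "((\<lambda>t. P (G1 t + x)) has_real_derivative psi (G1 t + x) * f t (w1 t)) (at t)" for x
          by (intro DERIV_chain2[OF P, where g = "\<lambda>t. G1 t + x"])
             (auto intro!: derivative_eq_intros at1[OF dG1[OF tb(1)] tb(2,3)])
        show "(h has_real_derivative (psi (G1 t + e) - psi (G1 t - e)) * f t (w1 t)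
            - \<sigma> * (psi (G1 t) - psi (G2 t)) * f0) (at t)"
          unfolding h_def Q_def d_def using c[of e] c[of "- e"]
          by (auto intro!: derivative_eq_intros at1[OF dw1[OF tb(1)] tb(2,3)] at1[OF dw2[OF tb(1)] tb(2,3)]
              simp: algebra_simps)
        have "t \<in> {a..t0}" using t by auto
        note g = Ge[OF this]
        have "psi (G1 t - e) \<le> psi (G1 t)" "psi (G1 t) \<le> psi (G1 t + e)"
          "psi (G1 t - e) \<le> psi (G2 t)" "psi (G2 t) \<le> psi (G1 t + e)"
          using g e0 by (auto intro!: monoD[OF psi(1)])
        then have "\<sigma> * (psi (G1 t) - psi (G2 t)) \<le> psi (G1 t + e) - psi (G1 t - e)"
          and nn: "0 \<le> psi (G1 t + e) - psi (G1 t - e)"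
          using sg by auto
        then have "\<sigma> * (psi (G1 t) - psi (G2 t)) * f0 \<le> (psi (G1 t + e) - psi (G1 t - e)) * f0"
          using f0 by (intro mult_right_mono) auto
        also have "\<dots> \<le> (psi (G1 t + e) - psi (G1 t - e)) * f t (w1 t)"
          using f0(2)[OF tb(1)] nn by (intro mult_left_mono) auto
        finally show "0 \<le> (psi (G1 t + e) - psi (G1 t - e)) * f t (w1 t) - \<sigma> * (psi (G1 t) - psi (G2 t)) * f0"
          by simp
      qed (use t0 in auto)
      then show ?thesis using w12 by (simp add: h_def d_def)
    qed
    have "\<bar>d t0\<bar> * f0 \<le> Q t0 - Q a" using main[of 1] main[of "-1"] by (auto simp: abs_if)
    also have "\<dots> \<le> 4 * e * (\<bar>psi (3 * B)\<bar> + 1)" using Qb[OF t0(1)] Qb[of a] ab by auto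
    finally have "\<bar>d t0\<bar> \<le> k * e" using f0 by (simp add: k_def field_simps)
    also have "\<dots> \<le> k * E t0" using k0 by (intro mult_left_mono) (auto simp: e_def)
    finally have "D \<le> k * E t0 * exp (- l * (t0 - a))" unfolding D_def by (intro mult_right_mono) auto
    also have "\<dots> = k * \<delta> * exp (- l * (t0 - a)) + k * Lam * D / l"
      using l0 by (simp add: E_def algebra_simps mult_exp_exp flip: exp_add)
    also have "k * Lam * D / l = D / 2" using k0 Lam by (simp add: l_def)
    also have "k * \<delta> * exp (- l * (t0 - a)) \<le> k * \<delta> * 1"
      using l0 t0 k0 by (intro mult_left_mono) (auto simp: \<delta>_def)
    finally have D: "D \<le> 2 * k * \<delta>" by simp
    have "\<bar>d b\<bar> \<le> D * exp (l * (b - a))" using dD ab by auto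
    also have "\<dots> \<le> 2 * k * \<delta> * exp (l * (b - a))" using D by (intro mult_right_mono) auto
    finally show "\<bar>w1 b - w2 b\<bar> \<le> 2 * k * exp (l * (b - a)) * \<bar>G1 a - G2 a\<bar>"
      by (simp add: d_def \<delta>_def mult_ac)
  qed
qed

text \<open>Shooting: the value at \<open>b\<close> is a continuous function of the initial flux and takes values on both sides of
  \<open>\<beta>\<close>, because the flux stays within \<open>f1 * (b - a)\<close> of its initial value.\<close>

lemma dirichlet_problem:
  fixes f :: "real \<Rightarrow> real \<Rightarrow> real" and psi phi P :: "real \<Rightarrow> real"
  assumes ab: "a < b" and psi: "mono psi" "\<And>x. psi (- x) = - psi x" "continuous_on UNIV psi"
    and phi: "\<And>x. psi (phi x) = x"
    and P: "\<And>x. (P has_real_derivative psi x) (at x)"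
    and cf: "\<And>w. continuous_on {a..b} w \<Longrightarrow> continuous_on {a..b} (\<lambda>s. f s (w s))"
    and fm: "\<And>s x y. s \<in> {a..b} \<Longrightarrow> x \<le> y \<Longrightarrow> f s x \<le> f s y"
    and f0: "0 < f0" "\<And>s x. s \<in> {a..b} \<Longrightarrow> f0 \<le> f s x"
    and f1: "\<And>s x. s \<in> {a..b} \<Longrightarrow> f s x \<le> f1"
    and lip: "\<And>s x y. s \<in> {a..b} \<Longrightarrow> \<bar>f s x - f s y\<bar> \<le> Lam * \<bar>x - y\<bar>"
  shows "\<exists>w G. w a = \<alpha> \<and> w b = \<beta> \<and> ivp_solution psi f a b w G"
proof -
  note at1 = has_derivative_within_Icc_imp_at
  define slope where "slope = phi ((\<beta> - \<alpha>) / (b - a))"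
  have f1': "0 < f1" using f0(1) f0(2)[of a 0] f1[of a 0] ab by auto
  define R where "R = f1 * (b - a)"
  define B where "B = \<bar>slope\<bar> + 2 * R"
  have R0: "R > 0" using f1' ab by (simp add: R_def)
  have B0: "B > 0" using R0 by (simp add: B_def)
  have "\<bar>f s x\<bar> \<le> f1" if "s \<in> {a..b}" for s x using f0(1) f0(2)[OF that, of x] f1[OF that, of x] by auto
  from initial_value_problem[where f = f and ?f1.0 = f1, OF ab psi(1,3) cf fm this]
  obtain w G where wa: "\<And>\<theta>. w \<theta> a = \<alpha>" and Ga: "\<And>\<theta>. G \<theta> a = \<theta>" and wG: "\<And>\<theta>. ivp_solution psi f a b (w \<theta>) (G \<theta>)"
    by metis
  have dw: "(w \<theta> has_real_derivative psi (G \<theta> s)) (at s within {a..b})"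
    and dG: "(G \<theta> has_real_derivative f s (w \<theta> s)) (at s within {a..b})" if "s \<in> {a..b}" for \<theta> s
    using wG[of \<theta>] that by (auto simp: ivp_solution_def)
  have cw: "continuous_on {a..b} (w \<theta>)" "continuous_on {a..b} (G \<theta>)" for \<theta>
    using DERIV_continuous_on[OF dw] DERIV_continuous_on[OF dG] by auto
  have Gb: "\<theta> \<le> G \<theta> s \<and> G \<theta> s \<le> \<theta> + R" if s: "s \<in> {a..b}" for \<theta> s
  proof
    have "G \<theta> a \<le> G \<theta> s"
    proof (rule nonneg_derivative_imp_mono[where f = "G \<theta>" and f' = "\<lambda>s. f s (w \<theta> s)"])
      show "(G \<theta> has_real_derivative f x (w \<theta> x)) (at x)" if "a < x" "x < s" for x
        using that s by (intro at1[OF dG]) auto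
      show "0 \<le> f x (w \<theta> x)" if "a < x" "x < s" for x
        using f0(1) f0(2)[of x "w \<theta> x"] that s by auto
    qed (use s in \<open>auto intro: continuous_on_subset[OF cw(2)]\<close>)
    then show "\<theta> \<le> G \<theta> s" by (simp add: Ga)
    have "f1 * a - G \<theta> a \<le> f1 * s - G \<theta> s"
    proof (rule nonneg_derivative_imp_mono[where f = "\<lambda>s. f1 * s - G \<theta> s" and f' = "\<lambda>s. f1 - f s (w \<theta> s)"])
      show "((\<lambda>s. f1 * s - G \<theta> s) has_real_derivative f1 - f x (w \<theta> x)) (at x)" if "a < x" "x < s" for x
        using that s by (auto intro!: derivative_eq_intros at1[OF dG])
      show "0 \<le> f1 - f x (w \<theta> x)" if "a < x" "x < s" for x
        using f1[of x "w \<theta> x"] that s by auto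
    qed (use s in \<open>auto intro!: continuous_intros continuous_on_subset[OF cw(2)]\<close>)
    moreover have "f1 * (s - a) \<le> R" using s f1' by (auto simp: R_def)
    ultimately show "G \<theta> s \<le> \<theta> + R" by (simp add: Ga algebra_simps)
  qed
  have mvt: "\<exists>z\<in>{a..b}. w \<theta> b - \<alpha> = (b - a) * psi (G \<theta> z)" for \<theta>
  proof -
    obtain l z where z: "a < z" "z < b" "(w \<theta> has_real_derivative l) (at z)" "w \<theta> b - w \<theta> a = (b - a) * l"
      using MVT[OF ab cw(1)[of \<theta>]] at1[OF dw[of _ \<theta>]] by (force simp: real_differentiable_def)
    have "l = psi (G \<theta> z)" using z by (intro DERIV_unique[OF z(3)] at1[OF dw]) auto
    then show ?thesis using z by (auto simp: wa intro!: bexI[of _ z])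
  qed
  define E where "E = (\<lambda>\<theta>. w \<theta> b)"
  have ps: "psi slope * (b - a) = \<beta> - \<alpha>" using ab by (simp add: slope_def phi)
  have "E (slope - R) \<le> \<beta>"
  proof -
    obtain z where z: "z \<in> {a..b}" "E (slope - R) - \<alpha> = (b - a) * psi (G (slope - R) z)"
      using mvt[of "slope - R"] by (auto simp: E_def)
    have "psi (G (slope - R) z) \<le> psi slope" using Gb[OF z(1), of "slope - R"] by (intro monoD[OF psi(1)]) auto
    then have "(b - a) * psi (G (slope - R) z) \<le> (b - a) * psi slope" using ab by (intro mult_left_mono) auto
    then show ?thesis using z(2) ps by (simp add: mult.commute)
  qed
  moreover have "\<beta> \<le> E slope"
  proof -
    obtain z where z: "z \<in> {a..b}" "E slope - \<alpha> = (b - a) * psi (G slope z)"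
      using mvt[of slope] by (auto simp: E_def)
    have "psi slope \<le> psi (G slope z)" using Gb[OF z(1), of slope] by (intro monoD[OF psi(1)]) auto
    then have "(b - a) * psi slope \<le> (b - a) * psi (G slope z)" using ab by (intro mult_left_mono) auto
    then show ?thesis using z(2) ps by (simp add: mult.commute)
  qed
  moreover have "continuous_on {slope - R..slope} E"
  proof -
    have lip': "\<bar>f s x - f s y\<bar> \<le> (\<bar>Lam\<bar> + 1) * \<bar>x - y\<bar>" if "s \<in> {a..b}" for s x y
      by (rule order_trans[OF lip[OF that] mult_right_mono]) auto
    have Lam': "0 < \<bar>Lam\<bar> + 1" by simp
    obtain K where K: "\<forall>w1 G1 w2 G2. w1 a = w2 a \<longrightarrow> ivp_solution psi f a b w1 G1 \<longrightarrow> ivp_solution psi f a b w2 G2 \<longrightarrow>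
      (\<forall>s\<in>{a..b}. \<bar>G1 s\<bar> \<le> B \<and> \<bar>G2 s\<bar> \<le> B) \<longrightarrow> \<bar>w1 b - w2 b\<bar> \<le> K * \<bar>G1 a - G2 a\<bar>"
      using shooting_dependence[where f = f, OF ab psi P f0 lip' B0 Lam'] by blast
    have Bb: "\<bar>G \<theta> s\<bar> \<le> B" if "\<theta> \<in> {slope - R..slope}" "s \<in> {a..b}" for \<theta> s
      using Gb[OF that(2), of \<theta>] that(1) R0 by (auto simp: B_def abs_le_iff)
    have "dist (E x) (E y) \<le> \<bar>K\<bar> * dist x y" if "x \<in> {slope - R..slope}" "y \<in> {slope - R..slope}" for x y
    proof -
      have "\<bar>w x b - w y b\<bar> \<le> K * \<bar>G x a - G y a\<bar>"
        using that by (intro K[rule_format] conjI wG Bb) (auto simp: wa)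
      also have "\<dots> \<le> \<bar>K\<bar> * \<bar>G x a - G y a\<bar>" by (intro mult_right_mono) auto
      finally show ?thesis by (simp add: E_def dist_real_def Ga)
    qed
    then show ?thesis
      by (intro uniformly_continuous_imp_continuous lipschitz_on_uniformly_continuous[of "\<bar>K\<bar>"] lipschitz_onI) auto
  qed
  ultimately obtain \<theta> where "E \<theta> = \<beta>"
    using IVT'[of E "slope - R" \<beta> slope] R0 by auto
  then show ?thesis using wa wG
    by (intro exI[of _ "w \<theta>"] exI[of _ "G \<theta>"]) (auto simp: E_def)
qed

section \<open>The equation in one dimension\<close>

locale emden_fowler =
  fixes p q m c :: real
  assumes p: "1 < p" and q: "p - 1 < q" and m: "- p < m" "m < - 1" and c: "0 < c"
begin

abbreviation psi :: "real \<Rightarrow> real" where "psi \<equiv> spow (1 / (p - 1))"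
abbreviation phi :: "real \<Rightarrow> real" where "phi \<equiv> spow (p - 1)"

text \<open>The sign \<open>e\<close> is \<open>1\<close> for absorption and \<open>- 1\<close> for the source equation. The flux \<open>G\<close> is a separate
  argument because \<open>w'\<close> itself need not be differentiable. Subsolutions and supersolutions refer to \<open>e = 1\<close>.\<close>

definition sol :: "real \<Rightarrow> real set \<Rightarrow> (real \<Rightarrow> real) \<Rightarrow> (real \<Rightarrow> real) \<Rightarrow> bool" where
  "sol e I w G \<longleftrightarrow> (\<forall>s\<in>I. 0 < w s \<and> (w has_real_derivative psi (G s)) (at s) \<and>
     (G has_real_derivative e * (c * s powr m * w s powr q)) (at s))"

definition subsol :: "real set \<Rightarrow> (real \<Rightarrow> real) \<Rightarrow> (real \<Rightarrow> real) \<Rightarrow> bool" where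
  "subsol I u U \<longleftrightarrow> (\<forall>s\<in>I. 0 < u s \<and> (u has_real_derivative psi (U s)) (at s) \<and>
     (\<exists>D\<ge>c * s powr m * u s powr q. (U has_real_derivative D) (at s)))"

definition supersol :: "real set \<Rightarrow> (real \<Rightarrow> real) \<Rightarrow> (real \<Rightarrow> real) \<Rightarrow> bool" where
  "supersol I v V \<longleftrightarrow> (\<forall>s\<in>I. 0 < v s \<and> (v has_real_derivative psi (V s)) (at s) \<and>
     (\<exists>D\<le>c * s powr m * v s powr q. (V has_real_derivative D) (at s)))"

lemma sol_imp_subsol: "sol 1 I w G \<Longrightarrow> subsol I w G"
  by (auto simp: sol_def subsol_def)

lemma sol_imp_supersol: "sol 1 I w G \<Longrightarrow> supersol I w G"
  by (auto simp: sol_def supersol_def)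

lemma sol_subset: "sol e I w G \<Longrightarrow> J \<subseteq> I \<Longrightarrow> sol e J w G"
  by (auto simp: sol_def)

lemma subsol_subset: "subsol I w G \<Longrightarrow> J \<subseteq> I \<Longrightarrow> subsol J w G"
  by (auto simp: subsol_def)

lemma supersol_subset: "supersol I w G \<Longrightarrow> J \<subseteq> I \<Longrightarrow> supersol J w G"
  by (auto simp: supersol_def)

lemma subsol_continuous: "subsol I u U \<Longrightarrow> continuous_on I u"
  unfolding subsol_def by (meson DERIV_isCont continuous_at_imp_continuous_on)

lemma supersol_continuous: "supersol I u U \<Longrightarrow> continuous_on I u"
  unfolding supersol_def by (meson DERIV_isCont continuous_at_imp_continuous_on)

lemma sol_continuous: "sol e I w G \<Longrightarrow> continuous_on I w" "sol e I w G \<Longrightarrow> continuous_on I G"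
  unfolding sol_def by (meson DERIV_isCont continuous_at_imp_continuous_on)+

lemma sol_deriv:
  assumes "sol e I w G" "s \<in> I"
  shows "0 < w s" "(w has_real_derivative psi (G s)) (at s)"
    "(G has_real_derivative e * (c * s powr m * w s powr q)) (at s)"
  using assms by (auto simp: sol_def)

lemma strict_mono_psi: "strict_mono psi"
  using p by (intro strict_mono_spow) auto

lemma psi_phi [simp]: "psi (phi x) = x"
  using p by (simp add: spow_spow')

lemma phi_psi [simp]: "phi (psi x) = x"
  using p by (simp add: spow_spow)

lemma psi_le_iff [simp]: "psi x \<le> psi y \<longleftrightarrow> x \<le> y"
  using p by (intro spow_le_iff) auto

lemma psi_less_iff [simp]: "psi x < psi y \<longleftrightarrow> x < y"
  using p by (intro spow_less_iff) auto

lemma psi_nonneg_iff [simp]: "0 \<le> psi x \<longleftrightarrow> 0 \<le> x" and psi_nonpos_iff [simp]: "psi x \<le> 0 \<longleftrightarrow> x \<le> 0"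
  and psi_pos_iff [simp]: "0 < psi x \<longleftrightarrow> 0 < x" and psi_neg_iff [simp]: "psi x < 0 \<longleftrightarrow> x < 0"
  using psi_le_iff[of 0 x] psi_le_iff[of x 0] psi_less_iff[of 0 x] psi_less_iff[of x 0]
  by (simp_all del: psi_le_iff psi_less_iff)

lemma source_mono: "0 < x \<Longrightarrow> x \<le> y \<Longrightarrow> c * s powr m * x powr q \<le> c * s powr m * y powr q"
  using c p q by (intro mult_left_mono powr_mono2) auto

lemma sub_super_choice:
  assumes "subsol I u U" "supersol I v V"
  obtains U' V' where "\<And>s. s \<in> I \<Longrightarrow> c * s powr m * u s powr q \<le> U' s \<and> (U has_real_derivative U' s) (at s)"
    "\<And>s. s \<in> I \<Longrightarrow> V' s \<le> c * s powr m * v s powr q \<and> (V has_real_derivative V' s) (at s)"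
proof -
  have "\<forall>s\<in>I. \<exists>D. c * s powr m * u s powr q \<le> D \<and> (U has_real_derivative D) (at s)"
    using assms(1) by (auto simp: subsol_def)
  moreover have "\<forall>s\<in>I. \<exists>D. D \<le> c * s powr m * v s powr q \<and> (V has_real_derivative D) (at s)"
    using assms(2) by (auto simp: supersol_def)
  ultimately show ?thesis using that by metis
qed

lemma sub_super_difference_increases:
  assumes u: "subsol {a<..<b} u U" "continuous_on {a..b} u"
    and v: "supersol {a<..<b} v V" "continuous_on {a..b} v"
    and "u a \<le> v a" "a \<le> t1" "v t1 < u t1" "t1 < t2" "t2 \<le> b"
  shows "u t1 - v t1 \<le> u t2 - v t2"
proof -
  obtain U' V' where U': "\<And>s. s \<in> {a<..<b} \<Longrightarrow> c * s powr m * u s powr q \<le> U' s \<and> (U has_real_derivative U' s) (at s)"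
    and V': "\<And>s. s \<in> {a<..<b} \<Longrightarrow> V' s \<le> c * s powr m * v s powr q \<and> (V has_real_derivative V' s) (at s)"
    using sub_super_choice[OF u(1) v(1)] by blast
  show ?thesis
  proof (rule difference_increases_once_positive[where a = a and b = b and U = U and V = V and U' = U' and V' = V',
        OF strict_mono_psi u(2) v(2)])
    fix s assume s: "a < s" "s < b"
    show "V' s \<le> U' s" if "v s < u s"
      using U'[of s] V'[of s] source_mono[of "v s" "u s" s] s that v(1) by (auto simp: supersol_def)
  qed (use assms U' V' in \<open>auto simp: subsol_def supersol_def\<close>)
qed

lemma sub_super_comparison:
  assumes u: "subsol {a<..<b} u U" "continuous_on {a..b} u"
    and v: "supersol {a<..<b} v V" "continuous_on {a..b} v"
    and ends: "u a \<le> v a" "u b \<le> v b" and t: "t \<in> {a..b}"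
  shows "u t \<le> v t"
proof (rule ccontr)
  assume n: "\<not> u t \<le> v t"
  then have "t < b" using t ends by (metis atLeastAtMost_iff less_eq_real_def)
  then have "u t - v t \<le> u b - v b"
    using n t by (intro sub_super_difference_increases[OF u v ends(1)]) auto
  then show False using n ends by auto
qed

lemma supersol_const: "0 < M \<Longrightarrow> supersol I (\<lambda>_. M) (\<lambda>_. 0)"
  unfolding supersol_def using c by (auto intro!: exI[of _ 0])

lemma supersol_linear: "(\<And>s. s \<in> I \<Longrightarrow> 0 < A + B * s) \<Longrightarrow> supersol I (\<lambda>s. A + B * s) (\<lambda>_. phi B)"
  unfolding supersol_def using c by (auto intro!: exI[of _ 0] derivative_eq_intros)

section \<open>The Dirichlet problem with positive data\<close>

text \<open>The source is truncated at the minimum \<open>\<mu>\<close> of the subsolution and at the maximum \<open>M\<close> of the boundary values,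
  which makes it Lipschitz and bounded away from \<open>0\<close>. By comparison the solution stays between \<open>u\<close> and \<open>M\<close>,
  where the truncation has no effect.\<close>

lemma dirichlet_above_subsol:
  assumes ab: "0 < a" "a < b" and u: "subsol {a<..<b} u U" "continuous_on {a..b} u"
    and upos: "\<And>s. s \<in> {a..b} \<Longrightarrow> 0 < u s" and \<alpha>: "u a \<le> \<alpha>" and \<beta>: "u b \<le> \<beta>"
  obtains w G where "sol 1 {a<..<b} w G" "continuous_on {a..b} w" "w a = \<alpha>" "w b = \<beta>"
    "\<And>s. s \<in> {a..b} \<Longrightarrow> u s \<le> w s"
proof -
  obtain t0 where t0: "t0 \<in> {a..b}" "\<And>s. s \<in> {a..b} \<Longrightarrow> u t0 \<le> u s"
    using continuous_attains_inf[OF _ _ u(2)] ab by auto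
  define \<mu> where "\<mu> = u t0"
  define M where "M = max \<alpha> \<beta>"
  define k where "k = (\<lambda>x. max \<mu> (min x M))"
  define f where "f = (\<lambda>s x. c * s powr m * k x powr q)"
  have \<mu>: "0 < \<mu>" using upos t0 by (simp add: \<mu>_def)
  have \<mu>M: "\<mu> \<le> M" using t0(2)[of a] ab \<alpha> by (auto simp: \<mu>_def M_def)
  have kb: "\<mu> \<le> k x" "k x \<le> M" for x using \<mu>M by (auto simp: k_def)
  have q0: "0 < q" using p q by linarith
  have kq: "\<mu> powr q \<le> k x powr q" "k x powr q \<le> M powr q" for x
    using kb[of x] \<mu> q0 by (auto intro!: powr_mono2)
  have sm: "b powr m \<le> s powr m" "s powr m \<le> a powr m" if "s \<in> {a..b}" for s
    using that ab m by (auto intro!: powr_mono2')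
  define L0 where "L0 = q * (\<mu> powr (q - 1) + M powr (q - 1))"
  have lipq: "\<bar>x powr q - y powr q\<bar> \<le> L0 * \<bar>x - y\<bar>" if "x \<in> {\<mu>..M}" "y \<in> {\<mu>..M}" for x y
  proof -
    have "norm (x powr q - y powr q) \<le> L0 * norm (x - y)"
    proof (rule field_differentiable_bound[of "{\<mu>..M}" _ "\<lambda>x. q * x powr (q - 1)"])
      fix z assume z: "z \<in> {\<mu>..M}"
      show "((\<lambda>x. x powr q) has_field_derivative q * z powr (q - 1)) (at z within {\<mu>..M})"
        using z \<mu> by (auto intro!: derivative_eq_intros)
      have "z powr (q - 1) \<le> \<mu> powr (q - 1) + M powr (q - 1)"
      proof (cases "q - 1 \<ge> 0")
        case True
        then have "z powr (q - 1) \<le> M powr (q - 1)" using z \<mu> by (intro powr_mono2) auto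
        then show ?thesis using powr_ge_zero[of \<mu> "q - 1"] by linarith
      next
        case False
        then have "z powr (q - 1) \<le> \<mu> powr (q - 1)" using z \<mu> by (intro powr_mono2') auto
        then show ?thesis using powr_ge_zero[of M "q - 1"] by linarith
      qed
      then show "norm (q * z powr (q - 1)) \<le> L0" using q0 by (simp add: L0_def abs_mult)
    qed (use that in auto)
    then show ?thesis by simp
  qed
  have cf: "continuous_on {a..b} (\<lambda>s. f s (w s))" if "continuous_on {a..b} w" for w
    unfolding f_def k_def using that \<mu> ab
    by (intro continuous_intros) (auto simp: max_def)
  have "\<exists>w G. w a = \<alpha> \<and> w b = \<beta> \<and> ivp_solution psi f a b w G"
  proof (rule dirichlet_problem[where phi = phi and P = "\<lambda>x. \<bar>x\<bar> powr (1 / (p - 1) + 1) / (1 / (p - 1) + 1)"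
        and ?f0.0 = "c * b powr m * \<mu> powr q" and ?f1.0 = "c * a powr m * M powr q" and Lam = "c * a powr m * L0"])
    show "((\<lambda>x. \<bar>x\<bar> powr (1 / (p - 1) + 1) / (1 / (p - 1) + 1)) has_real_derivative psi x) (at x)" for x
    proof -
      have "0 < 1 / (p - 1)" using p by simp
      then have "1 / (p - 1) + 1 \<noteq> 0" by linarith
      then show ?thesis
        by (intro DERIV_cong[OF DERIV_cdivide[OF DERIV_abs_powr[OF \<open>0 < 1 / (p - 1)\<close>]]])
           (rule nonzero_mult_div_cancel_left)
    qed
    show "mono psi" by (auto intro!: monoI)
    show "psi (- x) = - psi x" for x by (rule spow_minus)
    show "continuous_on UNIV psi" using p by (intro continuous_on_spow continuous_on_id) auto
    show "f s x \<le> f s y" if "x \<le> y" for s x y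
      unfolding f_def using that c \<mu> q0 kb[of x] by (intro mult_left_mono powr_mono2) (auto simp: k_def)
    show "0 < c * b powr m * \<mu> powr q" using c ab \<mu> by auto
    show "c * b powr m * \<mu> powr q \<le> f s x" if "s \<in> {a..b}" for s x
      unfolding f_def using c kq sm[OF that] by (intro mult_mono) auto
    show "f s x \<le> c * a powr m * M powr q" if "s \<in> {a..b}" for s x
      unfolding f_def using c kq sm[OF that] by (intro mult_mono) auto
    show "\<bar>f s x - f s y\<bar> \<le> c * a powr m * L0 * \<bar>x - y\<bar>" if "s \<in> {a..b}" for s x y
    proof -
      have "f s x - f s y = c * s powr m * (k x powr q - k y powr q)" by (simp add: f_def algebra_simps)
      then have "\<bar>f s x - f s y\<bar> = c * s powr m * \<bar>k x powr q - k y powr q\<bar>" using c by (simp add: abs_mult)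
      also have "\<dots> \<le> c * a powr m * (L0 * \<bar>k x - k y\<bar>)"
        using c sm[OF that] lipq[of "k x" "k y"] kb by (intro mult_mono) auto
      also have "\<dots> \<le> c * a powr m * (L0 * \<bar>x - y\<bar>)"
        using c q0 by (intro mult_left_mono) (auto simp: k_def L0_def)
      finally show ?thesis by (simp add: mult_ac)
    qed
  qed (use ab cf in auto)
  then obtain w G where w: "w a = \<alpha>" "w b = \<beta>"
    and dw: "\<And>s. s \<in> {a..b} \<Longrightarrow> (w has_real_derivative psi (G s)) (at s within {a..b})"
    and dG: "\<And>s. s \<in> {a..b} \<Longrightarrow> (G has_real_derivative f s (w s)) (at s within {a..b})" unfolding ivp_solution_def by blast
  have cw: "continuous_on {a..b} w" using DERIV_continuous_on[OF dw] .
  note at1 = has_derivative_within_Icc_imp_at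
  have dw': "(w has_real_derivative psi (G s)) (at s)" and dG': "(G has_real_derivative f s (w s)) (at s)"
    if "a < s" "s < b" for s using that by (auto intro!: at1[OF dw] at1[OF dG])
  have f_nonneg: "0 \<le> f s x" for s x unfolding f_def using c by simp
  have wM: "w s \<le> M" if "s \<in> {a..b}" for s
  proof (rule comparison_principle[where a = a and b = b and u = w and v = "\<lambda>_. M" and U = G and V = "\<lambda>_. 0"
         and U' = "\<lambda>s. f s (w s)" and V' = "\<lambda>_. 0", OF strict_mono_psi cw continuous_on_const])
    show "(w has_real_derivative psi (G x)) (at x)" "(G has_real_derivative f x (w x)) (at x)"
      if "a < x" "x < b" for x using dw' dG' that by auto
  qed (use that f_nonneg w in \<open>auto simp: M_def\<close>)
  have "\<forall>s\<in>{a<..<b}. \<exists>D. c * s powr m * u s powr q \<le> D \<and> (U has_real_derivative D) (at s)"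
    using u by (auto simp: subsol_def)
  then obtain U' where U': "\<And>s. s \<in> {a<..<b} \<Longrightarrow> c * s powr m * u s powr q \<le> U' s"
    "\<And>s. s \<in> {a<..<b} \<Longrightarrow> (U has_real_derivative U' s) (at s)" by metis
  have uw: "u s \<le> w s" if "s \<in> {a..b}" for s
  proof (rule comparison_principle[where a = a and b = b and u = u and v = w and U = U and V = G
         and V' = "\<lambda>s. f s (w s)" and U' = U', OF strict_mono_psi u(2) cw _ dw' _ dG'])
    fix s assume s: "a < s" "s < b"
    show "(u has_real_derivative psi (U s)) (at s)" using s u(1) by (auto simp: subsol_def)
    show "(U has_real_derivative U' s) (at s)" using U' s by auto
    assume "w s < u s"
    moreover have "\<mu> \<le> u s" using t0(2)[of s] s by (simp add: \<mu>_def)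
    ultimately have "k (w s) powr q \<le> u s powr q" using kb[of "w s"] \<mu> q0
      by (intro powr_mono2) (auto simp: k_def)
    then have "f s (w s) \<le> c * s powr m * u s powr q" unfolding f_def using c by (intro mult_left_mono) auto
    then show "f s (w s) \<le> U' s" using U'(1)[of s] s by auto
  qed (use that \<alpha> \<beta> w in auto)
  have "k (w s) = w s" if "s \<in> {a..b}" for s
    using uw[OF that] wM[OF that] t0(2)[OF that] by (auto simp: k_def \<mu>_def)
  moreover have "0 < w s" if "s \<in> {a..b}" for s using uw[OF that] upos[OF that] by linarith
  ultimately have "sol 1 {a<..<b} w G"
    using dw' dG' unfolding sol_def f_def by auto
  then show ?thesis using that cw w uw by blast
qed

section \<open>Limits of solutions\<close>

text \<open>Pointwise convergence suffices: solutions are convex, so bounds at the end points bound them and their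
  fluxes in between. Along a subsequence the flux at \<open>x0\<close> converges, and dominated convergence passes to the
  limit in both integrated equations.\<close>

lemma limit_of_solutions:
  assumes cd: "0 < x0" "x0 < x1" and sol: "\<And>n. sol 1 {x0..x1} (w n) (G n)"
    and lim: "\<And>s. s \<in> {x0..x1} \<Longrightarrow> (\<lambda>n::nat. w n s) \<longlonglongrightarrow> W s" and pos: "\<And>s. s \<in> {x0..x1} \<Longrightarrow> 0 < W s"
  shows "\<exists>H. sol 1 {x0<..<x1} W H"
proof -
  note d = sol_deriv[OF sol]
  define f where "f = (\<lambda>w::real\<Rightarrow>real. \<lambda>s. c * s powr m * w s powr q)"
  obtain M0 where M0: "\<And>n. norm (w n x0) \<le> M0"
    using lim[of x0] cd convergent_imp_Bseq[of "\<lambda>n. w n x0"] by (auto simp: Bseq_def convergent_def)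
  obtain M1 where M1: "\<And>n. norm (w n x1) \<le> M1"
    using lim[of x1] cd convergent_imp_Bseq[of "\<lambda>n. w n x1"] by (auto simp: Bseq_def convergent_def)
  define M where "M = max M0 M1"
  have Mb: "w n x0 \<le> M" "w n x1 \<le> M" for n using M0[of n] M1[of n] by (auto simp: M_def)
  have M: "0 < M" using Mb[of 0] d(1)[of x0 0] cd by auto
  have wM: "w n s \<le> M" if "s \<in> {x0..x1}" for n s
    by (rule sub_super_comparison[OF sol_imp_subsol[OF sol_subset[OF sol]] sol_continuous(1)[OF sol]
          supersol_const[OF M]]) (use that Mb in auto)
  define F where "F = c * x0 powr m * M powr q"
  have q0: "0 < q" using p q by linarith
  have fb: "0 \<le> f (w n) s" "f (w n) s \<le> F" if "s \<in> {x0..x1}" for n s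
  proof -
    have "w n s powr q \<le> M powr q" using wM[OF that, of n] d(1)[OF that, of n] q0 by (intro powr_mono2) auto
    moreover have "s powr m \<le> x0 powr m" using that cd m by (intro powr_mono2') auto
    ultimately show "f (w n) s \<le> F" unfolding f_def F_def using c by (intro mult_mono) auto
  qed (use c in \<open>simp add: f_def\<close>)
  have F0: "0 \<le> F" using c by (simp add: F_def)
  have cf: "continuous_on {x0..x1} (f (w n))" for n
    unfolding f_def using d(1)[of _ n] cd by (intro continuous_intros sol_continuous[OF sol]) force+
  have fin: "f (w n) integrable_on {x0..s}" if "s \<in> {x0..x1}" for n s
    using that by (intro integrable_continuous_real continuous_on_subset[OF cf]) auto
  have vd: "(f has_vector_derivative D) (at s within T) " if "(f has_real_derivative D) (at s)" for f :: "real \<Rightarrow> real" and D s T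
    using that by (simp add: has_real_derivative_iff_has_vector_derivative has_vector_derivative_at_within)
  have Geq: "(f (w n) has_integral G n s - G n x0) {x0..s}" if "s \<in> {x0..x1}" for n s
    using that by (intro fundamental_theorem_of_calculus vd) (auto simp: f_def intro!: d(3)[of _ n, simplified])
  have weq: "((\<lambda>t. psi (G n t)) has_integral w n s - w n x0) {x0..s}" if "s \<in> {x0..x1}" for n s
    using that by (intro fundamental_theorem_of_calculus vd) (auto intro!: d(2)[of _ n])
  define R where "R = F * (x1 - x0)"
  have Gd: "\<bar>G n s - G n x0\<bar> \<le> R" if "s \<in> {x0..x1}" for n s
  proof -
    have "norm (G n s - G n x0) \<le> F * norm (s - x0)"
      using fb[of _ n] d(3)[of _ n] that
      by (intro field_differentiable_bound[of "{x0..x1}" "G n" "f (w n)"])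
         (auto simp: f_def has_field_derivative_at_within)
    also have "\<dots> \<le> R" unfolding R_def using F0 that by (intro mult_left_mono) auto
    finally show ?thesis by simp
  qed
  define B where "B = phi (M / (x1 - x0)) + R"
  have GB: "\<bar>G n x0\<bar> \<le> B" for n
  proof -
    have "\<And>x. x0 \<le> x \<Longrightarrow> x \<le> x1 \<Longrightarrow> (w n has_real_derivative psi (G n x)) (at x)"
      using d(2)[of _ n] by auto
    then obtain z where z: "x0 < z" "z < x1" "w n x1 - w n x0 = (x1 - x0) * psi (G n z)"
      using MVT2[OF cd(2), of "w n" "\<lambda>x. psi (G n x)"] by blast
    define l where l: "l = psi (G n z)"
    have "\<bar>w n x1 - w n x0\<bar> \<le> M" using Mb[of n] d(1)[of x0 n] d(1)[of x1 n] cd by auto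
    then have "\<bar>l\<bar> \<le> M / (x1 - x0)" using z(3) cd by (simp add: l abs_mult field_simps)
    then have "psi (G n z) \<le> psi (phi (M / (x1 - x0)))" "psi (- phi (M / (x1 - x0))) \<le> psi (G n z)"
      unfolding l by (auto simp: spow_minus simp del: psi_le_iff)
    then have "\<bar>G n z\<bar> \<le> phi (M / (x1 - x0))" unfolding psi_le_iff by auto
    then show ?thesis using Gd[of z n] z by (auto simp: B_def)
  qed
  have "\<forall>n. G n x0 \<in> {-B..B}" using GB by (auto simp: abs_le_iff minus_le_iff)
  then obtain \<theta> r where r: "strict_mono r" "((\<lambda>n. G n x0) \<circ> r) \<longlonglongrightarrow> \<theta>"
    using seq_compactE[OF compact_imp_seq_compact[OF compact_Icc[of "-B" B]], of "\<lambda>n. G n x0"] by blast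
  define H where "H = (\<lambda>s. \<theta> + integral {x0..s} (f W))"
  have limf: "(\<lambda>n. f (w n) s) \<longlonglongrightarrow> f W s" if "s \<in> {x0..x1}" for s
    unfolding f_def using lim[OF that] pos[OF that] by (intro tendsto_intros) auto
  have dom: "f W integrable_on {x0..s}" "(\<lambda>n. integral {x0..s} (f (w n))) \<longlonglongrightarrow> integral {x0..s} (f W)"
    if "s \<in> {x0..x1}" for s
  proof -
    have b: "norm (f (w n) t) \<le> F" if "t \<in> {x0..s}" for n t
      using fb[of t n] that \<open>s \<in> {x0..x1}\<close> by auto
    have l: "(\<lambda>n. f (w n) t) \<longlonglongrightarrow> f W t" if "t \<in> {x0..s}" for t
      using limf that \<open>s \<in> {x0..x1}\<close> by auto
    show "f W integrable_on {x0..s}" "(\<lambda>n. integral {x0..s} (f (w n))) \<longlonglongrightarrow> integral {x0..s} (f W)"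
      using dominated_convergence[OF fin[OF that] integrable_const_ivl b l] by blast+
  qed
  have limG: "(\<lambda>n. G (r n) s) \<longlonglongrightarrow> H s" if "s \<in> {x0..x1}" for s
  proof -
    have "(\<lambda>n. G (r n) x0 + integral {x0..s} (f (w (r n)))) \<longlonglongrightarrow> H s"
      unfolding H_def using r(2) LIMSEQ_subseq_LIMSEQ[OF dom(2)[OF that] r(1)]
      by (intro tendsto_add) (auto simp: o_def)
    then show ?thesis using integral_unique[OF Geq[OF that]] by simp
  qed
  have cH: "continuous_on {x0..x1} H" unfolding H_def using dom(1)[of x1] cd
    by (intro continuous_intros indefinite_integral_continuous_1) auto
  have cpH: "continuous_on {x0..x1} (\<lambda>s. psi (H s))" using cH p by (intro continuous_intros) auto
  have psiB: "\<bar>psi (G n s)\<bar> \<le> psi (B + R)" if "s \<in> {x0..x1}" for n s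
  proof -
    have "G n s \<le> B + R" "- (B + R) \<le> G n s" using GB[of n] Gd[OF that, of n] by auto
    then have "psi (G n s) \<le> psi (B + R)" "psi (- (B + R)) \<le> psi (G n s)" unfolding psi_le_iff by linarith+
    then show ?thesis unfolding spow_minus by linarith
  qed
  have Weq: "W s = W x0 + integral {x0..s} (\<lambda>t. psi (H t))" if "s \<in> {x0..x1}" for s
  proof -
    have "(\<lambda>n. integral {x0..s} (\<lambda>t. psi (G (r n) t))) \<longlonglongrightarrow> integral {x0..s} (\<lambda>t. psi (H t))"
    proof (rule dominated_convergence(2)[where h = "\<lambda>_. psi (B + R)"])
      show "(\<lambda>t. psi (G (r n) t)) integrable_on {x0..s}" for n using weq[OF that] by blast
      show "norm (psi (G (r n) t)) \<le> psi (B + R)" if "t \<in> {x0..s}" for n t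
        using psiB[of t "r n"] that \<open>s \<in> {x0..x1}\<close> by auto
      show "(\<lambda>n. psi (G (r n) t)) \<longlonglongrightarrow> psi (H t)" if "t \<in> {x0..s}" for t
        using limG[of t] that \<open>s \<in> {x0..x1}\<close> p by (intro tendsto_spow) auto
    qed auto
    moreover have "(\<lambda>n. w (r n) s - w (r n) x0) \<longlonglongrightarrow> W s - W x0"
      using LIMSEQ_subseq_LIMSEQ[OF lim[OF that] r(1)] LIMSEQ_subseq_LIMSEQ[OF lim[of x0] r(1)] cd
      by (intro tendsto_diff) (auto simp: o_def)
    ultimately show ?thesis
      using LIMSEQ_unique[of "\<lambda>n. w (r n) s - w (r n) x0" "integral {x0..s} (\<lambda>t. psi (H t))" "W s - W x0"]
      by (simp add: integral_unique[OF weq[OF that]])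
  qed
  have dW: "(W has_real_derivative psi (H s)) (at s within {x0..x1})" if "s \<in> {x0..x1}" for s
  proof (rule has_field_derivative_transform_within[OF _ zero_less_one that])
    show "((\<lambda>s. W x0 + integral {x0..s} (\<lambda>t. psi (H t))) has_real_derivative psi (H s)) (at s within {x0..x1})"
      using integral_has_real_derivative[OF cpH that] by (auto intro!: derivative_eq_intros)
  qed (rule Weq[symmetric])
  have "continuous_on {x0..x1} W" using DERIV_continuous_on[OF dW] .
  then have cfW: "continuous_on {x0..x1} (f W)"
    unfolding f_def using pos cd by (intro continuous_intros) force+
  have dH: "(H has_real_derivative f W s) (at s within {x0..x1})" if "s \<in> {x0..x1}" for s
    unfolding H_def using integral_has_real_derivative[OF cfW that] by (auto intro!: derivative_eq_intros)
  have "sol 1 {x0<..<x1} W H"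
    unfolding sol_def using pos has_derivative_within_Icc_imp_at[OF dW] has_derivative_within_Icc_imp_at[OF dH]
    by (auto simp: f_def)
  then show ?thesis by blast
qed


text \<open>Local fluxes fit together because a flux is determined by the derivative of the solution.\<close>

lemma sol_localI:
  assumes "\<And>s. s \<in> I \<Longrightarrow> \<exists>x0 x1 H. x0 < s \<and> s < x1 \<and> sol e {x0<..<x1} W H"
  shows "sol e I W (\<lambda>s. phi (deriv W s))"
  unfolding sol_def
proof (intro ballI conjI)
  fix s assume "s \<in> I"
  then obtain x0 x1 H where H: "x0 < s" "s < x1" "sol e {x0<..<x1} W H" using assms by blast
  note d = sol_deriv[OF H(3)]
  have eq: "H t = phi (deriv W t)" if "t \<in> {x0<..<x1}" for t
    using DERIV_imp_deriv[OF d(2)[OF that]] by simp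
  have s: "s \<in> {x0<..<x1}" using H by auto
  show "0 < W s" "(W has_real_derivative psi (phi (deriv W s))) (at s)"
    using d[OF s] eq[OF s] by auto
  show "((\<lambda>s. phi (deriv W s)) has_real_derivative e * (c * s powr m * W s powr q)) (at s)"
    using has_field_derivative_transform_within_open[OF d(3)[OF s] open_greaterThanLessThan s eq] .
qed

section \<open>The Keller--Osserman bound\<close>

text \<open>The supersolution \<open>K * (r powr p' - \<bar>t - s\<bar> powr p') powr (- \<alpha>)\<close> with \<open>p' = p / (p - 1)\<close>, \<open>\<alpha> = p / (q - p + 1)\<close> is
  infinite at both ends of the interval, so it lies above every solution; its value at the centre is the bound.
  The exponent \<open>p'\<close> makes its flux equal to \<open>t - s\<close> times a power, which is differentiable at the centre.\<close>

lemma keller_osserman: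
  "\<exists>C>0. \<forall>s r w G. 0 < r \<longrightarrow> r < s \<longrightarrow> sol 1 {s - r..s + r} w G \<longrightarrow>
     w s powr (q - p + 1) \<le> C * r powr (- p) * (s + r) powr (- m)"
proof -
  define \<nu> where "\<nu> = q - p + 1"
  define \<alpha> where "\<alpha> = p / \<nu>"
  define p' where "p' = 1 / (p - 1) + 1"
  define e where "e = (\<alpha> + 1) * (p - 1)"
  define C0 where "C0 = (\<alpha> * p') powr (p - 1) * (1 + e * p')"
  have nu0: "0 < \<nu>" using q by (simp add: \<nu>_def)
  have al0: "0 < \<alpha>" using nu0 p by (simp add: \<alpha>_def)
  have p'0: "0 < p'" using p by (simp add: p'_def add_pos_pos)
  have e0: "0 < e" using al0 p by (simp add: e_def)
  have C0: "0 < C0" unfolding C0_def using al0 p'0 e0 by (intro mult_pos_pos add_pos_pos) auto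
  have pp: "p' * (p - 1) = p" using p by (simp add: p'_def field_simps)
  have alq: "- e - 1 = - \<alpha> * q" using nu0 by (simp add: e_def \<alpha>_def \<nu>_def field_simps)
  have alnu: "\<alpha> * \<nu> = p" using nu0 by (simp add: \<alpha>_def)
  show ?thesis
  proof (intro exI[of _ "C0 / c"] conjI allI impI)
    show "0 < C0 / c" using C0 c by simp
    fix s r w G
    assume r: "0 < r" "r < s" and sol: "sol 1 {s - r..s + r} w G"
    define R where "R = r powr p'"
    define h0 where "h0 = c * (s + r) powr m"
    define K where "K = (C0 * R / h0) powr (1 / \<nu>)"
    have R0: "0 < R" using r by (simp add: R_def)
    have h0: "0 < h0" using r c by (simp add: h0_def)
    have K0: "0 < K" using C0 R0 h0 by (simp add: K_def)
    have Knu: "h0 * K powr \<nu> = C0 * R" using C0 R0 h0 nu0 by (simp add: K_def powr_powr)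
    define Z where "Z = (\<lambda>t. R - \<bar>t - s\<bar> powr p')"
    define V where "V = (\<lambda>t. K * Z t powr (- \<alpha>))"
    define A where "A = (K * \<alpha> * p') powr (p - 1)"
    define U where "U = (\<lambda>t. A * (Z t powr (- e) * (t - s)))"
    have A0: "0 < A" using K0 al0 p'0 by (simp add: A_def)
    have Zpos: "0 < Z t" if "\<bar>t - s\<bar> < r" for t
      unfolding Z_def R_def using that p'0 by (simp add: powr_less_mono2)
    have dZ: "(Z has_real_derivative - (p' * psi (t - s))) (at t)" for t
    proof -
      have "0 < 1 / (p - 1)" using p by simp
      have "((\<lambda>t. t - s) has_real_derivative 1) (at t)" by (auto intro!: derivative_eq_intros)
      from DERIV_chain2[OF DERIV_abs_powr[OF \<open>0 < 1 / (p - 1)\<close>] this]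
      have "((\<lambda>t. \<bar>t - s\<bar> powr p') has_real_derivative p' * psi (t - s)) (at t)" by (simp add: p'_def)
      from DERIV_diff[OF DERIV_const this] show ?thesis unfolding Z_def by simp
    qed
    have super: "supersol {s - r<..<s + r} V U"
      unfolding supersol_def
    proof (intro ballI conjI)
      fix t assume "t \<in> {s - r<..<s + r}"
      then have t: "\<bar>t - s\<bar> < r" by auto
      note z = Zpos[OF t]
      show "0 < V t" using K0 z by (simp add: V_def)
      have "psi (U t) = A powr (1 / (p - 1)) * ((Z t powr (- e)) powr (1 / (p - 1)) * psi (t - s))"
        unfolding U_def using A0 by (simp add: spow_mult)
      also have "A powr (1 / (p - 1)) = K * \<alpha> * p'" using p K0 al0 p'0 by (simp add: A_def powr_powr)
      also have "(Z t powr (- e)) powr (1 / (p - 1)) = Z t powr (- \<alpha> - 1)"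
      proof -
        have "- e * (1 / (p - 1)) = - \<alpha> - 1" using p by (simp add: e_def)
        then show ?thesis by (simp only: powr_powr)
      qed
      finally have psiU: "psi (U t) = K * \<alpha> * p' * (Z t powr (- \<alpha> - 1) * psi (t - s))" .
      show "(V has_real_derivative psi (U t)) (at t)"
        unfolding V_def psiU using z
        by (auto intro!: derivative_eq_intros dZ simp: mult_ac)
      define D where "D = A * (Z t powr (- e) + e * p' * (Z t powr (- e - 1) * \<bar>t - s\<bar> powr p'))"
      have "psi (t - s) * (t - s) = \<bar>t - s\<bar> powr p'"
        by (auto simp: spow_def sgn_if p'_def powr_add abs_if)
      then have D: "D = A * (Z t powr (- e) + e * p' * (Z t powr (- e - 1) * (psi (t - s) * (t - s))))"
        by (simp add: D_def)
      have "(U has_real_derivative D) (at t)"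
        unfolding U_def D using z
        by (auto intro!: derivative_eq_intros dZ simp: mult_ac)
      moreover have "D \<le> c * t powr m * V t powr q"
      proof -
        have "Z t powr (- e) = Z t powr (- e - 1) * Z t" using powr_mult_base[of "Z t" "- e - 1"] z by (simp add: mult.commute)
        then have "D = A * Z t powr (- e - 1) * (Z t + e * p' * \<bar>t - s\<bar> powr p')" by (simp add: D_def algebra_simps)
        also have "\<dots> \<le> A * Z t powr (- e - 1) * (R + e * p' * R)"
        proof (intro mult_left_mono add_mono)
          show "\<bar>t - s\<bar> powr p' \<le> R" using z by (simp add: Z_def)
        qed (use A0 e0 p'0 in \<open>auto simp: Z_def\<close>)
        also have "\<dots> = K powr (p - 1) * (C0 * R) * Z t powr (- \<alpha> * q)"
          using K0 al0 p'0 unfolding alq by (simp add: A_def C0_def powr_mult algebra_simps)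
        also have "K powr (p - 1) * (C0 * R) = h0 * K powr q"
          using K0 by (simp add: Knu[symmetric] \<nu>_def powr_add[symmetric])
        also have "h0 * K powr q * Z t powr (- \<alpha> * q) = h0 * V t powr q"
          using K0 by (simp add: V_def powr_mult powr_powr)
        also have "\<dots> \<le> c * t powr m * V t powr q"
          unfolding h0_def using c t r m by (intro mult_right_mono mult_left_mono powr_mono2') auto
        finally show ?thesis .
      qed
      ultimately show "\<exists>D\<le>c * t powr m * V t powr q. (U has_real_derivative D) (at t)" by blast
    qed
    have "{s - r..s + r} \<noteq> {}" using r by auto
    then obtain t0 where "\<forall>t\<in>{s - r..s + r}. w t \<le> w t0" "t0 \<in> {s - r..s + r}"
      using continuous_attains_sup[OF compact_Icc _ sol_continuous(1)[OF sol]] by blast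
    then obtain M where M: "\<And>t. t \<in> {s - r..s + r} \<Longrightarrow> w t \<le> M" "0 < M" using sol_deriv(1)[OF sol] by blast
    \<comment> \<open>near the ends of the interval, where \<open>Z = \<eta>\<close>, the barrier is at least the maximum \<open>M\<close> of \<open>w\<close>\<close>
    define \<eta> where "\<eta> = min (R / 2) ((M / K) powr (- 1 / \<alpha>))"
    have eta: "0 < \<eta>" "\<eta> < R" using R0 M K0 by (auto simp: \<eta>_def)
    define \<rho> where "\<rho> = (R - \<eta>) powr (1 / p')"
    have rho: "0 < \<rho>" "\<rho> < r"
    proof -
      have "(R - \<eta>) powr (1 / p') < R powr (1 / p')" using eta p'0 by (intro powr_less_mono2) auto
      then show "\<rho> < r" using r p'0 by (simp add: \<rho>_def R_def powr_powr)
    qed (use eta in \<open>simp add: \<rho>_def\<close>)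
    have "\<rho> powr p' = R - \<eta>" using eta p'0 by (simp add: \<rho>_def powr_powr)
    then have Zr: "Z (s - \<rho>) = \<eta>" "Z (s + \<rho>) = \<eta>" using rho by (auto simp: Z_def)
    have MV: "M \<le> K * \<eta> powr (- \<alpha>)"
    proof -
      have "((M / K) powr (- 1 / \<alpha>)) powr (- \<alpha>) \<le> \<eta> powr (- \<alpha>)"
        using eta al0 by (intro powr_mono2') (auto simp: \<eta>_def)
      then show ?thesis using al0 M K0 by (simp add: powr_powr field_simps)
    qed
    have "w s \<le> V s"
    proof (rule sub_super_comparison[where u = w and v = V and U = G and V = U and t = s and a = "s - \<rho>" and b = "s + \<rho>"])
      show "subsol {s - \<rho><..<s + \<rho>} w G" using sol_imp_subsol[OF sol] rho by (auto intro: subsol_subset)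
      show "supersol {s - \<rho><..<s + \<rho>} V U" using super rho by (auto intro: supersol_subset)
      show "continuous_on {s - \<rho>..s + \<rho>} w"
        using rho by (intro continuous_on_subset[OF sol_continuous(1)[OF sol]]) auto
      show "continuous_on {s - \<rho>..s + \<rho>} V"
        using rho by (intro continuous_on_subset[OF supersol_continuous[OF super]]) auto
      show "w (s - \<rho>) \<le> V (s - \<rho>)" "w (s + \<rho>) \<le> V (s + \<rho>)"
        using M(1)[of "s - \<rho>"] M(1)[of "s + \<rho>"] rho MV by (auto simp: V_def Zr)
    qed (use rho in auto)
    also have "V s = K * R powr (- \<alpha>)" using p'0 by (simp add: V_def Z_def)
    finally have "w s powr \<nu> \<le> (K * R powr (- \<alpha>)) powr \<nu>"
      using sol_deriv(1)[OF sol, of s] r nu0 by (intro powr_mono2) auto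
    also have "\<dots> = C0 * R / h0 * R powr (- p)"
      using K0 R0 C0 h0 nu0 alnu by (simp add: K_def powr_mult powr_powr)
    also have "C0 * R / h0 * R powr (- p) = C0 / h0 * (R * R powr (- p))" by simp
    also have "R * R powr (- p) = r powr (- p)"
    proof -
      have "R * R powr (- p) = R powr (1 - p)" using R0 powr_mult_base[of R "- p"] by simp
      also have "\<dots> = r powr (- (p' * (p - 1)))" by (simp add: R_def powr_powr algebra_simps)
      finally show ?thesis by (simp add: pp)
    qed
    also have "C0 / h0 * r powr (- p) = C0 / c * r powr (- p) * (s + r) powr (- m)"
      by (simp add: h0_def powr_minus divide_inverse)
    finally show "w s powr (q - p + 1) \<le> C0 / c * r powr (- p) * (s + r) powr (- m)" by (simp add: \<nu>_def)
  qed
qed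

section \<open>Perron's method\<close>

text \<open>Solutions \<open>w n\<close> of Dirichlet problems above \<open>u\<close> that converge from below to the solution \<open>W\<close>.\<close>

definition perron_family ::
    "(nat \<Rightarrow> real) \<Rightarrow> (nat \<Rightarrow> real) \<Rightarrow> (nat \<Rightarrow> real) \<Rightarrow> (nat \<Rightarrow> real) \<Rightarrow> (real \<Rightarrow> real) \<Rightarrow>
      (nat \<Rightarrow> real \<Rightarrow> real) \<Rightarrow> (nat \<Rightarrow> real \<Rightarrow> real) \<Rightarrow> (real \<Rightarrow> real) \<Rightarrow> (real \<Rightarrow> real) \<Rightarrow> bool" where
  "perron_family a b \<alpha> \<beta> u w G W H \<longleftrightarrow>
    (\<forall>n. sol 1 {a n<..<b n} (w n) (G n) \<and> continuous_on {a n..b n} (w n) \<and>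
      w n (a n) = \<alpha> n \<and> w n (b n) = \<beta> n \<and> (\<forall>s\<in>{a n..b n}. u s \<le> w n s) \<and>
      (\<forall>s. a n < s \<and> s < b n \<longrightarrow> w n s \<le> W s \<and> (\<lambda>k. w k s) \<longlonglongrightarrow> W s)) \<and>
    sol 1 (\<Union>n. {a n<..<b n}) W H"

text \<open>At each end either the boundary values are those of the subsolution, or the end is fixed and the boundary
  values increase. In both cases \<open>w n \<le> w (Suc n)\<close> at the ends, hence everywhere by comparison.\<close>

lemma perron:
  fixes a b \<alpha> \<beta> :: "nat \<Rightarrow> real"
  assumes ab: "\<And>n. 0 < a n" "\<And>n. a n < b n" "\<And>n. a (Suc n) \<le> a n" "\<And>n. b n \<le> b (Suc n)"
    and u: "subsol J u U" "\<And>n. {a n..b n} \<subseteq> J"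
    and \<alpha>: "\<And>n. u (a n) \<le> \<alpha> n" "\<And>n. \<alpha> n = u (a n) \<or> a (Suc n) = a n \<and> \<alpha> n \<le> \<alpha> (Suc n)"
    and \<beta>: "\<And>n. u (b n) \<le> \<beta> n" "\<And>n. \<beta> n = u (b n) \<or> b (Suc n) = b n \<and> \<beta> n \<le> \<beta> (Suc n)"
  shows "\<exists>w G W H. perron_family a b \<alpha> \<beta> u w G W H"
proof -
  have "\<forall>n. \<exists>w G. sol 1 {a n<..<b n} w G \<and> continuous_on {a n..b n} w \<and> w (a n) = \<alpha> n \<and> w (b n) = \<beta> n
      \<and> (\<forall>s\<in>{a n..b n}. u s \<le> w s)"
  proof
    fix n
    have su: "subsol {a n..b n} u U" using subsol_subset[OF u(1) u(2)] .
    have pos: "0 < u s" if "s \<in> {a n..b n}" for s using su that by (auto simp: subsol_def)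
    have "subsol {a n<..<b n} u U" by (rule subsol_subset[OF su]) auto
    from dirichlet_above_subsol[OF ab(1,2) this subsol_continuous[OF su] pos \<alpha>(1) \<beta>(1)]
    show "\<exists>w G. sol 1 {a n<..<b n} w G \<and> continuous_on {a n..b n} w \<and> w (a n) = \<alpha> n \<and> w (b n) = \<beta> n
      \<and> (\<forall>s\<in>{a n..b n}. u s \<le> w s)" by metis
  qed
  then obtain w G where w: "\<And>n. sol 1 {a n<..<b n} (w n) (G n)" "\<And>n. continuous_on {a n..b n} (w n)"
    "\<And>n. w n (a n) = \<alpha> n" "\<And>n. w n (b n) = \<beta> n"
    and wu: "\<And>n s. s \<in> {a n..b n} \<Longrightarrow> u s \<le> w n s" by metis
  have amono: "a k \<le> a n" if "n \<le> k" for n k using lift_Suc_antimono_le[of a, OF ab(3) that] .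
  have bmono: "b n \<le> b k" if "n \<le> k" for n k using lift_Suc_mono_le[of b, OF ab(4) that] .
  have step: "w n s \<le> w (Suc n) s" if s: "s \<in> {a n..b n}" for n s
  proof (rule sub_super_comparison[OF sol_imp_subsol[OF w(1)] w(2) sol_imp_supersol[OF sol_subset[OF w(1)[of "Suc n"]]]
        continuous_on_subset[OF w(2)[of "Suc n"]] _ _ s])
    have "a n \<in> {a (Suc n)..b (Suc n)}" "b n \<in> {a (Suc n)..b (Suc n)}"
      using ab(2)[of n] ab(3,4)[of n] by auto
    from this[THEN wu]
    show "w n (a n) \<le> w (Suc n) (a n)" "w n (b n) \<le> w (Suc n) (b n)"
      using \<alpha>(2)[of n] \<beta>(2)[of n] w(3,4) by metis+
  qed (use ab(3,4)[of n] in auto)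
  have mono: "w n s \<le> w k s" if "n \<le> k" "s \<in> {a n..b n}" for n k s
    using that(1)
  proof (induction k rule: dec_induct)
    case (step k)
    then show ?case using \<open>\<And>n s. s \<in> {a n..b n} \<Longrightarrow> w n s \<le> w (Suc n) s\<close>[of s k] amono[of n k] bmono[of n k] that(2)
      by fastforce
  qed simp
  obtain C where C: "\<And>s r w G. 0 < r \<Longrightarrow> r < s \<Longrightarrow> sol 1 {s - r..s + r} w G \<Longrightarrow>
     w s powr (q - p + 1) \<le> C * r powr (- p) * (s + r) powr (- m)"
    using keller_osserman by blast
  have "\<exists>K. \<forall>k\<ge>n. w k s \<le> K" if "a n < s" "s < b n" for n s
  proof (intro exI allI impI)
    fix k assume k: "n \<le> k"
    \<comment> \<open>a radius that does not depend on \<open>k\<close>, so that the bound is uniform in \<open>k\<close>\<close>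
    define r where "r = min (s - a n) (b n - s) / 2"
    have r: "0 < r" "r < s - a n" "r < b n - s" using that by (auto simp: r_def min_def)
    have "w k s powr (q - p + 1) \<le> C * r powr (- p) * (s + r) powr (- m)"
      using r amono[OF k] bmono[OF k] ab(1)[of n] by (intro C[of _ _ "w k" "G k"] sol_subset[OF w(1)]) auto
    then have "(w k s powr (q - p + 1)) powr (1 / (q - p + 1)) \<le> (C * r powr (- p) * (s + r) powr (- m)) powr (1 / (q - p + 1))"
      using q by (intro powr_mono2) auto
    then show "w k s \<le> (C * r powr (- p) * (s + r) powr (- m)) powr (1 / (q - p + 1))"
      using sol_deriv(1)[OF w(1)[of k], of s] that amono[OF k] bmono[OF k] q by (simp add: powr_powr)
  qed
  then obtain K where wK: "w k s \<le> K n s" if "a n < s" "s < b n" "n \<le> k" for n k s by metis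
  have conv: "\<exists>L. (\<lambda>n. w n s) \<longlonglongrightarrow> L" if "a n < s" "s < b n" for n s
  proof -
    have "incseq (\<lambda>k. w (k + n) s)"
    proof (rule incseq_SucI)
      fix k
      have "a (k + n) \<le> s" "s \<le> b (k + n)" using amono[of n "k + n"] bmono[of n "k + n"] that by auto
      then show "w (k + n) s \<le> w (Suc k + n) s" using mono[of "k + n" "Suc k + n" s] by simp
    qed
    moreover have "\<forall>k. w (k + n) s \<le> K n s" using wK[OF that] by simp
    ultimately obtain L where "(\<lambda>k. w (k + n) s) \<longlonglongrightarrow> L"
      using incseq_convergent[of "\<lambda>k. w (k + n) s" "K n s"] by blast
    then show ?thesis using LIMSEQ_offset[of "\<lambda>k. w k s" n L] by blast
  qed
  define W where "W = (\<lambda>s. lim (\<lambda>n. w n s))"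
  have lim: "(\<lambda>n. w n s) \<longlonglongrightarrow> W s" if "a n < s" "s < b n" for n s
    using conv[OF that] by (auto simp: W_def convergent_LIMSEQ_iff[symmetric] convergent_def)
  have wW: "w n s \<le> W s" if "a n < s" "s < b n" for n s
    using lim[OF that] mono[of n _ s] that by (intro LIMSEQ_le_const) auto
  have "sol 1 (\<Union>n. {a n<..<b n}) W (\<lambda>s. phi (deriv W s))"
  proof (rule sol_localI)
    fix s assume "s \<in> (\<Union>n. {a n<..<b n})"
    then obtain n where n: "a n < s" "s < b n" by auto
    obtain x0 where x0: "a n < x0" "x0 < s" using dense n by blast
    obtain x1 where x1: "s < x1" "x1 < b n" using dense n by blast
    have sub: "{x0..x1} \<subseteq> {a (k + n)<..<b (k + n)}" for k
      using amono[of n "k + n"] bmono[of n "k + n"] x0 x1 by auto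
    have "\<exists>H. sol 1 {x0<..<x1} W H"
    proof (rule limit_of_solutions[where w = "\<lambda>k. w (k + n)" and G = "\<lambda>k. G (k + n)"])
      show "0 < x0" using ab(1)[of n] x0 by linarith
      show "x0 < x1" using x0 x1 by linarith
      show "sol 1 {x0..x1} (w (k + n)) (G (k + n))" for k
        by (rule sol_subset[OF w(1) sub])
      fix t assume t: "t \<in> {x0..x1}"
      then show "(\<lambda>k. w (k + n) t) \<longlonglongrightarrow> W t" using x0 x1 by (intro LIMSEQ_ignore_initial_segment lim[of n]) auto
      have "0 < w n t" using sol_deriv(1)[OF w(1)[of n], of t] t x0 x1 by auto
      also have "w n t \<le> W t" using t x0 x1 by (intro wW) auto
      finally show "0 < W t" .
    qed
    then show "\<exists>x0 x1 H. x0 < s \<and> s < x1 \<and> sol 1 {x0<..<x1} W H" using x0 x1 by blast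
  qed
  then show ?thesis using w wu wW lim unfolding perron_family_def
    by (intro exI[of _ w] exI[of _ G] exI[of _ W] exI[of _ "\<lambda>s. phi (deriv W s)"]) blast
qed

lemma perron_familyD:
  assumes "perron_family a b \<alpha> \<beta> u w G W H"
  shows "sol 1 {a n<..<b n} (w n) (G n)" "continuous_on {a n..b n} (w n)" "w n (a n) = \<alpha> n" "w n (b n) = \<beta> n"
    "s \<in> {a n..b n} \<Longrightarrow> u s \<le> w n s" "a n < s \<Longrightarrow> s < b n \<Longrightarrow> w n s \<le> W s"
    "a n < s \<Longrightarrow> s < b n \<Longrightarrow> (\<lambda>k. w k s) \<longlonglongrightarrow> W s" "sol 1 (\<Union>n. {a n<..<b n}) W H"
  using assms by (simp_all add: perron_family_def)

lemma perron_family_lower: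
  assumes P: "perron_family a b \<alpha> \<beta> u w G W H" and s: "s \<in> (\<Union>n. {a n<..<b n})"
  shows "u s \<le> W s"
proof -
  obtain n where n: "a n < s" "s < b n" using s by auto
  have "u s \<le> w n s" using n by (intro perron_familyD(5)[OF P]) auto
  also have "w n s \<le> W s" using n by (rule perron_familyD(6)[OF P])
  finally show ?thesis .
qed

lemma perron_family_upper:
  assumes P: "perron_family a b \<alpha> \<beta> u w G W H" and s: "s \<in> (\<Union>n. {a n<..<b n})"
    and ab: "\<And>n. a (Suc n) \<le> a n" "\<And>n. b n \<le> b (Suc n)"
    and B: "\<And>n. a n < s \<Longrightarrow> s < b n \<Longrightarrow> w n s \<le> B"
  shows "W s \<le> B"
proof -
  obtain n where n: "a n < s" "s < b n" using s by auto
  have "w k s \<le> B" if "n \<le> k" for k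
    using lift_Suc_antimono_le[of a, OF ab(1) that] lift_Suc_mono_le[of b, OF ab(2) that] n by (intro B) auto
  then show ?thesis by (intro LIMSEQ_le_const2[OF perron_familyD(7)[OF P n]]) auto
qed


section \<open>The power solution\<close>

text \<open>\<open>wst\<close> is \<open>w\<^sup>*\<close> in the variable \<open>s\<close> and \<open>Gst\<close> its flux. Integrating the equation twice from infinity
  defines an operator that is homogeneous of degree \<open>Qe\<close>.\<close>

definition nu :: real where "nu = q - p + 1"
definition be :: real where "be = (m + p) / nu"
definition Qe :: real where "Qe = q / (p - 1)"
definition ast :: real where "ast = (be powr (p - 1) * ((be + 1) * (p - 1)) / c) powr (1 / nu)"
definition wst :: "real \<Rightarrow> real" where "wst s = ast * s powr (- be)"
definition Gst :: "real \<Rightarrow> real" where "Gst s = - ((ast * be) powr (p - 1) * s powr (- (be + 1) * (p - 1)))"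

lemma nu_pos: "0 < nu" using q by (simp add: nu_def)
lemma q_pos: "0 < q" using p q by linarith
lemma be_pos: "0 < be" using nu_pos m by (simp add: be_def)
lemma Qe_gt1: "1 < Qe" using p q by (simp add: Qe_def)
lemma ast_pos: "0 < ast" unfolding ast_def using be_pos p c by simp
lemma wst_pos: "0 < s \<Longrightarrow> 0 < wst s" using ast_pos by (simp add: wst_def)

definition ae :: real where "ae = nu / (p - 1)"
definition bex :: real where "bex = (m + p) / (p - 1)"

lemma ae_pos: "0 < ae" and bex_pos: "0 < bex"
  using nu_pos p m by (auto simp: ae_def bex_def)

text \<open>The slope produced by the flux estimates: dividing by \<open>w powr (ae + 1)\<close> turns it into a bound on the
  derivative of \<open>w powr (- ae)\<close> by a multiple of the derivative of \<open>s powr bex\<close>.\<close>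

lemma psi_source_rate:
  assumes "0 \<le> k"
  shows "psi (k * x powr q * s powr (m + 1)) = k powr (1 / (p - 1)) * (x powr (ae + 1) * s powr (bex - 1))"
proof -
  have "psi (k * x powr q * s powr (m + 1)) = (k * x powr q * s powr (m + 1)) powr (1 / (p - 1))"
    using assms by (intro spow_nonneg) auto
  also have "\<dots> = k powr (1 / (p - 1)) * (x powr (q * (1 / (p - 1))) * s powr ((m + 1) * (1 / (p - 1))))"
    by (simp only: powr_mult powr_powr mult.assoc)
  also have "q * (1 / (p - 1)) = ae + 1" using p by (simp add: ae_def nu_def field_simps)
  also have "(m + 1) * (1 / (p - 1)) = bex - 1" using p by (simp add: bex_def field_simps)
  finally show ?thesis .
qed

lemma bex_ae: "bex / ae = be" using p by (simp add: be_def ae_def bex_def)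

lemma psi_Gst: "psi (Gst s) = - (ast * be * s powr (- be - 1))"
proof -
  have "psi (Gst s) = - psi ((ast * be) powr (p - 1) * s powr (- (be + 1) * (p - 1)))"
    unfolding Gst_def by (rule spow_minus)
  also have "psi ((ast * be) powr (p - 1) * s powr (- (be + 1) * (p - 1))) =
      ((ast * be) powr (p - 1) * s powr (- (be + 1) * (p - 1))) powr (1 / (p - 1))"
    by (intro spow_nonneg) auto
  also have "\<dots> = (ast * be) powr ((p - 1) * (1 / (p - 1))) * s powr (- (be + 1) * (p - 1) * (1 / (p - 1)))"
    by (simp only: powr_mult powr_ge_zero powr_powr)
  also have "(p - 1) * (1 / (p - 1)) = 1" using p by simp
  also have "- (be + 1) * (p - 1) * (1 / (p - 1)) = - be - 1" using p by simp
  finally show ?thesis using ast_pos be_pos by simp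
qed

lemma wst_sol: "sol 1 {0<..} wst Gst"
  unfolding sol_def
proof (intro ballI conjI)
  fix s :: real assume "s \<in> {0<..}"
  then have s: "0 < s" by simp
  show "0 < wst s" using wst_pos[OF s] .
  show "(wst has_real_derivative psi (Gst s)) (at s)"
    unfolding wst_def[abs_def] psi_Gst using s by (auto intro!: derivative_eq_intros)
  have e: "- (be + 1) * (p - 1) - 1 = m + (- be) * q"
  proof -
    have "be * (q - p + 1) = m + p" using nu_pos by (simp add: be_def nu_def)
    then show ?thesis by (simp add: algebra_simps)
  qed
  have "ast powr q = ast powr nu * ast powr (p - 1)" by (simp add: nu_def flip: powr_add)
  also have "ast powr nu = be powr (p - 1) * ((be + 1) * (p - 1)) / c"
    unfolding ast_def using nu_pos be_pos p c by (simp add: powr_powr)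
  finally have a: "c * ast powr q = (ast * be) powr (p - 1) * ((be + 1) * (p - 1))"
    using c ast_pos be_pos by (simp add: powr_mult)
  have "(Gst has_real_derivative (ast * be) powr (p - 1) * ((be + 1) * (p - 1) * s powr (- (be + 1) * (p - 1) - 1))) (at s)"
  proof -
    define E where "E = - (be + 1) * (p - 1)"
    have "((\<lambda>s. - ((ast * be) powr (p - 1) * s powr E)) has_real_derivative (ast * be) powr (p - 1) * (- E * s powr (E - 1))) (at s)"
      using s by (auto intro!: derivative_eq_intros)
    moreover have "- E = (be + 1) * (p - 1)" by (simp add: E_def algebra_simps)
    ultimately show ?thesis unfolding Gst_def[abs_def] by (simp only: E_def)
  qed
  also have "(ast * be) powr (p - 1) * ((be + 1) * (p - 1) * s powr (- (be + 1) * (p - 1) - 1)) =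
      c * ast powr q * s powr (m + (- be) * q)" unfolding a e by simp
  also have "\<dots> = 1 * (c * s powr m * wst s powr q)"
    unfolding wst_def powr_mult powr_powr powr_add by simp
  finally show "(Gst has_real_derivative 1 * (c * s powr m * wst s powr q)) (at s)" .
qed

lemma scaled_wst_derivs:
  assumes "0 < l" "0 < s"
  shows "((\<lambda>s. l * wst s) has_real_derivative psi (l powr (p - 1) * Gst s)) (at s)"
    "((\<lambda>s. l powr (p - 1) * Gst s) has_real_derivative l powr (p - 1) * (c * s powr m * wst s powr q)) (at s)"
proof -
  have "psi (l powr (p - 1) * Gst s) = (l powr (p - 1)) powr (1 / (p - 1)) * psi (Gst s)"
    by (intro spow_mult) auto
  also have "(l powr (p - 1)) powr (1 / (p - 1)) = l" using assms p by (simp add: powr_powr)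
  finally have "psi (l powr (p - 1) * Gst s) = l * psi (Gst s)" .
  then show "((\<lambda>s. l * wst s) has_real_derivative psi (l powr (p - 1) * Gst s)) (at s)"
    using sol_deriv(2)[OF wst_sol, of s] assms by (auto intro!: derivative_eq_intros)
  show "((\<lambda>s. l powr (p - 1) * Gst s) has_real_derivative l powr (p - 1) * (c * s powr m * wst s powr q)) (at s)"
    using sol_deriv(3)[OF wst_sol, of s] assms by (auto intro!: derivative_eq_intros)
qed

text \<open>The left-hand side of the equation scales like \<open>l powr (p - 1)\<close>, the right-hand side like \<open>l powr q\<close>.\<close>

lemma supersol_scaled_wst: "1 \<le> l \<Longrightarrow> supersol {0<..} (\<lambda>s. l * wst s) (\<lambda>s. l powr (p - 1) * Gst s)"
  unfolding supersol_def
proof (intro ballI conjI)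
  fix s :: real assume l: "1 \<le> l" and "s \<in> {0<..}"
  then have s: "0 < s" by simp
  show "0 < l * wst s" using wst_pos[OF s] l by simp
  show "((\<lambda>s. l * wst s) has_real_derivative psi (l powr (p - 1) * Gst s)) (at s)"
    using l s by (intro scaled_wst_derivs) auto
  have "l powr (p - 1) \<le> l powr q" using l q by (intro powr_mono) auto
  then have "l powr (p - 1) * (c * s powr m * wst s powr q) \<le> l powr q * (c * s powr m * wst s powr q)"
    using c by (intro mult_right_mono) auto
  also have "\<dots> = c * s powr m * (l * wst s) powr q" using l wst_pos[OF s] by (simp add: powr_mult)
  finally show "\<exists>D\<le>c * s powr m * (l * wst s) powr q. ((\<lambda>s. l powr (p - 1) * Gst s) has_real_derivative D) (at s)"
    using scaled_wst_derivs(2)[of l s] l s by (intro exI conjI) auto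
qed

lemma subsol_scaled_wst: "0 < l \<Longrightarrow> l \<le> 1 \<Longrightarrow> subsol {0<..} (\<lambda>s. l * wst s) (\<lambda>s. l powr (p - 1) * Gst s)"
  unfolding subsol_def
proof (intro ballI conjI)
  fix s :: real assume l: "0 < l" "l \<le> 1" and "s \<in> {0<..}"
  then have s: "0 < s" by simp
  show "0 < l * wst s" using wst_pos[OF s] l by simp
  show "((\<lambda>s. l * wst s) has_real_derivative psi (l powr (p - 1) * Gst s)) (at s)"
    using l s by (intro scaled_wst_derivs) auto
  have "l powr q \<le> l powr (p - 1)" using l q by (intro powr_mono') auto
  then have "l powr q * (c * s powr m * wst s powr q) \<le> l powr (p - 1) * (c * s powr m * wst s powr q)"
    using c by (intro mult_right_mono) auto
  moreover have "l powr q * (c * s powr m * wst s powr q) = c * s powr m * (l * wst s) powr q"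
    using l wst_pos[OF s] by (simp add: powr_mult)
  ultimately show "\<exists>D\<ge>c * s powr m * (l * wst s) powr q. ((\<lambda>s. l powr (p - 1) * Gst s) has_real_derivative D) (at s)"
    using scaled_wst_derivs(2)[of l s] l s by (intro exI conjI) auto
qed

section \<open>Behaviour at infinity\<close>

lemma powr_tendsto_0: "x < 0 \<Longrightarrow> ((\<lambda>s::real. s powr x) \<longlongrightarrow> 0) at_top"
  by (rule tendsto_neg_powr[OF _ filterlim_ident])

lemma powr_at_top: assumes "0 < x" shows "filterlim (\<lambda>s::real. s powr x) at_top at_top"
proof -
  have "filterlim (\<lambda>s::real. inverse (s powr (- x))) at_top at_top"
    using assms by (intro filterlim_inverse_at_top powr_tendsto_0)
      (auto intro: eventually_mono[OF eventually_gt_at_top[of 0]])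
  then show ?thesis by (simp add: powr_minus)
qed

lemma wst_tendsto_0: "(wst \<longlongrightarrow> 0) at_top"
  unfolding wst_def using be_pos by (intro tendsto_mult_right_zero powr_tendsto_0) auto

lemma Gst_tendsto_0: "(Gst \<longlongrightarrow> 0) at_top"
proof -
  have "((\<lambda>s. - ((ast * be) powr (p - 1) * s powr (- (be + 1) * (p - 1)))) \<longlongrightarrow> - 0) at_top"
    using be_pos p by (intro tendsto_minus tendsto_mult_right_zero powr_tendsto_0)
      (auto intro: mult_neg_pos simp del: minus_add_distrib)
  then show ?thesis by (simp add: Gst_def[abs_def])
qed

lemma nondecreasing_to_limit:
  fixes f f' :: "real \<Rightarrow> real"
  assumes lim: "(f \<longlongrightarrow> L) at_top"
    and d: "\<And>x. s0 < x \<Longrightarrow> (f has_real_derivative f' x) (at x)" and nn: "\<And>x. s0 < x \<Longrightarrow> 0 \<le> f' x"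
    and s: "s0 < s"
  shows "f s \<le> L"
proof (rule tendsto_lowerbound[OF lim])
  have "f s \<le> f x" if "s \<le> x" for x
  proof (rule nonneg_derivative_imp_mono[where f = f and f' = f', OF that])
    show "continuous_on {s..x} f"
      using s by (intro continuous_at_imp_continuous_on ballI DERIV_isCont[OF d]) auto
  qed (use s d nn in auto)
  then show "\<forall>\<^sub>F x in at_top. f s \<le> f x" using eventually_ge_at_top[of s] by (rule eventually_mono[rotated])
qed simp

lemma nonincreasing_to_limit:
  fixes f f' :: "real \<Rightarrow> real"
  assumes lim: "(f \<longlongrightarrow> L) at_top"
    and d: "\<And>x. s0 < x \<Longrightarrow> (f has_real_derivative f' x) (at x)" and nn: "\<And>x. s0 < x \<Longrightarrow> f' x \<le> 0"
    and s: "s0 < s"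
  shows "L \<le> f s"
  using nondecreasing_to_limit[of "\<lambda>x. - f x" "- L" s0 "\<lambda>x. - f' x" s] assms
  by (auto intro!: tendsto_minus DERIV_minus)

text \<open>Two integrations from infinity, each of which reverses the order.\<close>

lemma flux_order_imp_order:
  fixes u v U V U' V' :: "real \<Rightarrow> real"
  assumes u: "\<And>t. y < t \<Longrightarrow> (u has_real_derivative psi (U t)) (at t)"
    and v: "\<And>t. y < t \<Longrightarrow> (v has_real_derivative psi (V t)) (at t)"
    and U: "\<And>t. y < t \<Longrightarrow> (U has_real_derivative U' t) (at t)"
    and V: "\<And>t. y < t \<Longrightarrow> (V has_real_derivative V' t) (at t)"
    and lim: "(u \<longlongrightarrow> 0) at_top" "(v \<longlongrightarrow> 0) at_top" "(U \<longlongrightarrow> 0) at_top" "(V \<longlongrightarrow> 0) at_top"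
    and le: "\<And>t. y < t \<Longrightarrow> U' t \<le> V' t" and s: "y < s"
  shows "u s \<le> v s"
proof -
  have UV: "V t \<le> U t" if "y < t" for t
  proof -
    have "V t - U t \<le> 0"
      by (rule nondecreasing_to_limit[where f = "\<lambda>t. V t - U t" and f' = "\<lambda>t. V' t - U' t", OF _ _ _ that])
         (use tendsto_diff[OF lim(4,3)] le in \<open>auto intro!: DERIV_diff U V\<close>)
    then show ?thesis by simp
  qed
  have "u s - v s \<le> 0"
    by (rule nondecreasing_to_limit[where f = "\<lambda>t. u t - v t" and f' = "\<lambda>t. psi (U t) - psi (V t)", OF _ _ _ s])
       (use tendsto_diff[OF lim(1,2)] UV in \<open>auto intro!: DERIV_diff u v\<close>)
  then show ?thesis by simp
qed

lemma Qe_wst_tendsto: "((\<lambda>s. l powr Qe * wst s) \<longlongrightarrow> 0) at_top"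
  and Qe_Gst_tendsto: "((\<lambda>s. l powr q * Gst s) \<longlongrightarrow> 0) at_top"
  by (intro tendsto_mult_right_zero wst_tendsto_0 Gst_tendsto_0)+

lemma Qe_wst_derivs:
  assumes "0 < s"
  shows "((\<lambda>s. l powr Qe * wst s) has_real_derivative psi (l powr q * Gst s)) (at s)"
    "((\<lambda>s. l powr q * Gst s) has_real_derivative l powr q * (c * s powr m * wst s powr q)) (at s)"
proof -
  have "psi (l powr q * Gst s) = l powr Qe * psi (Gst s)" by (simp add: spow_mult powr_powr Qe_def)
  then show "((\<lambda>s. l powr Qe * wst s) has_real_derivative psi (l powr q * Gst s)) (at s)"
    using DERIV_cmult[OF sol_deriv(2)[OF wst_sol]] assms by simp
  show "((\<lambda>s. l powr q * Gst s) has_real_derivative l powr q * (c * s powr m * wst s powr q)) (at s)"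
    using DERIV_cmult[OF sol_deriv(3)[OF wst_sol]] assms by simp
qed

text \<open>The Keller--Osserman bound on an interval of length comparable with \<open>s\<close> scales exactly like \<open>wst\<close>.\<close>

lemma universal_bound:
  "\<exists>C>0. \<forall>s0 w G s. 0 \<le> s0 \<longrightarrow> sol 1 {s0<..} w G \<longrightarrow> 2 * s0 < s \<longrightarrow> w s \<le> C * wst s"
proof -
  obtain K where K: "0 < K" "\<And>s r w G. 0 < r \<Longrightarrow> r < s \<Longrightarrow> sol 1 {s - r..s + r} w G \<Longrightarrow>
     w s powr nu \<le> K * r powr (- p) * (s + r) powr (- m)"
    using keller_osserman unfolding nu_def by blast
  define C where "C = (K * (1/2) powr (- p) * (3/2) powr (- m)) powr (1 / nu)"
  have C: "0 < C" using K by (simp add: C_def)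
  show ?thesis
  proof (intro exI[of _ "C / ast"] conjI allI impI)
    show "0 < C / ast" using C ast_pos by simp
    fix s0 s :: real and w G assume s0: "0 \<le> s0" and sol: "sol 1 {s0<..} w G" and s: "2 * s0 < s"
    have s1: "0 < s" using s0 s by linarith
    have sol': "sol 1 {s - s / 2..s + s / 2} w G" using s by (intro sol_subset[OF sol]) auto
    have "w s powr nu \<le> K * (s / 2) powr (- p) * (s + s / 2) powr (- m)"
      using s1 by (intro K(2)[OF _ _ sol']) auto
    also have "s + s / 2 = 3 / 2 * s" by simp
    also have "s / 2 = 1 / 2 * s" by simp
    also have "K * (1 / 2 * s) powr (- p) * (3 / 2 * s) powr (- m) =
        (K * (1/2) powr (- p) * (3/2) powr (- m)) * s powr (- p + - m)"
      using s1 by (simp only: powr_mult powr_add) (simp add: mult_ac)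
    finally have "w s powr nu \<le> (K * (1/2) powr (- p) * (3/2) powr (- m)) * s powr (- p + - m)" .
    then have "(w s powr nu) powr (1 / nu) \<le> ((K * (1/2) powr (- p) * (3/2) powr (- m)) * s powr (- p + - m)) powr (1 / nu)"
      using nu_pos by (intro powr_mono2) auto
    also have "\<dots> = C * s powr ((- p + - m) * (1 / nu))" using K unfolding C_def
      by (simp only: powr_mult powr_powr)
    also have "(- p + - m) * (1 / nu) = - be" using nu_pos by (simp add: be_def field_simps)
    also have "(w s powr nu) powr (1 / nu) = w s"
      using nu_pos sol_deriv(1)[OF sol, of s] s s0 by (simp add: powr_powr)
    finally show "w s \<le> C / ast * wst s" using ast_pos by (simp add: wst_def)
  qed
qed

context
  fixes s0 w G assumes s0: "0 \<le> s0" and sol: "sol 1 {s0<..} w G"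
begin

lemma w_pos: "s0 < s \<Longrightarrow> 0 < w s"
  and w_deriv: "s0 < s \<Longrightarrow> (w has_real_derivative psi (G s)) (at s)"
  and G_deriv: "s0 < s \<Longrightarrow> (G has_real_derivative c * s powr m * w s powr q) (at s)"
  using sol_deriv[OF sol, of s] by auto

lemma cont_w: "s0 < x \<Longrightarrow> continuous_on {x..y} w" and cont_G: "s0 < x \<Longrightarrow> continuous_on {x..y} G"
  by (auto intro: continuous_on_subset[OF sol_continuous(1)[OF sol]] continuous_on_subset[OF sol_continuous(2)[OF sol]])

lemma w_tendsto_0: "(w \<longlongrightarrow> 0) at_top"
proof -
  obtain C where C: "0 < C" "\<And>s. 2 * s0 < s \<Longrightarrow> w s \<le> C * wst s" using universal_bound s0 sol by blast
  show ?thesis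
  proof (rule tendsto_sandwich[OF _ _ tendsto_const])
    show "\<forall>\<^sub>F s in at_top. 0 \<le> w s" using eventually_gt_at_top[of s0]
      by eventually_elim (use w_pos in \<open>auto intro: less_imp_le\<close>)
    show "\<forall>\<^sub>F s in at_top. w s \<le> C * wst s" using eventually_gt_at_top[of "2 * s0"]
      by eventually_elim (use C in auto)
    show "((\<lambda>s. C * wst s) \<longlongrightarrow> 0) at_top" using wst_tendsto_0 by (rule tendsto_mult_right_zero)
  qed
qed

lemma G_mono: assumes "s0 < x" "x \<le> y" shows "G x \<le> G y"
  by (rule nonneg_derivative_imp_mono[where f = G and f' = "\<lambda>s. c * s powr m * w s powr q"])
     (use assms c in \<open>auto intro!: cont_G G_deriv\<close>)

lemma w_convex: assumes "s0 < x" "x \<le> y" shows "w x + psi (G x) * (y - x) \<le> w y"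
proof -
  have "w x - psi (G x) * x \<le> w y - psi (G x) * y"
    by (rule nonneg_derivative_imp_mono[where f = "\<lambda>t. w t - psi (G x) * t" and f' = "\<lambda>t. psi (G t) - psi (G x)"])
       (use assms G_mono in \<open>auto intro!: derivative_eq_intros w_deriv continuous_intros cont_w\<close>)
  then show ?thesis by (simp add: algebra_simps)
qed

text \<open>A convex function that increases somewhere is bounded below by a positive constant near infinity, which
  contradicts the Keller--Osserman bound.\<close>

lemma G_nonpos: assumes "s0 < s" shows "G s \<le> 0"
proof (rule ccontr)
  assume G: "\<not> G s \<le> 0"
  have "w s \<le> w x" if "s \<le> x" for x
  proof -
    have "0 \<le> psi (G s) * (x - s)" using G that by simp
    then show ?thesis using w_convex[OF assms that] by linarith
  qed
  then have "w s \<le> 0"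
    by (intro tendsto_lowerbound[OF w_tendsto_0] eventually_mono[OF eventually_ge_at_top[of s]]) auto
  then show False using w_pos[OF assms] by simp
qed

lemma G_tendsto_0: "(G \<longlongrightarrow> 0) at_top"
proof (rule tendstoI)
  fix \<epsilon> :: real assume e: "0 < \<epsilon>"
  have "\<exists>s>s0. - \<epsilon> < G s"
  proof (rule ccontr)
    assume n: "\<not> (\<exists>s>s0. - \<epsilon> < G s)"
    define k where "k = psi \<epsilon>"
    have k: "0 < k" using e by (simp add: k_def)
    define x where "x = s0 + 1"
    define y where "y = x + w x / k"
    have xy: "s0 < x" "x < y" using w_pos[of x] k by (auto simp: x_def y_def)
    have "w y + k * y \<le> w x + k * x"
    proof (rule nonpos_derivative_imp_antimono[where f = "\<lambda>t. w t + k * t" and f' = "\<lambda>t. psi (G t) + k"])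
      show "psi (G t) + k \<le> 0" if "x < t" "t < y" for t
      proof -
        have "G t \<le> - \<epsilon>" using n that xy by (meson less_trans not_le)
        then have "psi (G t) \<le> psi (- \<epsilon>)" by simp
        then show ?thesis by (simp add: spow_minus k_def)
      qed
    qed (use xy in \<open>auto intro!: derivative_eq_intros w_deriv continuous_intros cont_w\<close>)
    then have "w y \<le> 0" using k by (simp add: y_def algebra_simps)
    then show False using w_pos[of y] xy by auto
  qed
  then obtain s where s: "s0 < s" "- \<epsilon> < G s" by blast
  show "\<forall>\<^sub>F x in at_top. dist (G x) 0 < \<epsilon>"
    using eventually_ge_at_top[of s]
  proof eventually_elim
    case (elim x)
    then show ?case using G_mono[OF s(1) elim] G_nonpos[of x] s by auto
  qed
qed

text \<open>Since \<open>w\<close> decreases, \<open>- G s\<close>, which is the integral of the source over \<open>(s, \<infinity>)\<close>, is at most its value with \<open>w\<close> frozen at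
  \<open>w s\<close>. The resulting inequality for \<open>w'\<close> integrates to \<open>w powr (- ae) \<le> C * s powr bex\<close>.\<close>

lemma w_lower_bound: "\<exists>k>0. \<forall>\<^sub>F s in at_top. k * wst s \<le> w s"
proof -
  define c1 where "c1 = c / (- m - 1)"
  have c1: "0 < c1" using c m by (simp add: c1_def)
  have mc1: "c1 * (m + 1) = - c" using m by (simp add: c1_def field_simps)
  have GH: "- G s \<le> c1 * w s powr q * s powr (m + 1)" if "s0 < s" for s
  proof -
    define H where "H = (\<lambda>s. - G s - c1 * (w s powr q * s powr (m + 1)))"
    have "(H \<longlongrightarrow> - 0 - c1 * (0 * 0)) at_top"
      unfolding H_def
    proof (intro tendsto_diff tendsto_minus tendsto_mult tendsto_const G_tendsto_0 powr_tendsto_0)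
      show "((\<lambda>x. w x powr q) \<longlongrightarrow> 0) at_top"
        by (rule tendsto_zero_powrI[OF w_tendsto_0 tendsto_const _ q_pos])
           (use w_pos in \<open>auto intro!: eventually_mono[OF eventually_gt_at_top[of s0]] less_imp_le\<close>)
    qed (use m in auto)
    then have lim: "(H \<longlongrightarrow> 0) at_top" by simp
    have "H s \<le> 0"
    proof (rule nondecreasing_to_limit[OF lim _ _ that])
      fix x assume x: "s0 < x"
      then have x0: "0 < x" using s0 by simp
      define X where "X = q * w x powr (q - 1) * psi (G x) * x powr (m + 1)"
      show "(H has_real_derivative - (c1 * X)) (at x)"
      proof -
        have A: "((\<lambda>s. w s powr q) has_real_derivative q * w x powr (q - 1) * psi (G x)) (at x)"
          using DERIV_fun_powr[OF w_deriv[OF x] w_pos[OF x], of q] by simp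
        have B: "((\<lambda>s. s powr (m + 1)) has_real_derivative (m + 1) * x powr m) (at x)"
          using x0 by (auto intro!: derivative_eq_intros)
        have "- (c * x powr m * w x powr q) - c1 * (q * w x powr (q - 1) * psi (G x) * x powr (m + 1) + (m + 1) * x powr m * w x powr q) =
            - (c1 * X) - (c + c1 * (m + 1)) * (x powr m * w x powr q)"
          by (simp add: X_def algebra_simps)
        then show ?thesis
          using DERIV_diff[OF DERIV_minus[OF G_deriv[OF x]] DERIV_cmult[OF DERIV_mult[OF A B], of c1]]
          unfolding H_def mc1 by simp
      qed
      have "X \<le> 0" unfolding X_def using G_nonpos[OF x] q_pos
        by (intro mult_nonpos_nonneg mult_nonneg_nonpos) auto
      then show "0 \<le> - (c1 * X)" using c1 by (simp add: mult_nonneg_nonpos)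
    qed
    then show ?thesis by (simp add: H_def)
  qed
  define c2 where "c2 = c1 powr (1 / (p - 1))"
  have c2: "0 < c2" using c1 by (simp add: c2_def)
  have w': "- psi (G s) \<le> c2 * (w s powr (ae + 1) * s powr (bex - 1))" if s: "s0 < s" for s
  proof -
    have "- psi (G s) = psi (- G s)" by (simp add: spow_minus)
    also have "\<dots> \<le> psi (c1 * w s powr q * s powr (m + 1))" using GH[OF s] by simp
    finally show ?thesis using psi_source_rate[of c1] c1 by (simp add: c2_def)
  qed
  define x where "x = s0 + 1"
  define C where "C = w x powr (- ae) + ae * c2 / bex"
  have x: "s0 < x" "1 \<le> x" using s0 by (auto simp: x_def)
  have C: "0 < C" using ae_pos bex_pos c2 by (simp add: C_def add_nonneg_pos)
  have up: "w s powr (- ae) \<le> C * s powr bex" if s: "x \<le> s" for s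
  proof -
    define f where "f = (\<lambda>s. w s powr (- ae) - ae * c2 / bex * s powr bex)"
    have "f s \<le> f x"
    proof (rule nonpos_derivative_imp_antimono[where f = f and
        f' = "\<lambda>s. - ae * w s powr (- ae - 1) * psi (G s) - ae * c2 * s powr (bex - 1)", OF s])
      fix t assume t: "x < t" "t < s"
      have t0: "s0 < t" "0 < t" using t x by auto
      show "(f has_real_derivative - ae * w t powr (- ae - 1) * psi (G t) - ae * c2 * t powr (bex - 1)) (at t)"
        unfolding f_def using bex_pos t0 w_pos[OF t0(1)] by (auto intro!: derivative_eq_intros w_deriv)
      have "ae * w t powr (- ae - 1) * (- psi (G t)) \<le> ae * w t powr (- ae - 1) * (c2 * (w t powr (ae + 1) * t powr (bex - 1)))"
        using w'[OF t0(1)] ae_pos by (intro mult_left_mono) auto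
      also have "\<dots> = ae * c2 * t powr (bex - 1) * (w t powr (- ae - 1) * w t powr (ae + 1))" by simp
      also have "w t powr (- ae - 1) * w t powr (ae + 1) = 1" using w_pos[OF t0(1)] by (simp flip: powr_add)
      finally show "- ae * w t powr (- ae - 1) * psi (G t) - ae * c2 * t powr (bex - 1) \<le> 0" by simp
    next
      have "w t \<noteq> 0" "t \<noteq> 0" if "t \<in> {x..s}" for t using w_pos[of t] that x by auto
      then show "continuous_on {x..s} f" unfolding f_def using x
        by (intro continuous_intros cont_w) auto
    qed
    then have "w s powr (- ae) \<le> w x powr (- ae) - ae * c2 / bex * x powr bex + ae * c2 / bex * s powr bex" by (simp add: f_def)
    also have "\<dots> \<le> w x powr (- ae) * 1 + ae * c2 / bex * s powr bex" using ae_pos bex_pos c2 by simp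
    also have "\<dots> \<le> w x powr (- ae) * s powr bex + ae * c2 / bex * s powr bex"
      using x s bex_pos by (intro add_right_mono mult_left_mono ge_one_powr_ge_zero) auto
    finally show ?thesis by (simp add: C_def algebra_simps)
  qed
  have "C powr (- 1 / ae) / ast * wst s \<le> w s" if s: "x \<le> s" for s
  proof -
    have s': "s0 < s" "0 < s" using s x by auto
    have "(C * s powr bex) powr (- 1 / ae) \<le> (w s powr (- ae)) powr (- 1 / ae)"
      using up[OF s] w_pos[OF s'(1)] ae_pos by (intro powr_mono2') auto
    also have "\<dots> = w s" using ae_pos w_pos[OF s'(1)] by (simp add: powr_powr)
    also have "(C * s powr bex) powr (- 1 / ae) = C powr (- 1 / ae) * s powr (bex * (- 1 / ae))"
      using C by (simp only: powr_mult powr_powr)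
    also have "bex * (- 1 / ae) = - be"
    proof -
      show ?thesis using bex_ae by simp
    qed
    finally show ?thesis using ast_pos by (simp add: wst_def)
  qed
  then show ?thesis using C ast_pos
    by (intro exI[of _ "C powr (- 1 / ae) / ast"] conjI eventually_mono[OF eventually_ge_at_top[of x]]) auto
qed

lemma improve_lower:
  assumes l: "0 < l" and ev: "\<forall>\<^sub>F s in at_top. l * wst s \<le> w s"
  shows "\<forall>\<^sub>F s in at_top. l powr Qe * wst s \<le> w s"
proof -
  obtain x where x: "\<And>s. x \<le> s \<Longrightarrow> l * wst s \<le> w s" using ev by (auto simp: eventually_at_top_linorder)
  note y = flux_order_imp_order[where U' = "\<lambda>s. l powr q * (c * s powr m * wst s powr q)" and V' = "\<lambda>s. c * s powr m * w s powr q",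
      OF _ _ _ _ Qe_wst_tendsto[of l] w_tendsto_0 Qe_Gst_tendsto[of l] G_tendsto_0]
  have "l powr Qe * wst s \<le> w s" if "max x s0 < s" for s
  proof (rule y[OF _ _ _ _ _ that])
    fix t assume "max x s0 < t"
    then have t: "s0 < t" "0 < t" "x \<le> t" using s0 by auto
    show "(w has_real_derivative psi (G t)) (at t)" "(G has_real_derivative c * t powr m * w t powr q) (at t)"
      using t by (auto intro!: w_deriv G_deriv)
    have "(l * wst t) powr q \<le> w t powr q" using x[OF t(3)] wst_pos[OF t(2)] l q_pos by (intro powr_mono2) auto
    then have "c * t powr m * (l * wst t) powr q \<le> c * t powr m * w t powr q" using c by (intro mult_left_mono) auto
    then show "l powr q * (c * t powr m * wst t powr q) \<le> c * t powr m * w t powr q"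
      using l wst_pos[OF t(2)] by (simp add: powr_mult mult_ac)
  qed (use s0 l in \<open>auto intro!: Qe_wst_derivs\<close>)
  then show ?thesis by (intro eventually_mono[OF eventually_gt_at_top[of "max x s0"]]) auto
qed

lemma improve_upper:
  assumes l: "0 < l" and ev: "\<forall>\<^sub>F s in at_top. w s \<le> l * wst s"
  shows "\<forall>\<^sub>F s in at_top. w s \<le> l powr Qe * wst s"
proof -
  obtain x where x: "\<And>s. x \<le> s \<Longrightarrow> w s \<le> l * wst s" using ev by (auto simp: eventually_at_top_linorder)
  note y = flux_order_imp_order[where V' = "\<lambda>s. l powr q * (c * s powr m * wst s powr q)" and U' = "\<lambda>s. c * s powr m * w s powr q",
      OF _ _ _ _ w_tendsto_0 Qe_wst_tendsto[of l] G_tendsto_0 Qe_Gst_tendsto[of l]]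
  have "w s \<le> l powr Qe * wst s" if "max x s0 < s" for s
  proof (rule y[OF _ _ _ _ _ that])
    fix t assume "max x s0 < t"
    then have t: "s0 < t" "0 < t" "x \<le> t" using s0 by auto
    show "(w has_real_derivative psi (G t)) (at t)" "(G has_real_derivative c * t powr m * w t powr q) (at t)"
      using t by (auto intro!: w_deriv G_deriv)
    have "w t powr q \<le> (l * wst t) powr q" using x[OF t(3)] w_pos[OF t(1)] q_pos by (intro powr_mono2) auto
    then have "c * t powr m * w t powr q \<le> c * t powr m * (l * wst t) powr q" using c by (intro mult_left_mono) auto
    then show "c * t powr m * w t powr q \<le> l powr q * (c * t powr m * wst t powr q)"
      using l wst_pos[OF t(2)] by (simp add: powr_mult mult_ac)
  qed (use s0 l in \<open>auto intro!: Qe_wst_derivs\<close>)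
  then show ?thesis by (intro eventually_mono[OF eventually_gt_at_top[of "max x s0"]]) auto
qed

lemma no_bump_above:
  assumes "1 \<le> l" "s0 < x" "x \<le> t" "t \<le> y" "w x \<le> l * wst x" "w y \<le> l * wst y"
  shows "w t \<le> l * wst t"
proof (rule sub_super_comparison[where a = x and b = y and v = "\<lambda>s. l * wst s" and V = "\<lambda>s. l powr (p - 1) * Gst s"])
  show "subsol {x<..<y} w G" using assms by (intro sol_imp_subsol sol_subset[OF sol]) auto
  show "continuous_on {x..y} w" using assms by (intro cont_w) auto
  show "supersol {x<..<y} (\<lambda>s. l * wst s) (\<lambda>s. l powr (p - 1) * Gst s)"
    using assms s0 by (intro supersol_subset[OF supersol_scaled_wst]) auto
  show "continuous_on {x..y} (\<lambda>s. l * wst s)"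
    using assms s0 by (intro continuous_on_subset[OF supersol_continuous[OF supersol_scaled_wst]]) auto
qed (use assms in auto)

lemma no_dip_below:
  assumes "0 < l" "l \<le> 1" "s0 < x" "x \<le> t" "t \<le> y" "l * wst x \<le> w x" "l * wst y \<le> w y"
  shows "l * wst t \<le> w t"
proof (rule sub_super_comparison[where a = x and b = y and u = "\<lambda>s. l * wst s" and U = "\<lambda>s. l powr (p - 1) * Gst s"])
  show "supersol {x<..<y} w G" using assms by (intro sol_imp_supersol sol_subset[OF sol]) auto
  show "continuous_on {x..y} w" using assms by (intro cont_w) auto
  show "subsol {x<..<y} (\<lambda>s. l * wst s) (\<lambda>s. l powr (p - 1) * Gst s)"
    using assms s0 by (intro subsol_subset[OF subsol_scaled_wst]) auto
  show "continuous_on {x..y} (\<lambda>s. l * wst s)"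
    using assms s0 by (intro continuous_on_subset[OF subsol_continuous[OF subsol_scaled_wst]]) auto
qed (use assms in auto)

lemma ex_powr_Qe_power_greater:
  assumes "1 < l" shows "\<exists>n. C < l powr (Qe ^ n)"
proof -
  obtain n where n: "ln (max 1 C) / ln l < Qe ^ n" using real_arch_pow[OF Qe_gt1] by blast
  have "max 1 C = exp (ln (max 1 C) / ln l * ln l)" using assms by simp
  also have "\<dots> < exp (Qe ^ n * ln l)"
    unfolding exp_less_cancel_iff using n assms by (intro mult_strict_right_mono) auto
  also have "\<dots> = l powr (Qe ^ n)" using assms by (simp add: powr_def)
  finally have "max 1 C < l powr (Qe ^ n)" .
  then show ?thesis by (intro exI[of _ n]) simp
qed

text \<open>Iterating \<open>improve_lower\<close> multiplies \<open>wst\<close> by \<open>l powr (Qe ^ n)\<close>, which exceeds the constant of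
  \<open>universal_bound\<close>.\<close>

lemma not_eventually_ge_above_1:
  assumes l: "1 < l" shows "\<not> (\<forall>\<^sub>F s in at_top. l * wst s \<le> w s)"
proof
  assume ev: "\<forall>\<^sub>F s in at_top. l * wst s \<le> w s"
  have iter: "\<forall>\<^sub>F s in at_top. l powr (Qe ^ n) * wst s \<le> w s" for n
  proof (induction n)
    case (Suc n)
    have "(l powr (Qe ^ n)) powr Qe = l powr (Qe ^ Suc n)" by (simp add: powr_powr mult.commute)
    then show ?case using improve_lower[OF _ Suc] l by simp
  qed (use ev l in simp)
  obtain C where C: "\<And>s. 2 * s0 < s \<Longrightarrow> w s \<le> C * wst s" using universal_bound s0 sol by blast
  obtain n where n: "C < l powr (Qe ^ n)" using ex_powr_Qe_power_greater[OF l] by blast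
  have "\<forall>\<^sub>F s in at_top. 2 * s0 < s \<and> l powr (Qe ^ n) * wst s \<le> w s"
    using iter[of n] eventually_gt_at_top[of "2 * s0"] by eventually_elim auto
  then obtain s where s: "2 * s0 < s" "l powr (Qe ^ n) * wst s \<le> w s"
    unfolding eventually_at_top_linorder by blast
  then have "l powr (Qe ^ n) * wst s \<le> C * wst s" using C[OF s(1)] by linarith
  then show False using n wst_pos[of s] s s0 by simp
qed

lemma not_eventually_le_below_1:
  assumes l: "0 < l" "l < 1" shows "\<not> (\<forall>\<^sub>F s in at_top. w s \<le> l * wst s)"
proof
  assume ev: "\<forall>\<^sub>F s in at_top. w s \<le> l * wst s"
  have iter: "\<forall>\<^sub>F s in at_top. w s \<le> l powr (Qe ^ n) * wst s" for n
  proof (induction n)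
    case (Suc n)
    have "(l powr (Qe ^ n)) powr Qe = l powr (Qe ^ Suc n)" by (simp add: powr_powr mult.commute)
    then show ?case using improve_upper[OF _ Suc] l by simp
  qed (use ev l in simp)
  obtain k where k: "0 < k" "\<forall>\<^sub>F s in at_top. k * wst s \<le> w s" using w_lower_bound by blast
  obtain n where "inverse k < (inverse l) powr (Qe ^ n)"
    using ex_powr_Qe_power_greater[of "inverse l"] l by (auto simp: one_less_inverse)
  then have n: "l powr (Qe ^ n) < k" using k l by (simp add: inverse_powr)
  have "\<forall>\<^sub>F s in at_top. 0 < s \<and> k * wst s \<le> w s \<and> w s \<le> l powr (Qe ^ n) * wst s"
    using iter[of n] k(2) eventually_gt_at_top[of 0] by eventually_elim auto
  then obtain s where s: "0 < s" "k * wst s \<le> w s" "w s \<le> l powr (Qe ^ n) * wst s"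
    unfolding eventually_at_top_linorder by blast
  then have "k * wst s \<le> l powr (Qe ^ n) * wst s" by linarith
  then show False using n wst_pos[of s] s by simp
qed

text \<open>Since \<open>w < l * wst\<close> at arbitrarily large points, a later point with \<open>w > l * wst\<close> would lie on a bump.\<close>

lemma eventually_le_above_1:
  assumes l: "1 < l" shows "\<forall>\<^sub>F s in at_top. w s \<le> l * wst s"
proof (rule ccontr)
  assume n: "\<not> (\<forall>\<^sub>F s in at_top. w s \<le> l * wst s)"
  obtain x where x: "s0 + 1 \<le> x" "w x < l * wst x"
    using not_eventually_ge_above_1[OF l] unfolding eventually_at_top_linorder by (meson not_le)
  obtain t where t: "x \<le> t" "l * wst t < w t" using n unfolding eventually_at_top_linorder by (meson not_le)
  obtain y where y: "t \<le> y" "w y < l * wst y"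
    using not_eventually_ge_above_1[OF l] unfolding eventually_at_top_linorder by (meson not_le)
  have "w t \<le> l * wst t" using x t y l by (intro no_bump_above[of l x t y]) auto
  then show False using t by simp
qed

lemma eventually_ge_below_1:
  assumes l: "0 < l" "l < 1" shows "\<forall>\<^sub>F s in at_top. l * wst s \<le> w s"
proof (rule ccontr)
  assume n: "\<not> (\<forall>\<^sub>F s in at_top. l * wst s \<le> w s)"
  obtain x where x: "s0 + 1 \<le> x" "l * wst x < w x"
    using not_eventually_le_below_1[OF l] unfolding eventually_at_top_linorder by (meson not_le)
  obtain t where t: "x \<le> t" "w t < l * wst t" using n unfolding eventually_at_top_linorder by (meson not_le)
  obtain y where y: "t \<le> y" "l * wst y < w y"
    using not_eventually_le_below_1[OF l] unfolding eventually_at_top_linorder by (meson not_le)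
  have "l * wst t \<le> w t" using x t y l by (intro no_dip_below[of l x t y]) auto
  then show False using t by simp
qed

lemma ratio_tendsto_1: "((\<lambda>s. w s / wst s) \<longlongrightarrow> 1) at_top"
proof (rule tendstoI)
  fix \<epsilon> :: real assume e: "0 < \<epsilon>"
  \<comment> \<open>the maximum keeps \<open>l\<close> positive for large \<open>\<epsilon>\<close>\<close>
  define l where "l = max (1/2) (1 - \<epsilon> / 2)"
  have l: "0 < l" "l < 1" "1 - \<epsilon> < l" using e by (auto simp: l_def)
  have "\<forall>\<^sub>F s in at_top. w s \<le> (1 + \<epsilon> / 2) * wst s" "\<forall>\<^sub>F s in at_top. l * wst s \<le> w s"
    using e l by (auto intro!: eventually_le_above_1 eventually_ge_below_1)
  then show "\<forall>\<^sub>F s in at_top. dist (w s / wst s) 1 < \<epsilon>"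
    using eventually_gt_at_top[of 0]
  proof eventually_elim
    case (elim s)
    then have "w s / wst s \<le> 1 + \<epsilon> / 2" "l \<le> w s / wst s"
      using wst_pos[of s] by (auto simp: field_simps)
    then show ?case using e l by (auto simp: dist_real_def abs_less_iff)
  qed
qed

end

section \<open>Nonexistence for the source equation\<close>

text \<open>The source keeps \<open>G\<close> above its mass beyond \<open>s\<close>, which for nondecreasing \<open>w\<close> is at least \<open>c1 * w s powr q * s powr
  (m + 1)\<close>. Hence \<open>w powr (- ae)\<close> decreases at least as fast as a negative multiple of \<open>s powr bex\<close> and cannot stay
  positive.\<close>

lemma no_source_solution:
  assumes s0: "0 \<le> s0" and sol: "sol (-1) {s0<..} w G"
  shows False
proof -
  have d: "0 < w s" "(w has_real_derivative psi (G s)) (at s)"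
    "(G has_real_derivative - (c * s powr m * w s powr q)) (at s)" if "s0 < s" for s
    using sol_deriv[OF sol, of s] that by auto
  have cont_w: "continuous_on {x..y} w" and cont_G: "continuous_on {x..y} G" if "s0 < x" for x y
    using that by (auto intro: continuous_on_subset[OF sol_continuous(1)[OF sol]] continuous_on_subset[OF sol_continuous(2)[OF sol]])
  have Gmono: "G y \<le> G x" if "s0 < x" "x \<le> y" for x y
    by (rule nonpos_derivative_imp_antimono[where f = G and f' = "\<lambda>s. - (c * s powr m * w s powr q)"])
       (use that c in \<open>auto intro!: cont_G d\<close>)
  have Gnn: "0 \<le> G x" if x: "s0 < x" for x
  proof (rule ccontr)
    assume "\<not> 0 \<le> G x"
    then have k: "psi (G x) < 0" by simp
    define y where "y = x - w x / psi (G x)"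
    have xy: "x < y" using k d(1)[OF x] by (simp add: y_def divide_pos_neg)
    have "w y - psi (G x) * y \<le> w x - psi (G x) * x"
      by (rule nonpos_derivative_imp_antimono[where f = "\<lambda>t. w t - psi (G x) * t" and f' = "\<lambda>t. psi (G t) - psi (G x)"])
        (use xy x Gmono in \<open>auto intro!: derivative_eq_intros d continuous_intros cont_w\<close>)
    then have "w y \<le> 0" using k by (simp add: y_def algebra_simps)
    then show False using d(1)[of y] x xy by auto
  qed
  have wmono: "w x \<le> w y" if "s0 < x" "x \<le> y" for x y
    by (rule nonneg_derivative_imp_mono[where f = w and f' = "\<lambda>s. psi (G s)"])
       (use that Gnn in \<open>auto intro!: cont_w d\<close>)
  define c1 where "c1 = c / (- m - 1)"
  have c1: "0 < c1" using c m by (simp add: c1_def)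
  have mc1: "c1 * (m + 1) = - c" using m by (simp add: c1_def field_simps)
  have GH: "c1 * w x powr q * x powr (m + 1) \<le> G x" if x: "s0 < x" for x
  proof -
    define H where "H = (\<lambda>s. G s - c1 * w x powr q * s powr (m + 1))"
    have "H y \<le> H x" if y: "x \<le> y" for y
    proof (rule nonpos_derivative_imp_antimono[where f = H and f' = "\<lambda>s. - (c * s powr m * w s powr q) + c * s powr m * w x powr q", OF y])
      show "continuous_on {x..y} H" unfolding H_def using x s0
        by (intro continuous_intros cont_G) auto
      fix s assume s: "x < s" "s < y"
      have "((\<lambda>s. c1 * w x powr q * s powr (m + 1)) has_real_derivative c1 * w x powr q * ((m + 1) * s powr (m + 1 - 1))) (at s)"
        using s x s0 by (auto intro!: derivative_eq_intros)
      also have "c1 * w x powr q * ((m + 1) * s powr (m + 1 - 1)) = c1 * (m + 1) * (s powr m * w x powr q)" by simp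
      finally have "((\<lambda>s. c1 * w x powr q * s powr (m + 1)) has_real_derivative - (c * s powr m * w x powr q)) (at s)"
        unfolding mc1 by (simp add: mult_ac)
      from DERIV_diff[OF d(3) this, of] s x
      show "(H has_real_derivative - (c * s powr m * w s powr q) + c * s powr m * w x powr q) (at s)"
        unfolding H_def by simp
      show "- (c * s powr m * w s powr q) + c * s powr m * w x powr q \<le> 0"
        using source_mono[of "w x" "w s" s] d(1)[OF x] wmono[OF x, of s] s by simp
    qed
    then have "\<forall>\<^sub>F y in at_top. - (c1 * w x powr q * y powr (m + 1)) \<le> H x"
    proof (intro eventually_mono[OF eventually_ge_at_top[of x]])
      fix y assume "x \<le> y"
      then show "- (c1 * w x powr q * y powr (m + 1)) \<le> H x"
        using \<open>\<And>y. x \<le> y \<Longrightarrow> H y \<le> H x\<close>[of y] Gnn[of y] x by (auto simp: H_def)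
    qed
    moreover have "((\<lambda>y. - (c1 * w x powr q * y powr (m + 1))) \<longlongrightarrow> - 0) at_top"
      using m by (intro tendsto_minus tendsto_mult_right_zero powr_tendsto_0) auto
    ultimately have "0 \<le> H x" using tendsto_upperbound[of "\<lambda>y. - (c1 * w x powr q * y powr (m + 1))" "- 0" at_top] by simp
    then show ?thesis by (simp add: H_def)
  qed
  define c2 where "c2 = c1 powr (1 / (p - 1))"
  have c2: "0 < c2" using c1 by (simp add: c2_def)
  have w': "c2 * (w s powr (ae + 1) * s powr (bex - 1)) \<le> psi (G s)" if s: "s0 < s" for s
  proof -
    have "psi (c1 * w s powr q * s powr (m + 1)) \<le> psi (G s)" using GH[OF s] by simp
    then show ?thesis using psi_source_rate[of c1] c1 by (simp add: c2_def)
  qed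
  define x where "x = s0 + 1"
  have x: "s0 < x" "0 < x" using s0 by (auto simp: x_def)
  define f where "f = (\<lambda>s. w s powr (- ae) + ae * c2 / bex * s powr bex)"
  have fx: "f s \<le> f x" if s: "x \<le> s" for s
  proof (rule nonpos_derivative_imp_antimono[where f = f and
      f' = "\<lambda>s. - ae * w s powr (- ae - 1) * psi (G s) + ae * c2 * s powr (bex - 1)", OF s])
    fix t assume t: "x < t" "t < s"
    have t0: "s0 < t" "0 < t" using t x by auto
    show "(f has_real_derivative - ae * w t powr (- ae - 1) * psi (G t) + ae * c2 * t powr (bex - 1)) (at t)"
      unfolding f_def using bex_pos t0 d(1)[OF t0(1)] by (auto intro!: derivative_eq_intros d)
    have "ae * c2 * t powr (bex - 1) * (w t powr (- ae - 1) * w t powr (ae + 1)) =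
        ae * w t powr (- ae - 1) * (c2 * (w t powr (ae + 1) * t powr (bex - 1)))" by simp
    also have "\<dots> \<le> ae * w t powr (- ae - 1) * psi (G t)"
      using w'[OF t0(1)] ae_pos by (intro mult_left_mono) auto
    also have "w t powr (- ae - 1) * w t powr (ae + 1) = 1" using d(1)[OF t0(1)] by (simp flip: powr_add)
    finally show "- ae * w t powr (- ae - 1) * psi (G t) + ae * c2 * t powr (bex - 1) \<le> 0" by simp
  next
    have "w t \<noteq> 0" "t \<noteq> 0" if "t \<in> {x..s}" for t using d(1)[of t] that x by auto
    then show "continuous_on {x..s} f" unfolding f_def using x
      by (intro continuous_intros cont_w) auto
  qed
  have "filterlim (\<lambda>s. ae * c2 / bex * s powr bex) at_top at_top"
    using ae_pos bex_pos c2 by (intro filterlim_tendsto_pos_mult_at_top[OF tendsto_const] powr_at_top) auto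
  then have "\<forall>\<^sub>F s in at_top. f x < ae * c2 / bex * s powr bex" by (simp add: filterlim_at_top_dense)
  then have "\<forall>\<^sub>F s in at_top. x \<le> s \<and> f x < ae * c2 / bex * s powr bex"
    using eventually_ge_at_top[of x] by eventually_elim auto
  then obtain s where s: "x \<le> s" "f x < ae * c2 / bex * s powr bex"
    unfolding eventually_at_top_linorder by blast
  then show False using fx[of s] powr_ge_zero[of "w s" "- ae"] unfolding f_def by linarith
qed


section \<open>Barriers and exhaustions\<close>

text \<open>The exponents make the flux a multiple of \<open>s powr (m + 1) * u powr q\<close>. The inequality then reduces to one
  between constants, which holds once \<open>B\<close> is large enough.\<close>

lemma regular_subsol:
  "\<exists>B U. 0 < B \<and> subsol {0<..} (\<lambda>s. (1 + B * s powr bex) powr (- 1 / ae)) U"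
proof -
  define B where "B = (c / (- m - 1)) powr (1 / (p - 1)) / be"
  define k where "k = (be * B) powr (p - 1)"
  have B: "0 < B" using c m be_pos by (simp add: B_def)
  have k: "k = c / (- m - 1)" using c m be_pos p by (simp add: k_def B_def powr_powr)
  have k0: "0 < k" using k c m by simp
  define Y where "Y = (\<lambda>s::real. 1 + B * s powr bex)"
  define u where "u = (\<lambda>s. Y s powr (- 1 / ae))"
  define U where "U = (\<lambda>s. - (k * (s powr (m + 1) * Y s powr (- q / ae))))"
  have "subsol {0<..} u U"
    unfolding subsol_def
  proof (intro ballI conjI)
    fix s :: real assume "s \<in> {0<..}"
    then have s: "0 < s" by simp
    have Y: "0 < Y s" using B by (simp add: Y_def add_pos_nonneg)
    then show "0 < u s" by (simp add: u_def)
    have dY: "(Y has_real_derivative B * (bex * s powr (bex - 1))) (at s)"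
      unfolding Y_def using s by (auto intro!: derivative_eq_intros)
    have "psi (U s) = - psi (k * (s powr (m + 1) * Y s powr (- q / ae)))"
      unfolding U_def by (rule spow_minus)
    also have "psi (k * (s powr (m + 1) * Y s powr (- q / ae))) = (k * (s powr (m + 1) * Y s powr (- q / ae))) powr (1 / (p - 1))"
      using k0 by (intro spow_nonneg) auto
    also have "\<dots> = (be * B) powr ((p - 1) * (1 / (p - 1))) * (s powr ((m + 1) * (1 / (p - 1))) * Y s powr (- q / ae * (1 / (p - 1))))"
      by (simp only: k_def powr_mult powr_powr)
    also have "(p - 1) * (1 / (p - 1)) = 1" using p by simp
    also have "(m + 1) * (1 / (p - 1)) = bex - 1" using p by (simp add: bex_def field_simps)
    also have "- q / ae * (1 / (p - 1)) = - 1 / ae - 1"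
    proof -
      have "- q / ae * (1 / (p - 1)) = - q / nu" using p by (simp add: ae_def)
      also have "\<dots> = - (p - 1) / nu - 1" using nu_pos by (simp add: nu_def field_simps)
      also have "\<dots> = - 1 / ae - 1" using p by (simp add: ae_def)
      finally show ?thesis .
    qed
    finally have psiU: "psi (U s) = - (be * B * (s powr (bex - 1) * Y s powr (- 1 / ae - 1)))"
      using be_pos B by simp
    show "(u has_real_derivative psi (U s)) (at s)"
    proof -
      have "(u has_real_derivative - 1 / ae * Y s powr (- 1 / ae - 1) * (B * (bex * s powr (bex - 1)))) (at s)"
        unfolding u_def using DERIV_fun_powr[OF dY Y, of "- 1 / ae"] by simp
      also have "- 1 / ae * Y s powr (- 1 / ae - 1) * (B * (bex * s powr (bex - 1))) = psi (U s)"
        unfolding psiU bex_ae[symmetric] by simp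
      finally show ?thesis .
    qed
    define X where "X = q / ae * Y s powr (- q / ae - 1) * (B * (bex * s powr (bex - 1))) * s powr (m + 1)"
    have X: "0 \<le> X" unfolding X_def using q_pos ae_pos bex_pos B by simp
    have "((\<lambda>s. s powr (m + 1)) has_real_derivative (m + 1) * s powr m) (at s)"
      using s by (auto intro!: derivative_eq_intros)
    from DERIV_minus[OF DERIV_cmult[OF DERIV_mult[OF this DERIV_fun_powr[OF dY Y, of "- q / ae"]], of k]]
    have "(U has_real_derivative - (k * (- X + (m + 1) * s powr m * Y s powr (- q / ae)))) (at s)"
      unfolding U_def by (rule DERIV_cong) (simp add: X_def mult_ac)
    moreover have "c * s powr m * u s powr q \<le> - (k * (- X + (m + 1) * s powr m * Y s powr (- q / ae)))"
    proof -
      have "- (k * (m + 1)) = c" using m by (simp add: k field_simps)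
      then have "- (k * (- X + (m + 1) * s powr m * Y s powr (- q / ae))) = k * X + c * (s powr m * Y s powr (- q / ae))"
        by (metis (no_types, opaque_lifting) add.commute distrib_left minus_add_distrib minus_mult_left minus_mult_minus mult.assoc mult_minus_left)
      moreover have "u s powr q = Y s powr (- q / ae)" by (simp add: u_def powr_powr)
      ultimately show ?thesis using X k0 by (simp add: mult.assoc)
    qed
    ultimately show "\<exists>D\<ge>c * s powr m * u s powr q. (U has_real_derivative D) (at s)" by blast
  qed
  then show ?thesis using B unfolding u_def Y_def by blast
qed

lemma regular_subsol_lt_1: "0 < B \<Longrightarrow> 0 < s \<Longrightarrow> (1 + B * s powr bex) powr (- 1 / ae) < 1"
  using ae_pos powr_less_mono2_neg[of "- 1 / ae" 1 "1 + B * s powr bex"] by simp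

lemma regular_subsol_tendsto: "0 < B \<Longrightarrow> ((\<lambda>s. (1 + B * s powr bex) powr (- 1 / ae)) \<longlongrightarrow> 1) (at_right 0)"
proof -
  have "((\<lambda>s::real. s powr bex) \<longlongrightarrow> 0) (at_right 0)"
    by (rule tendsto_zero_powrI[OF _ tendsto_const _ bex_pos])
       (auto intro: eventually_at_right_less[THEN eventually_mono])
  then have "((\<lambda>s. (1 + B * s powr bex) powr (- 1 / ae)) \<longlongrightarrow> (1 + B * 0) powr (- 1 / ae)) (at_right 0)"
    by (intro tendsto_intros) auto
  then show ?thesis by simp
qed

lemma eventually_inverse_shift_less:
  assumes "0 < s" shows "\<forall>\<^sub>F n in sequentially. 1 / (real n + 3) < s"
proof -
  have "filterlim (\<lambda>n. 3 + real n) at_top sequentially"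
    by (rule filterlim_tendsto_add_at_top[OF tendsto_const filterlim_real_sequentially])
  from order_tendstoD(2)[OF real_tendsto_divide_at_top[OF tendsto_const this, of 1] assms]
  show ?thesis by (simp add: add.commute)
qed

lemma UN_exhaust:
  fixes a b :: "nat \<Rightarrow> real"
  assumes "\<And>n. {a n<..<b n} \<subseteq> I" "\<And>s. s \<in> I \<Longrightarrow> \<forall>\<^sub>F n in sequentially. a n < s \<and> s < b n"
  shows "(\<Union>n. {a n<..<b n}) = I"
proof (intro equalityI subsetI)
  fix s assume "s \<in> I"
  then obtain n where "a n < s \<and> s < b n" using assms(2) unfolding eventually_sequentially by blast
  then show "s \<in> (\<Union>n. {a n<..<b n})" by auto
qed (use assms(1) in blast)

section \<open>Absorption solutions with prescribed behaviour\<close>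

lemma global_regular_solution:
  "\<exists>W H. sol 1 {0<..} W H \<and> (W \<longlongrightarrow> 1) (at_right 0)"
proof -
  obtain B U where B: "0 < B" and sub: "subsol {0<..} (\<lambda>s. (1 + B * s powr bex) powr (- 1 / ae)) U"
    using regular_subsol by blast
  define u where "u = (\<lambda>s. (1 + B * s powr bex) powr (- 1 / ae))"
  define a where "a = (\<lambda>n. 1 / (real n + 3))"
  define b where "b = (\<lambda>n. real n + 3)"
  have "\<exists>w G W H. perron_family a b (\<lambda>n. u (a n)) (\<lambda>n. u (b n)) u w G W H"
  proof (rule perron[where a = a and b = b and u = u and \<alpha> = "\<lambda>n. u (a n)" and \<beta> = "\<lambda>n. u (b n)" and J = "{0<..}" and U = U])
    show "a n < b n" for n
    proof -
      have "a n \<le> 1" "1 < b n" by (auto simp: a_def b_def)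
      then show ?thesis by simp
    qed
    then show "{a n..b n} \<subseteq> {0<..}" for n by (auto simp: a_def intro: less_le_trans[rotated])
  qed (use sub in \<open>auto simp: u_def a_def b_def frac_le\<close>)
  then obtain w G W H where P: "perron_family a b (\<lambda>n. u (a n)) (\<lambda>n. u (b n)) u w G W H" by blast
  note w = perron_familyD[OF P]
  have Un: "(\<Union>n. {a n<..<b n}) = {0<..}"
  proof (rule UN_exhaust)
    show "{a n<..<b n} \<subseteq> {0<..}" for n by (auto simp: a_def intro: less_trans[rotated])
    fix s :: real assume s: "s \<in> {0<..}"
    have "\<forall>\<^sub>F n in sequentially. s < b n"
      using filterlim_real_sequentially[unfolded filterlim_at_top_dense, rule_format, of s]
      by eventually_elim (simp add: b_def)
    then show "\<forall>\<^sub>F n in sequentially. a n < s \<and> s < b n"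
      using eventually_inverse_shift_less[of s] s by (auto simp: a_def intro: eventually_conj)
  qed
  have w1: "w n s \<le> 1" if "a n < s" "s < b n" for n s
  proof (rule sub_super_comparison[OF sol_imp_subsol[OF w(1)[where n = n]] w(2)[where n = n], where v = "\<lambda>_. 1"])
    show "supersol {a n<..<b n} (\<lambda>_. 1) (\<lambda>_. 0)" by (intro supersol_const) simp
    show "w n (a n) \<le> 1" using w(3)[where n = n] regular_subsol_lt_1[OF B, of "a n"] by (simp add: u_def a_def)
    show "w n (b n) \<le> 1" using w(4)[where n = n] regular_subsol_lt_1[OF B, of "b n"] by (simp add: u_def b_def)
  qed (use that in auto)
  have "u s \<le> W s \<and> W s \<le> 1" if "0 < s" for s
    using perron_family_lower[OF P, of s] perron_family_upper[OF P, of s 1] w1 that unfolding Un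
    by (auto simp: a_def b_def frac_le)
  then have "(W \<longlongrightarrow> 1) (at_right 0)"
    by (intro tendsto_sandwich[OF _ _ regular_subsol_tendsto[OF B] tendsto_const])
       (auto simp: u_def intro!: eventually_mono[OF eventually_at_right_less])
  then show ?thesis using w(8) unfolding Un by blast
qed

lemma eventually_above_boundary_at_left:
  fixes w W :: "real \<Rightarrow> real"
  assumes "continuous_on {a..b} w" "a < b" "\<And>s. a < s \<Longrightarrow> s < b \<Longrightarrow> w s \<le> W s" "z < w b"
  shows "\<forall>\<^sub>F s in at_left b. z < W s"
proof -
  have "(w \<longlongrightarrow> w b) (at_left b)"
    using assms(1,2) by (rule continuous_on_Icc_at_leftD)
  then have "\<forall>\<^sub>F s in at_left b. z < w s" using assms(4) by (rule order_tendstoD)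
  moreover have "\<forall>\<^sub>F s in at_left b. s \<in> {a<..<b}" using assms(2) by (rule eventually_at_left_real)
  ultimately show ?thesis by eventually_elim (use assms(3) in force)
qed

lemma eventually_above_boundary_at_right:
  fixes w W :: "real \<Rightarrow> real"
  assumes "continuous_on {a..b} w" "a < b" "\<And>s. a < s \<Longrightarrow> s < b \<Longrightarrow> w s \<le> W s" "z < w a"
  shows "\<forall>\<^sub>F s in at_right a. z < W s"
proof -
  have "(w \<longlongrightarrow> w a) (at_right a)"
    using assms(1,2) by (rule continuous_on_Icc_at_rightD)
  then have "\<forall>\<^sub>F s in at_right a. z < w s" using assms(4) by (rule order_tendstoD)
  moreover have "\<forall>\<^sub>F s in at_right a. s \<in> {a<..<b}" using assms(2) by (rule eventually_at_right_real)
  ultimately show ?thesis by eventually_elim (use assms(3) in force)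
qed

text \<open>The same subsolution forces \<open>W \<rightarrow> 1\<close> at \<open>0\<close> together with the line \<open>1 + s\<close>. The boundary value \<open>2\<close> at \<open>s = 1\<close>
  makes the solution increase somewhere, which is what excludes a global extension.\<close>

lemma local_regular_increasing_solution:
  "\<exists>W H. sol 1 {0<..<1} W H \<and> (W \<longlongrightarrow> 1) (at_right 0) \<and> (\<exists>t\<in>{0<..<1}. 0 < H t)"
proof -
  obtain B U where B: "0 < B" and sub: "subsol {0<..} (\<lambda>s. (1 + B * s powr bex) powr (- 1 / ae)) U"
    using regular_subsol by blast
  define u where "u = (\<lambda>s. (1 + B * s powr bex) powr (- 1 / ae))"
  have u1: "u s < 1" if "0 < s" for s using regular_subsol_lt_1[OF B that] by (simp add: u_def)
  define a where "a = (\<lambda>n. 1 / (real n + 3))"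
  have a: "0 < a n" "a n < 1" for n by (auto simp: a_def)
  have "\<exists>w G W H. perron_family a (\<lambda>_. 1) (\<lambda>n. u (a n)) (\<lambda>_. 2) u w G W H"
    using sub a u1[of 1]
    by (intro perron[where a = a and b = "\<lambda>_. 1" and u = u and \<alpha> = "\<lambda>n. u (a n)" and \<beta> = "\<lambda>_. 2" and J = "{0<..}" and U = U])
       (auto simp: u_def intro: less_le_trans[OF a(1)], auto simp: a_def frac_le)
  then obtain w G W H where P: "perron_family a (\<lambda>_. 1) (\<lambda>n. u (a n)) (\<lambda>_. 2) u w G W H" by blast
  note w = perron_familyD[OF P]
  have Un: "(\<Union>n. {a n<..<1}) = {0<..<1}"
  proof (rule UN_exhaust)
    show "{a n<..<1} \<subseteq> {0<..<1}" for n using a(1)[of n] by (auto intro: less_trans)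
  qed (use eventually_inverse_shift_less in \<open>auto simp: a_def\<close>)
  have w1: "w n s \<le> 1 + 1 * s" if "a n < s" "s < 1" for n s
  proof (rule sub_super_comparison[OF sol_imp_subsol[OF w(1)[where n = n]] w(2)[where n = n], where v = "\<lambda>s. 1 + 1 * s"])
    show "supersol {a n<..<1} (\<lambda>s. 1 + 1 * s) (\<lambda>_. phi 1)" using a[of n] by (intro supersol_linear) auto
    show "w n (a n) \<le> 1 + 1 * a n" using w(3)[where n = n] u1[of "a n"] a[of n] by simp
  qed (use that w(4) in \<open>auto intro!: continuous_intros\<close>)
  have "u s \<le> W s \<and> W s \<le> 1 + s" if "0 < s" "s < 1" for s
    using perron_family_lower[OF P, of s] perron_family_upper[OF P, of s "1 + s"] w1 that unfolding Un
    by (auto simp: a_def frac_le)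
  moreover have "((\<lambda>s::real. 1 + s) \<longlongrightarrow> 1 + 0) (at_right 0)" by (intro tendsto_intros)
  ultimately have lim: "(W \<longlongrightarrow> 1) (at_right 0)"
    using eventually_at_right_real[of 0 "1::real"]
    by (intro tendsto_sandwich[OF _ _ regular_subsol_tendsto[OF B], of W "\<lambda>s. 1 + s"])
       (auto simp: u_def elim!: eventually_mono)
  have sol: "sol 1 {0<..<1} W H" using w(8) unfolding Un .
  have "\<forall>\<^sub>F s in at_left 1. 3/2 < W s"
    using w(4)[where n = 0] w(6)[where n = 0] a[of 0] by (intro eventually_above_boundary_at_left[OF w(2)[where n = 0]]) auto
  moreover have "\<forall>\<^sub>F s in at_left 1. s \<in> {0<..<1::real}" by (rule eventually_at_left_real) simp
  ultimately have "\<forall>\<^sub>F s in at_left 1. 3/2 < W s \<and> s \<in> {0<..<1::real}" by eventually_elim auto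
  then obtain y where y: "3/2 < W y" "0 < y" "y < 1" using eventually_happens'[OF trivial_limit_at_left_real] by auto
  have "\<forall>\<^sub>F s in at_right 0. W s < 3/2" using order_tendstoD(2)[OF lim, of "3/2"] by simp
  moreover have "\<forall>\<^sub>F s in at_right 0. s \<in> {0<..<y}" using y by (intro eventually_at_right_real)
  ultimately have "\<forall>\<^sub>F s in at_right 0. W s < 3/2 \<and> s \<in> {0<..<y}" by eventually_elim auto
  then obtain x where x: "W x < 3/2" "0 < x" "x < y" using eventually_happens'[OF trivial_limit_at_right_real] by auto
  have "\<exists>z. x < z \<and> z < y \<and> W y - W x = (y - x) * psi (H z)"
    using x y by (intro MVT2 sol_deriv(2)[OF sol]) auto
  then obtain z where z: "x < z" "z < y" "W y - W x = (y - x) * psi (H z)" by blast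
  then have "0 < (y - x) * psi (H z)" using x y by simp
  then have "0 < H z" using x by (simp add: zero_less_mult_iff)
  then show ?thesis using sol lim z x y by (intro exI[of _ W] exI[of _ H]) (auto intro!: bexI[of _ z])
qed

lemma wst_at_right_0: "filterlim wst at_top (at_right 0)"
proof -
  have "((\<lambda>s::real. s powr be) \<longlongrightarrow> 0) (at_right 0)"
    by (rule tendsto_zero_powrI[OF _ tendsto_const _ be_pos])
       (auto intro: eventually_at_right_less[THEN eventually_mono])
  then have "filterlim (\<lambda>s::real. inverse (s powr be)) at_top (at_right 0)"
    by (intro filterlim_inverse_at_top) (auto intro: eventually_mono[OF eventually_at_right_less])
  then have "filterlim (\<lambda>s. ast * s powr - be) at_top (at_right 0)"
    using ast_pos by (intro filterlim_tendsto_pos_mult_at_top[OF tendsto_const]) (auto simp: powr_minus)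
  then show ?thesis by (simp add: wst_def[abs_def])
qed

text \<open>Bounded differences suffice at this end, because \<open>wst\<close> tends to infinity there.\<close>

lemma ratio_tendsto_1_at_right_0:
  assumes "\<forall>\<^sub>F s in at_right 0. wst s - K \<le> W s \<and> W s \<le> wst s + K"
  shows "((\<lambda>s. W s / wst s) \<longlongrightarrow> 1) (at_right 0)"
proof -
  have 0: "((\<lambda>s. K / wst s) \<longlongrightarrow> 0) (at_right 0)"
    by (rule real_tendsto_divide_at_top[OF tendsto_const wst_at_right_0])
  have ev: "\<forall>\<^sub>F s in at_right 0. 1 - K / wst s \<le> W s / wst s \<and> W s / wst s \<le> 1 + K / wst s"
    using assms eventually_at_right_less[of 0]
  proof eventually_elim
    case (elim s)
    have w: "0 < wst s" using elim by (intro wst_pos)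
    have "(wst s - K) / wst s \<le> W s / wst s" "W s / wst s \<le> (wst s + K) / wst s"
      using elim w by (auto intro!: divide_right_mono)
    then show ?case using w by (simp add: diff_divide_distrib add_divide_distrib)
  qed
  show ?thesis
  proof (rule tendsto_sandwich)
    show "\<forall>\<^sub>F s in at_right 0. 1 - K / wst s \<le> W s / wst s" "\<forall>\<^sub>F s in at_right 0. W s / wst s \<le> 1 + K / wst s"
      using ev by (auto elim: eventually_mono)
    show "((\<lambda>s. 1 - K / wst s) \<longlongrightarrow> 1) (at_right 0)" "((\<lambda>s. 1 + K / wst s) \<longlongrightarrow> 1) (at_right 0)"
      using tendsto_diff[OF tendsto_const 0, of 1] tendsto_add[OF tendsto_const 0, of 1] by auto
  qed
qed

text \<open>\<open>wst - wst 1\<close> is a subsolution because lowering \<open>wst\<close> lowers the source and keeps the flux. The line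
  through \<open>(1/2, wst (1/2))\<close> and \<open>(1, 0)\<close> forces the value \<open>0\<close> at \<open>s = 1\<close>.\<close>

lemma singular_solution_vanishing:
  "\<exists>W H. sol 1 {0<..<1} W H \<and> ((\<lambda>s. W s / wst s) \<longlongrightarrow> 1) (at_right 0) \<and> (W \<longlongrightarrow> 0) (at_left 1)"
proof -
  define u where "u = (\<lambda>s. wst s - wst 1)"
  define a where "a = (\<lambda>n. 1 / (real n + 3))"
  define b where "b = (\<lambda>n. 1 - 1 / (real n + 3))"
  have wlt: "wst 1 < wst s" if "0 < s" "s < 1" for s
    unfolding wst_def using that be_pos ast_pos by (intro mult_strict_left_mono powr_less_mono2_neg) auto
  have sub: "subsol {0<..<1} u Gst"
    unfolding subsol_def
  proof (intro ballI conjI)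
    fix s :: real assume s: "s \<in> {0<..<1}"
    show "0 < u s" using wlt s by (simp add: u_def)
    show "(u has_real_derivative psi (Gst s)) (at s)" unfolding u_def
      using sol_deriv(2)[OF wst_sol, of s] s by (auto intro!: derivative_eq_intros)
    show "\<exists>D\<ge>c * s powr m * u s powr q. (Gst has_real_derivative D) (at s)"
      using sol_deriv(3)[OF wst_sol, of s] s wlt[of s] wst_pos[of 1]
      by (intro exI[of _ "c * s powr m * wst s powr q"] conjI source_mono) (auto simp: u_def)
  qed
  have a: "0 < a n" "a n \<le> 1/3" and b: "2/3 \<le> b n" "b n < 1" for n
    by (auto simp: a_def b_def field_simps)
  have "\<exists>w G W H. perron_family a b (\<lambda>n. u (a n)) (\<lambda>n. u (b n)) u w G W H"
  proof (rule perron[where a = a and b = b and u = u and \<alpha> = "\<lambda>n. u (a n)" and \<beta> = "\<lambda>n. u (b n)" and J = "{0<..<1}" and U = Gst])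
    show "{a n..b n} \<subseteq> {0<..<1}" for n using a[of n] b[of n] by auto
    show "a n < b n" for n using a[of n] b[of n] by auto
  qed (use sub a in \<open>auto simp: a_def b_def frac_le\<close>)
  then obtain w G W H where P: "perron_family a b (\<lambda>n. u (a n)) (\<lambda>n. u (b n)) u w G W H" by blast
  note w = perron_familyD[OF P]
  have Un: "(\<Union>n. {a n<..<b n}) = {0<..<1}"
  proof (rule UN_exhaust)
    show "{a n<..<b n} \<subseteq> {0<..<1}" for n using a[of n] b[of n] by auto
    fix s :: real assume s: "s \<in> {0<..<1}"
    have "\<forall>\<^sub>F n in sequentially. a n < s" "\<forall>\<^sub>F n in sequentially. s < b n"
      using eventually_inverse_shift_less[of s] eventually_inverse_shift_less[of "1 - s"] s
      by (auto simp: a_def b_def algebra_simps)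
    then show "\<forall>\<^sub>F n in sequentially. a n < s \<and> s < b n" by (rule eventually_conj)
  qed
  have cwst: "continuous_on {x..y} wst" if "0 < x" for x y
    using that by (intro continuous_on_subset[OF sol_continuous(1)[OF wst_sol]]) auto
  have super: "supersol {x<..<y} wst Gst" if "0 < x" for x y
    using that by (intro sol_imp_supersol sol_subset[OF wst_sol]) auto
  have w1: "w n s \<le> wst s" if "s \<in> {a n..b n}" for n s
    by (rule sub_super_comparison[OF sol_imp_subsol[OF w(1)] w(2) super cwst _ _ that])
       (use a[of n] w(3,4)[of n] wst_pos[of 1] in \<open>auto simp: u_def\<close>)
  define K where "K = 2 * wst (1/2)"
  have K: "0 < K" using wst_pos[of "1/2"] by (simp add: K_def)
  have super_l: "supersol {1/2<..<y} (\<lambda>s. K + (- K) * s) (\<lambda>_. phi (- K))" if "y \<le> 1" for y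
    using that K by (intro supersol_linear) (auto simp: algebra_simps)
  have ul: "u s \<le> K + (- K) * s" if "s \<in> {1/2..1}" for s
  proof (rule sub_super_comparison[OF subsol_subset[OF sub] _ super_l _ _ _ that])
    show "continuous_on {1/2..1} u" unfolding u_def by (intro continuous_intros cwst) auto
    show "u (1/2) \<le> K + (- K) * (1/2)" using wst_pos[of 1] by (simp add: u_def K_def)
  qed (auto intro!: continuous_intros simp: u_def)
  have w2: "w n s \<le> K + (- K) * s" if "s \<in> {1/2..b n}" for n s
  proof (rule sub_super_comparison[OF sol_imp_subsol[OF sol_subset[OF w(1)[where n = n]]] continuous_on_subset[OF w(2)[where n = n]]
        super_l[of "b n"] _ _ _ that])
    show "w n (1/2) \<le> K + (- K) * (1/2)" using w1[of "1/2" n] a[of n] b[of n] by (simp add: K_def)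
    show "w n (b n) \<le> K + (- K) * b n" using w(4)[where n = n] ul[of "b n"] b[of n] by simp
  qed (use a[of n] b[of n] in \<open>auto intro!: continuous_intros\<close>)
  have Wb: "u s \<le> W s \<and> W s \<le> wst s" if "0 < s" "s < 1" for s
    using perron_family_lower[OF P, of s] perron_family_upper[OF P, of s "wst s"] w1 that unfolding Un
    by (auto simp: a_def b_def frac_le)
  have Wl: "W s \<le> K + (- K) * s" if "1/2 < s" "s < 1" for s
    using perron_family_upper[OF P, of s "K + (- K) * s"] w2 that unfolding Un
    by (auto simp: a_def b_def frac_le)
  have "((\<lambda>s. W s / wst s) \<longlongrightarrow> 1) (at_right 0)"
  proof (rule ratio_tendsto_1_at_right_0[where K = "wst 1"])
    show "\<forall>\<^sub>F s in at_right 0. wst s - wst 1 \<le> W s \<and> W s \<le> wst s + wst 1"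
      using eventually_at_right_real[OF zero_less_one]
    proof eventually_elim
      case (elim s)
      then show ?case using Wb[of s] wst_pos[of 1] by (simp add: u_def)
    qed
  qed
  moreover have "(W \<longlongrightarrow> 0) (at_left 1)"
  proof (rule tendsto_sandwich[OF _ _ tendsto_const])
    have ev: "\<forall>\<^sub>F s in at_left 1. s \<in> {1/2<..<1::real}" by (rule eventually_at_left_real) simp
    show "\<forall>\<^sub>F s in at_left 1. 0 \<le> W s"
      using ev
    proof eventually_elim
      case (elim s)
      then show ?case using Wb[of s] wlt[of s] by (simp add: u_def)
    qed
    show "\<forall>\<^sub>F s in at_left 1. W s \<le> K + (- K) * s" using ev by eventually_elim (use Wl in auto)
    have "((\<lambda>s. K + (- K) * s) \<longlongrightarrow> K + (- K) * 1) (at_left 1)" by (intro tendsto_intros)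
    then show "((\<lambda>s. K + (- K) * s) \<longlongrightarrow> 0) (at_left 1)" by simp
  qed
  ultimately show ?thesis using w(8) unfolding Un by blast
qed

text \<open>The solutions \<open>w n\<close> agree with \<open>wst\<close> at the left end, so \<open>w n - wst\<close> and in the limit \<open>W - wst\<close> is nondecreasing.
  It therefore stays bounded as \<open>s \<rightarrow> 0\<close>.\<close>

lemma singular_solution_blowing_up:
  "\<exists>W H. sol 1 {0<..<1} W H \<and> ((\<lambda>s. W s / wst s) \<longlongrightarrow> 1) (at_right 0) \<and> filterlim W at_top (at_left 1)"
proof -
  define a where "a = (\<lambda>n. 1 / (real n + 3))"
  have a: "0 < a n" "a n < 1" for n by (auto simp: a_def)
  have "\<exists>w G W H. perron_family a (\<lambda>_. 1) (\<lambda>n. wst (a n)) (\<lambda>n. wst 1 + real n) wst w G W H"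
    using sol_imp_subsol[OF wst_sol] a
    by (intro perron[where a = a and b = "\<lambda>_. 1" and u = wst and \<alpha> = "\<lambda>n. wst (a n)" and \<beta> = "\<lambda>n. wst 1 + real n"
          and J = "{0<..}" and U = Gst])
       (auto intro: less_le_trans[OF a(1)], auto simp: a_def frac_le)
  then obtain w G W H where P: "perron_family a (\<lambda>_. 1) (\<lambda>n. wst (a n)) (\<lambda>n. wst 1 + real n) wst w G W H" by blast
  note w = perron_familyD[OF P]
  have Un: "(\<Union>n. {a n<..<1}) = {0<..<1}"
  proof (rule UN_exhaust)
    show "{a n<..<1} \<subseteq> {0<..<1}" for n using a(1)[of n] by (auto intro: less_trans)
  qed (use eventually_inverse_shift_less in \<open>auto simp: a_def\<close>)
  have inc: "w n s - wst s \<le> w n t - wst t" if "a n < s" "s < t" "t < 1" for n s t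
  proof (cases "wst s < w n s")
    case True
    show ?thesis
    proof (rule sub_super_difference_increases[OF sol_imp_subsol[OF w(1)[where n = n]] w(2)[where n = n]
          sol_imp_supersol[OF sol_subset[OF wst_sol]] continuous_on_subset[OF sol_continuous(1)[OF wst_sol]]])
    qed (use that a[of n] w(3)[where n = n] True in auto)
  next
    case False
    moreover have "wst t \<le> w n t" using that by (intro w(5)) auto
    ultimately show ?thesis by simp
  qed
  have Winc: "W s - wst s \<le> W t - wst t" if st: "0 < s" "s < t" "t < 1" for s t
  proof -
    have "s \<in> (\<Union>n. {a n<..<1})" using st unfolding Un by simp
    then obtain n where n: "a n < s" by auto
    have "a k < s" if "n \<le> k" for k using n frac_le[of 1 1 "real n + 3" "real k + 3"] that by (auto simp: a_def)
    then have "\<exists>n. \<forall>k\<ge>n. w k s - wst s \<le> w k t - wst t" using inc st by blast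
    then show ?thesis
      using n st by (intro LIMSEQ_le[OF tendsto_diff[OF w(7)[where n = n and s = s] tendsto_const] tendsto_diff[OF w(7)[where n = n and s = t] tendsto_const]]) auto
  qed
  have Wge: "wst s \<le> W s" if "0 < s" "s < 1" for s
    using perron_family_lower[OF P, of s] that unfolding Un by auto
  have "\<forall>\<^sub>F s in at_right 0. wst s - (W (1/2) - wst (1/2)) \<le> W s \<and> W s \<le> wst s + (W (1/2) - wst (1/2))"
  proof -
    have "\<forall>\<^sub>F s in at_right 0. s \<in> {0<..<1/2::real}" by (rule eventually_at_right_real) simp
    then show ?thesis
    proof eventually_elim
      case (elim s)
      then show ?case using Wge[of s] Wge[of "1/2"] Winc[of s "1/2"] by auto
    qed
  qed
  then have "((\<lambda>s. W s / wst s) \<longlongrightarrow> 1) (at_right 0)" by (rule ratio_tendsto_1_at_right_0)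
  moreover have "filterlim W at_top (at_left 1)"
    unfolding filterlim_at_top_dense
  proof
    fix z
    obtain n where n: "z < real n" using reals_Archimedean2 by blast
    then have "z < w n 1" using w(4)[where n = n] wst_pos[of 1] by simp
    then show "\<forall>\<^sub>F s in at_left 1. z < W s"
      using w(6)[where n = n] a[of n] by (intro eventually_above_boundary_at_left[OF w(2)[where n = n]]) auto
  qed
  ultimately show ?thesis using w(8) unfolding Un by blast
qed

lemma decaying_solution_blowing_up:
  "\<exists>W H. sol 1 {1<..} W H \<and> filterlim W at_top (at_right 1)"
proof -
  define b where "b = (\<lambda>n. real n + 3)"
  have b: "1 < b n" for n by (auto simp: b_def)
  have "\<exists>w G W H. perron_family (\<lambda>_. 1) b (\<lambda>n. wst 1 + real n) (\<lambda>n. wst (b n)) wst w G W H"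
    using sol_imp_subsol[OF wst_sol] b
    by (intro perron[where a = "\<lambda>_. 1" and b = b and u = wst and \<alpha> = "\<lambda>n. wst 1 + real n" and \<beta> = "\<lambda>n. wst (b n)"
          and J = "{0<..}" and U = Gst]) (auto, auto simp: b_def)
  then obtain w G W H where P: "perron_family (\<lambda>_. 1) b (\<lambda>n. wst 1 + real n) (\<lambda>n. wst (b n)) wst w G W H" by blast
  note w = perron_familyD[OF P]
  have Un: "(\<Union>n. {1<..<b n}) = {1<..}"
  proof (intro set_eqI iffI)
    fix s :: real assume s: "s \<in> {1<..}"
    obtain n where "s < real n" using reals_Archimedean2 by blast
    then show "s \<in> (\<Union>n. {1<..<b n})" using s by (auto simp: b_def intro!: exI[of _ n])
  qed auto
  have "filterlim W at_top (at_right 1)"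
    unfolding filterlim_at_top_dense
  proof
    fix z
    obtain n where n: "z < real n" using reals_Archimedean2 by blast
    then have "z < w n 1" using w(3)[where n = n] wst_pos[of 1] by simp
    then show "\<forall>\<^sub>F s in at_right 1. z < W s"
      using w(6)[where n = n] b[of n] by (intro eventually_above_boundary_at_right[OF w(2)[where n = n]]) auto
  qed
  then show ?thesis using w(8) unfolding Un by blast
qed

text \<open>The correction \<open>s powr (1 + \<delta>)\<close> has a second derivative of the order \<open>s powr (m + q)\<close> of the source. For small
  \<open>k\<close> it dominates, since the flux scales like \<open>k powr (p - 1)\<close> and the source like \<open>k powr q\<close>.\<close>

lemma linear_solution_bounds:
  "\<exists>W H k. 0 < k \<and> sol 1 {0<..<1/2} W H \<and> (\<forall>s\<in>{0<..<1/2}. k * s \<le> W s \<and> W s \<le> 2 * k * s)"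
proof -
  define \<delta> where "\<delta> = m + q + 1"
  have d: "0 < \<delta>" using m q by (simp add: \<delta>_def)
  define m0 where "m0 = (p - 1) * min 1 ((2 + \<delta>) powr (p - 2))"
  \<comment> \<open>the value of \<open>k\<close> at which flux and source balance\<close>
  define k where "k = (m0 * \<delta> * (1 + \<delta>) / (c * 2 powr q)) powr (1 / nu)"
  have m0: "0 < m0" using p d by (simp add: m0_def)
  have k: "0 < k" using m0 d c by (simp add: k_def)
  have knu: "c * 2 powr q * k powr nu = m0 * \<delta> * (1 + \<delta>)"
    using m0 d c nu_pos by (simp add: k_def powr_powr)
  define u where "u = (\<lambda>s. k * (s + s powr (1 + \<delta>)))"
  define u' where "u' = (\<lambda>s. k * (1 + (1 + \<delta>) * s powr \<delta>))"
  define U where "U = (\<lambda>s. u' s powr (p - 1))"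
  have sd: "s powr (1 + \<delta>) = s * s powr \<delta>" "s powr \<delta> \<le> 1" if "0 < s" "s < 1" for s
    using that d by (auto simp: powr_add powr_le_one_le intro: powr_le1)
  have sub: "subsol {0<..<1} u U"
    unfolding subsol_def
  proof (intro ballI conjI)
    fix s :: real assume "s \<in> {0<..<1}"
    then have s: "0 < s" "s < 1" by auto
    show us: "0 < u s" using s k by (simp add: u_def add_pos_nonneg)
    have u'p: "0 < u' s" using k d by (simp add: u'_def add_pos_nonneg)
    have psiU: "psi (U s) = u' s" unfolding U_def using u'p p by (simp add: spow_pos powr_powr)
    show "(u has_real_derivative psi (U s)) (at s)"
      unfolding psiU u_def u'_def using s by (auto intro!: derivative_eq_intros)
    have du': "(u' has_real_derivative k * ((1 + \<delta>) * (\<delta> * s powr (\<delta> - 1)))) (at s)"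
      unfolding u'_def using s by (auto intro!: derivative_eq_intros)
    define D where "D = (p - 1) * u' s powr (p - 2) * (k * ((1 + \<delta>) * (\<delta> * s powr (\<delta> - 1))))"
    have "(U has_real_derivative D) (at s)"
      unfolding U_def D_def using DERIV_fun_powr[OF du' u'p, of "p - 1"] by simp
    moreover have "c * s powr m * u s powr q \<le> D"
    proof -
      have "u s \<le> 2 * k * s" using sd[OF s] s k by (simp add: u_def)
      then have "u s powr q \<le> (2 * k * s) powr q" using us q_pos by (intro powr_mono2) auto
      then have "c * s powr m * u s powr q \<le> c * s powr m * (2 * k * s) powr q" using c by (intro mult_left_mono) auto
      also have "\<dots> = c * 2 powr q * k powr q * (s powr m * s powr q)" using s k by (simp add: powr_mult)
      also have "k powr q = k powr nu * k powr (p - 1)" by (simp add: nu_def flip: powr_add)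
      also have "s powr m * s powr q = s powr (\<delta> - 1)" by (simp add: \<delta>_def flip: powr_add)
      also have "c * 2 powr q * (k powr nu * k powr (p - 1)) * s powr (\<delta> - 1) =
          m0 * k powr (p - 1) * (\<delta> * (1 + \<delta>) * s powr (\<delta> - 1))" using knu by (simp add: mult_ac) 
      also have "\<dots> \<le> (p - 1) * u' s powr (p - 2) * k * (\<delta> * (1 + \<delta>) * s powr (\<delta> - 1))"
      proof (rule mult_right_mono)
        have "(2 + \<delta>) powr (p - 2) \<le> (u' s / k) powr (p - 2) \<or> 1 \<le> (u' s / k) powr (p - 2)"
        proof (cases "2 \<le> p")
          case True
          then show ?thesis using k d by (intro disjI2 ge_one_powr_ge_zero) (auto simp: u'_def)
        next
          case False
          have "(1 + \<delta>) * s powr \<delta> \<le> 1 + \<delta>" using sd(2)[OF s] d by (simp add: mult_left_le)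
          then have "u' s / k \<le> 2 + \<delta>" using k by (simp add: u'_def)
          then show ?thesis using False u'p k by (intro disjI1 powr_mono2') auto
        qed
        then have "m0 \<le> (p - 1) * (u' s / k) powr (p - 2)" unfolding m0_def using p by (intro mult_left_mono) auto
        then have "m0 * k powr (p - 1) \<le> (p - 1) * (u' s / k) powr (p - 2) * k powr (p - 1)"
          by (intro mult_right_mono) auto
        also have "\<dots> = (p - 1) * u' s powr (p - 2) * k"
        proof -
          have "k powr (p - 1) = k powr (p - 2) * k" using k powr_mult_base[of k "p - 2"] by (simp add: mult.commute)
          moreover have "(u' s / k) powr (p - 2) * k powr (p - 2) = u' s powr (p - 2)"
            using k u'p by (simp flip: powr_mult)
          ultimately show ?thesis by (metis mult.assoc)
        qed
        finally show "m0 * k powr (p - 1) \<le> (p - 1) * u' s powr (p - 2) * k" .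
      qed (use d in auto)
      also have "\<dots> = D" by (simp add: D_def mult_ac)
      finally show ?thesis .
    qed
    ultimately show "\<exists>D\<ge>c * s powr m * u s powr q. (U has_real_derivative D) (at s)" by blast
  qed
  define a where "a = (\<lambda>n. 1 / (real n + 3))"
  have a: "0 < a n" "a n < 1/2" for n by (auto simp: a_def field_simps)
  have "\<exists>w G W H. perron_family a (\<lambda>_. 1/2) (\<lambda>n. u (a n)) (\<lambda>_. u (1/2)) u w G W H"
    using sub a
    by (intro perron[where a = a and b = "\<lambda>_. 1/2" and u = u and \<alpha> = "\<lambda>n. u (a n)" and \<beta> = "\<lambda>_. u (1/2)"
          and J = "{0<..<1}" and U = U])
       (auto intro: less_le_trans[OF a(1)], auto simp: a_def frac_le)
  then obtain w G W H where P: "perron_family a (\<lambda>_. 1/2) (\<lambda>n. u (a n)) (\<lambda>_. u (1/2)) u w G W H" by blast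
  note w = perron_familyD[OF P]
  have Un: "(\<Union>n. {a n<..<1/2}) = {0<..<1/2}"
  proof (rule UN_exhaust)
    show "{a n<..<1/2} \<subseteq> {0<..<1/2}" for n using a(1)[of n] by (auto intro: less_trans)
  qed (use eventually_inverse_shift_less in \<open>auto simp: a_def\<close>)
  have ub: "k * s \<le> u s" "u s \<le> 0 + 2 * k * s" if "0 < s" "s < 1" for s
    using sd[OF that] that k by (auto simp: u_def)
  have w1: "w n s \<le> 0 + 2 * k * s" if "a n < s" "s < 1/2" for n s
  proof (rule sub_super_comparison[OF sol_imp_subsol[OF w(1)[where n = n]] w(2)[where n = n], where v = "\<lambda>s. 0 + 2 * k * s"])
    show "supersol {a n<..<1/2} (\<lambda>s. 0 + 2 * k * s) (\<lambda>_. phi (2 * k))"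
      by (rule supersol_linear) (use a[of n] k in \<open>auto intro: less_trans\<close>)
    show "w n (a n) \<le> 0 + 2 * k * a n" using w(3)[where n = n] ub(2)[of "a n"] a[of n] by simp
    show "w n (1/2) \<le> 0 + 2 * k * (1/2)" using w(4)[where n = n] ub(2)[of "1/2"] by simp
  qed (use that in \<open>auto intro!: continuous_intros\<close>)
  have "k * s \<le> W s \<and> W s \<le> 2 * k * s" if "0 < s" "s < 1/2" for s
    using perron_family_lower[OF P, of s] perron_family_upper[OF P, of s "2 * k * s"] w1 ub(1)[of s] that unfolding Un
    by (auto simp: a_def frac_le)
  then show ?thesis using w(8) k unfolding Un
    by (intro exI[of _ W] exI[of _ H] exI[of _ k]) auto
qed

end

lemma mono_bounded_below_tendsto_at_right:
  fixes f :: "real \<Rightarrow> real"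
  assumes d: "0 < d" and mono: "\<And>x y. 0 < x \<Longrightarrow> x \<le> y \<Longrightarrow> y < d \<Longrightarrow> f x \<le> f y"
    and bd: "\<And>x. 0 < x \<Longrightarrow> x < d \<Longrightarrow> B \<le> f x"
  shows "\<exists>L\<ge>B. (f \<longlongrightarrow> L) (at_right 0)"
proof -
  define L where "L = Inf (f ` {0<..<d})"
  have ne: "f ` {0<..<d} \<noteq> {}" using d by (auto intro!: exI[of _ "d / 2"])
  have bb: "bdd_below (f ` {0<..<d})" using bd by (intro bdd_belowI[of _ B]) auto
  have LB: "B \<le> L" unfolding L_def using bd by (intro cInf_greatest[OF ne]) auto
  have "(f \<longlongrightarrow> L) (at_right 0)"
  proof (rule order_tendstoI)
    fix z assume "z < L"
    have "\<forall>\<^sub>F x in at_right 0. x \<in> {0<..<d}" using d by (rule eventually_at_right_real)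
    then show "\<forall>\<^sub>F x in at_right 0. z < f x"
    proof eventually_elim
      case (elim x)
      then have "L \<le> f x" unfolding L_def using bb by (intro cInf_lower) auto
      then show ?case using \<open>z < L\<close> by linarith
    qed
  next
    fix z assume "L < z"
    then obtain y where y: "0 < y" "y < d" "f y < z" using cInf_lessD[OF ne, of z] unfolding L_def by auto
    have "\<forall>\<^sub>F x in at_right 0. x \<in> {0<..<y}" using y by (intro eventually_at_right_real)
    then show "\<forall>\<^sub>F x in at_right 0. f x < z"
    proof eventually_elim
      case (elim x)
      then show ?case using mono[of x y] y by auto
    qed
  qed
  then show ?thesis using LB by blast
qed

context emden_fowler
begin

section \<open>Solutions of the source equation near the origin\<close>

text \<open>\<open>T\<close> prescribes \<open>w = C\<close> at \<open>0\<close> and \<open>G = \<theta>\<close> at \<open>s0\<close>; with the flux fixed at the right end, \<open>T\<close> preserves the order.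
  \<open>P\<close> is a primitive of an upper bound of the source, and \<open>bound\<close> says that \<open>C + K * s powr b'\<close> is mapped below
  itself. The flux may be unbounded at \<open>0\<close>, hence the integrals over half-open intervals.\<close>

lemma source_local_solution:
  assumes s0: "0 < s0" and C: "0 \<le> C" and th: "0 \<le> \<theta>" and pos: "0 < C \<or> 0 < \<theta>" and K: "0 < K" "0 < b'"
    and P: "\<And>x. 0 < x \<Longrightarrow> x \<le> s0 \<Longrightarrow> (P has_real_derivative - P' x) (at x)"
    and P': "\<And>x. 0 < x \<Longrightarrow> x \<le> s0 \<Longrightarrow> c * x powr m * (C + K * x powr b') powr q \<le> P' x"
    and bound: "\<And>x. 0 < x \<Longrightarrow> x \<le> s0 \<Longrightarrow> \<theta> + P x - P s0 \<le> phi (K * (b' * x powr (b' - 1)))"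
  shows "\<exists>w G. sol (-1) {0<..<s0} w G \<and> (\<forall>s\<in>{0<..<s0}. C \<le> w s \<and> w s \<le> C + K * s powr b' \<and> \<theta> \<le> G s \<and>
      G s \<le> phi (K * (b' * s powr (b' - 1))))"
proof -
  define F where "F = (\<lambda>w x. c * x powr m * w x powr q)"
  define G where "G = (\<lambda>w x. \<theta> + integral {x..s0} (F w))"
  define T where "T = (\<lambda>w s. C + integral {0..s} (\<lambda>x. psi (G w x)))"
  define Om where "Om = (\<lambda>s. K * s powr b')"
  define h where "h = (\<lambda>x. K * (b' * x powr (b' - 1)))"
  define X where "X = {0<..s0}"
  define lo where "lo = (\<lambda>s::real. C)"
  define hi where "hi = (\<lambda>s. C + Om s)"
  define M where "M = (\<lambda>x y. \<bar>Om x - Om y\<bar>)"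
  define S where "S = {w. (\<forall>x\<in>X. lo x \<le> w x \<and> w x \<le> hi x) \<and> (\<forall>x\<in>X. \<forall>y\<in>X. \<bar>w x - w y\<bar> \<le> M x y)}"
  have dOm: "(Om has_real_derivative h x) (at x)" if "0 < x" for x
    unfolding Om_def h_def using that by (auto intro!: derivative_eq_intros)
  have cOm: "continuous_on {0..s} Om" for s unfolding Om_def using K
    by (intro continuous_intros continuous_on_powr') auto
  have vd: "(f has_vector_derivative D) (at s)" if "(f has_real_derivative D) (at s)" for f :: "real \<Rightarrow> real" and D s
    using that by (simp add: has_real_derivative_iff_has_vector_derivative)
  have hint: "(h has_integral Om y - Om x) {x..y}" if "0 \<le> x" "x \<le> y" for x y
    by (rule fundamental_theorem_of_calculus_interior[where f = Om])
       (use that in \<open>auto intro!: vd dOm continuous_on_subset[OF cOm[of y]]\<close>)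
  have Om_mono: "Om x \<le> Om y" if "0 \<le> x" "x \<le> y" for x y
    unfolding Om_def using that K by (intro mult_left_mono powr_mono2) auto
  have Om0: "Om 0 = 0" by (simp add: Om_def)
  have cw: "continuous_on X w" if w: "w \<in> S" for w
    unfolding continuous_on_def
  proof
    fix x assume x: "x \<in> X"
    have "(Om \<longlongrightarrow> Om x) (at x within X)"
      using continuous_on_subset[OF cOm[of s0], of X] x unfolding continuous_on_def X_def
      by (metis greaterThanAtMost_subseteq_atLeastAtMost_iff order_refl)
    then have "((\<lambda>y. M y x) \<longlongrightarrow> \<bar>Om x - Om x\<bar>) (at x within X)" unfolding M_def by (intro tendsto_intros)
    then have "((\<lambda>y. M y x) \<longlongrightarrow> 0) (at x within X)" by simp
    then have "((\<lambda>y. w y - w x) \<longlongrightarrow> 0) (at x within X)"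
      by (rule tendsto_0_le[where K = 1])
         (use w x in \<open>auto simp: eventually_at_filter S_def M_def\<close>)
    then show "(w \<longlongrightarrow> w x) (at x within X)" by (simp add: LIM_zero_iff)
  qed
  have wnn: "0 \<le> w x" if "w \<in> S" "x \<in> X" for w x using that C unfolding S_def lo_def by force
  have cF: "continuous_on X (F w)" if "w \<in> S" for w
    unfolding F_def using wnn[OF that] q_pos
    by (intro continuous_intros continuous_on_powr'[OF cw[OF that]]) (auto simp: X_def)
  have cF': "continuous_on {x..s0} (F w)" if "w \<in> S" "0 < x" for w x
    using that by (intro continuous_on_subset[OF cF[OF that(1)]]) (auto simp: X_def)
  have Fnn: "0 \<le> F w x" for w x unfolding F_def using c by simp
  have dG: "(G w has_real_derivative - F w t) (at t within {x..s0})" if "w \<in> S" "0 < x" "t \<in> {x..s0}" for w x t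
    unfolding G_def using integral_has_real_derivative'[OF cF'[OF that(1,2)] that(3)]
    by (auto intro!: derivative_eq_intros)
  have cG: "continuous_on {x..s0} (\<lambda>t. psi (G w t))" if "w \<in> S" "0 < x" for w x
    using p DERIV_continuous_on[OF dG[OF that]] by (intro continuous_on_spow) auto
  have cGX: "continuous_on X (\<lambda>t. psi (G w t))" if "w \<in> S" for w
    unfolding continuous_on_def
  proof
    fix x assume x: "x \<in> X"
    then have "((\<lambda>t. psi (G w t)) \<longlongrightarrow> psi (G w x)) (at x within {x/2..s0})"
      using cG[OF that, of "x/2"] by (auto simp: continuous_on_def X_def)
    moreover have "at x within {x/2..s0} = at x within X"
      by (rule at_within_nhd[of x "{x/2<..}"]) (use x in \<open>auto simp: X_def\<close>)
    ultimately show "((\<lambda>t. psi (G w t)) \<longlongrightarrow> psi (G w x)) (at x within X)" by simp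
  qed
  have Gb: "\<theta> \<le> G w x" "G w x \<le> phi (h x)" if w: "w \<in> S" and x: "x \<in> X" for w x
  proof -
    have x': "0 < x" "x \<le> s0" using x by (auto simp: X_def)
    have Fi: "F w integrable_on {x..s0}" using cF'[OF w x'(1)] by (rule integrable_continuous_real)
    show "\<theta> \<le> G w x" unfolding G_def using Fnn integral_nonneg[OF Fi] by simp
    have "((\<lambda>y. - P' y) has_integral P s0 - P x) {x..s0}"
    proof (rule fundamental_theorem_of_calculus[where f = P and a = x and b = s0])
      show "(P has_vector_derivative - P' y) (at y within {x..s0})" if "y \<in> {x..s0}" for y
        by (rule has_vector_derivative_at_within, rule vd[OF P]) (use that x' in auto)
    qed (use x' in auto)
    from has_integral_neg[OF this] have Pi: "(P' has_integral P x - P s0) {x..s0}" by simp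
    have "integral {x..s0} (F w) \<le> P x - P s0"
    proof (rule has_integral_le[OF integrable_integral[OF Fi] Pi])
      fix y assume "y \<in> {x..s0}"
      then have y: "0 < y" "y \<le> s0" using x' by auto
      have "w y powr q \<le> (C + K * y powr b') powr q"
        using w y wnn[OF w, of y] q_pos by (intro powr_mono2) (auto simp: S_def X_def hi_def Om_def)
      then have "F w y \<le> c * y powr m * (C + K * y powr b') powr q" unfolding F_def using c by (intro mult_left_mono) auto
      then show "F w y \<le> P' y" using P'[OF y] by simp
    qed
    then show "G w x \<le> phi (h x)" using bound[OF x'] by (simp add: G_def h_def)
  qed
  have pG: "0 \<le> psi (G w x)" "psi (G w x) \<le> h x" if "w \<in> S" "x \<in> X" for w x
  proof -
    show "0 \<le> psi (G w x)" using Gb(1)[OF that] th by simp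
    have "psi (G w x) \<le> psi (phi (h x))" using Gb(2)[OF that] unfolding psi_le_iff .
    then show "psi (G w x) \<le> h x" by simp
  qed
  have pint: "(\<lambda>x. psi (G w x)) integrable_on {x..y}" if w: "w \<in> S" and xy: "0 \<le> x" "x \<le> y" "y \<le> s0" for w x y
  proof -
    have "(\<lambda>x. psi (G w x)) integrable_on X"
    proof (rule measurable_bounded_by_integrable_imp_integrable)
      show "(\<lambda>x. psi (G w x)) \<in> borel_measurable (lebesgue_on X)"
        by (rule continuous_imp_measurable_on_sets_lebesgue[OF cGX[OF w]]) (simp add: X_def)
      have "h integrable_on {0..s0}" using hint[of 0 s0] s0 by auto
      moreover have ins: "{0..s0} = insert 0 X" using s0 by (auto simp: X_def)
      ultimately show "h integrable_on X" by (simp add: integrable_on_insert_iff)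
      show "norm (psi (G w x)) \<le> h x" if "x \<in> X" for x using pG[OF w that] by simp
    qed (simp add: X_def)
    moreover have "{0..s0} = insert 0 X" using s0 by (auto simp: X_def)
    ultimately have "(\<lambda>x. psi (G w x)) integrable_on {0..s0}" by (simp add: integrable_on_insert_iff)
    then show ?thesis by (rule integrable_on_subinterval) (use xy in auto)
  qed
  have inc: "0 \<le> integral {x..y} (\<lambda>x. psi (G w x))" "integral {x..y} (\<lambda>x. psi (G w x)) \<le> Om y - Om x"
    if w: "w \<in> S" and xy: "0 \<le> x" "x \<le> y" "y \<le> s0" for w x y
  proof -
    have i: "(\<lambda>x. psi (G w x)) integrable_on {x..y}" by (rule pint[OF that])
    have hi: "(h has_integral Om y - Om x) {x..y}" using xy by (intro hint)
    have eq: "integral {x..y} g = integral {x<..y} g" for g :: "real \<Rightarrow> real"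
      by (rule integral_spike_set; rule negligible_subset[OF negligible_sing[of x]]) auto
    have ins: "{x..y} = insert x {x<..y}" using xy by auto
    have i': "(\<lambda>x. psi (G w x)) integrable_on {x<..y}" "h integrable_on {x<..y}"
      using i hi unfolding ins by (auto simp: integrable_on_insert_iff)
    show "0 \<le> integral {x..y} (\<lambda>x. psi (G w x))" unfolding eq
      using xy pG[OF w] by (intro integral_nonneg i') (auto simp: X_def)
    have "integral {x<..y} (\<lambda>x. psi (G w x)) \<le> integral {x<..y} h"
      using xy pG[OF w] by (intro integral_le i') (auto simp: X_def)
    then show "integral {x..y} (\<lambda>x. psi (G w x)) \<le> Om y - Om x" using integral_unique[OF hi] unfolding eq by simp
  qed
  have Tsplit: "T w y = T w x + integral {x..y} (\<lambda>x. psi (G w x))" if "w \<in> S" "0 \<le> x" "x \<le> y" "y \<le> s0" for w x y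
    unfolding T_def using Henstock_Kurzweil_Integration.integral_combine[OF that(2,3) pint[OF that(1), of 0 y]] that by simp
  have maps: "T w \<in> S" if w: "w \<in> S" for w
  proof -
    have 1: "\<bar>T w x - T w y\<bar> \<le> \<bar>Om x - Om y\<bar>" if "x \<in> X" "y \<in> X" for x y
    proof (cases "x \<le> y")
      case True
      then show ?thesis using that Tsplit[OF w, of x y] inc[OF w, of x y] by (auto simp: X_def)
    next
      case False
      then show ?thesis using that Tsplit[OF w, of y x] inc[OF w, of y x] by (auto simp: X_def)
    qed
    have "C \<le> T w x" "T w x \<le> C + Om x" if "x \<in> X" for x
      using inc[OF w, of 0 x] that by (auto simp: T_def X_def Om0)
    then show ?thesis using 1 unfolding S_def lo_def hi_def M_def by blast
  qed
  have "lo \<in> S" using Om_mono[of 0] by (auto simp: S_def lo_def hi_def M_def X_def Om0)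
  moreover have "T w x \<le> T v x"
    if w: "w \<in> S" and v: "v \<in> S" and le: "\<And>x. x \<in> X \<Longrightarrow> w x \<le> v x" and x: "x \<in> X" for w v x
  proof -
    have G_le: "G w y \<le> G v y" if y: "y \<in> X" for y
    proof -
      have "F w t \<le> F v t" if "t \<in> {y..s0}" for t
      proof -
        have t: "t \<in> X" using that y by (auto simp: X_def)
        have "w t powr q \<le> v t powr q" using le[OF t] wnn[OF w t] q_pos by (intro powr_mono2) auto
        then show ?thesis unfolding F_def using c by (intro mult_left_mono) auto
      qed
      then have "integral {y..s0} (F w) \<le> integral {y..s0} (F v)"
        using y by (intro integral_le integrable_continuous_real cF' w v) (auto simp: X_def)
      then show ?thesis by (simp add: G_def)
    qed
    have eq: "integral {0..x} g = integral {0<..x} g" for g :: "real \<Rightarrow> real"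
      by (rule integral_spike_set; rule negligible_subset[OF negligible_sing[of 0]]) auto
    have ins: "{0..x} = insert 0 {0<..x}" using x by (auto simp: X_def)
    have i: "(\<lambda>x. psi (G w x)) integrable_on {0<..x}" if "w \<in> S" for w
      using pint[OF that, of 0 x] x unfolding ins by (auto simp: integrable_on_insert_iff X_def)
    have "integral {0<..x} (\<lambda>x. psi (G w x)) \<le> integral {0<..x} (\<lambda>x. psi (G v x))"
      using G_le x by (intro integral_le i w v) (auto simp: X_def)
    then show ?thesis by (simp add: T_def eq)
  qed
  ultimately obtain w where w: "w \<in> S" "\<And>x. x \<in> X \<Longrightarrow> T w x = w x"
    using monotone_fixed_point[of lo X hi M T] maps unfolding S_def by blast
  have wpos: "0 < w s" if s: "s \<in> {0<..<s0}" for s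
  proof (cases "0 < C")
    case True
    then show ?thesis using w(1) s unfolding S_def lo_def X_def by force
  next
    case False
    then have t: "0 < \<theta>" using pos by simp
    have "(s - s/2) * psi \<theta> = integral {s/2..s} (\<lambda>_. psi \<theta>)" using s by simp
    also have "\<dots> \<le> integral {s/2..s} (\<lambda>x. psi (G w x))"
      using s Gb(1)[OF w(1)] by (intro integral_le pint w(1)) (auto simp: X_def)
    finally have "(s - s/2) * psi \<theta> \<le> T w s - T w (s/2)" using Tsplit[OF w(1), of "s/2" s] s by simp
    moreover have "0 \<le> T w (s/2)" using inc(1)[OF w(1), of 0 "s/2"] s C by (simp add: T_def)
    moreover have "0 < (s - s/2) * psi \<theta>" using s t by (intro mult_pos_pos) auto
    ultimately show ?thesis using w(2)[of s] s by (simp add: X_def)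
  qed
  have sol: "sol (-1) {0<..<s0} w (G w)"
    unfolding sol_def
  proof (intro ballI conjI)
    fix s assume s: "s \<in> {0<..<s0}"
    show "0 < w s" using wpos[OF s] .
    define x where "x = s / 2"
    have x: "0 < x" "x < s" "s < s0" "s \<in> {x..s0}" using s by (auto simp: x_def)
    show "(G w has_real_derivative - 1 * (c * s powr m * w s powr q)) (at s)"
      using has_derivative_within_Icc_imp_at[OF dG[OF w(1) x(1,4)] x(2,3)] by (simp add: F_def)
    have "((\<lambda>y. T w x + integral {x..y} (\<lambda>t. psi (G w t))) has_real_derivative psi (G w s)) (at s within {x..s0})"
      using integral_has_real_derivative[OF cG[OF w(1) x(1)] x(4)] by (auto intro!: derivative_eq_intros)
    then have "(w has_real_derivative psi (G w s)) (at s within {x..s0})"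
    proof (rule has_field_derivative_transform_within[OF _ zero_less_one x(4)])
      fix y assume "y \<in> {x..s0}"
      then show "T w x + integral {x..y} (\<lambda>t. psi (G w t)) = w y"
        using Tsplit[OF w(1), of x y] w(2)[of y] x by (auto simp: X_def)
    qed
    then show "(w has_real_derivative psi (G w s)) (at s)"
      using has_derivative_within_Icc_imp_at x by blast
  qed
  have "C \<le> w s \<and> w s \<le> C + K * s powr b' \<and> \<theta> \<le> G w s \<and> G w s \<le> phi (K * (b' * s powr (b' - 1)))"
    if "s \<in> {0<..<s0}" for s
    using w(1) Gb[OF w(1), of s] that unfolding S_def X_def lo_def hi_def Om_def h_def by auto
  then show ?thesis using sol by (intro exI[of _ w] exI[of _ "G w"]) blast
qed

section \<open>Asymptotics at the origin\<close>

lemma powr_tendsto_0_at_right: "0 < x \<Longrightarrow> ((\<lambda>s::real. s powr x) \<longlongrightarrow> 0) (at_right 0)"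
  by (rule tendsto_zero_powrI[OF _ tendsto_const])
     (auto intro: eventually_at_right_less[THEN eventually_mono])

lemma source_regular_solution:
  "\<exists>s0>0. \<exists>w G. sol (-1) {0<..<s0} w G \<and> (w \<longlongrightarrow> 1) (at_right 0)"
proof -
  define k where "k = c * 2 powr q / (- m - 1)"
  define K where "K = k powr (1 / (p - 1)) / bex"
  \<comment> \<open>up to here the upper bound \<open>1 + K * s powr bex\<close> is at most \<open>2\<close>\<close>
  define s0 where "s0 = K powr (- 1 / bex)"
  have k: "0 < k" using c m by (simp add: k_def)
  have K: "0 < K" using k bex_pos by (simp add: K_def)
  have s0: "0 < s0" using K by (simp add: s0_def)
  have "s0 powr bex = K powr (- 1 / bex * bex)" unfolding s0_def by (rule powr_powr)
  also have "- 1 / bex * bex = - 1" using bex_pos by simp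
  finally have Ks: "K * s0 powr bex = 1" using K by (simp add: powr_minus)
  have Kx: "K * x powr bex \<le> 1" if "0 < x" "x \<le> s0" for x
  proof -
    have "K * x powr bex \<le> K * s0 powr bex" using that K bex_pos by (intro mult_left_mono powr_mono2) auto
    then show ?thesis by (simp add: Ks)
  qed
  have "\<exists>w G. sol (-1) {0<..<s0} w G \<and> (\<forall>s\<in>{0<..<s0}. 1 \<le> w s \<and> w s \<le> 1 + K * s powr bex \<and> 0 \<le> G s \<and>
      G s \<le> phi (K * (bex * s powr (bex - 1))))"
  proof (rule source_local_solution[where P = "\<lambda>x. k * x powr (m + 1)" and P' = "\<lambda>x. c * 2 powr q * x powr m"])
    fix x assume x: "0 < x" "x \<le> s0"
    have "k * (m + 1) = - (c * 2 powr q)" using m by (simp add: k_def field_simps)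
    then have "- (c * 2 powr q * x powr m) = k * ((m + 1) * x powr (m + 1 - 1))" by (simp flip: mult.assoc)
    then show "((\<lambda>x. k * x powr (m + 1)) has_real_derivative - (c * 2 powr q * x powr m)) (at x)"
      using x by (auto intro!: derivative_eq_intros)
    have "(1 + K * x powr bex) powr q \<le> 2 powr q" using Kx[OF x] K q_pos by (intro powr_mono2) auto
    then have "c * x powr m * (1 + K * x powr bex) powr q \<le> c * x powr m * 2 powr q" using c by (intro mult_left_mono) auto
    then show "c * x powr m * (1 + K * x powr bex) powr q \<le> c * 2 powr q * x powr m" by (simp add: mult_ac)
    have "phi (K * (bex * x powr (bex - 1))) = (K * (bex * x powr (bex - 1))) powr (p - 1)"
      using K bex_pos by (intro spow_nonneg) auto
    also have "\<dots> = (K * bex) powr (p - 1) * x powr ((bex - 1) * (p - 1))"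
      by (simp only: powr_mult powr_powr mult.assoc)
    also have "(bex - 1) * (p - 1) = m + 1" using p by (simp add: bex_def field_simps)
    also have "(K * bex) powr (p - 1) = k" using k bex_pos p by (simp add: K_def powr_powr)
    finally show "0 + k * x powr (m + 1) - k * s0 powr (m + 1) \<le> phi (K * (bex * x powr (bex - 1)))"
      using k by simp
  qed (use s0 K bex_pos in auto)
  then obtain w G where w: "sol (-1) {0<..<s0} w G" "\<forall>s\<in>{0<..<s0}. 1 \<le> w s \<and> w s \<le> 1 + K * s powr bex" by blast
  have ev: "\<forall>\<^sub>F s in at_right 0. s \<in> {0<..<s0}" using s0 by (rule eventually_at_right_real)
  have "(w \<longlongrightarrow> 1) (at_right 0)"
  proof (rule tendsto_sandwich[OF _ _ tendsto_const])
    show "\<forall>\<^sub>F s in at_right 0. 1 \<le> w s" "\<forall>\<^sub>F s in at_right 0. w s \<le> 1 + K * s powr bex"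
      using ev w(2) by (auto elim!: eventually_mono)
    have "((\<lambda>s. 1 + K * s powr bex) \<longlongrightarrow> 1 + K * 0) (at_right 0)"
      by (intro tendsto_intros powr_tendsto_0_at_right bex_pos)
    then show "((\<lambda>s. 1 + K * s powr bex) \<longlongrightarrow> 1) (at_right 0)" by simp
  qed
  then show ?thesis using w(1) s0 by blast
qed

lemma linear_asymptotics:
  assumes s0: "0 < s0" and sol: "sol e {0<..<s0} w G" and w0: "(w \<longlongrightarrow> 0) (at_right 0)" and G: "(G \<longlongrightarrow> g) (at_right 0)"
  shows "((\<lambda>s. w s / s) \<longlongrightarrow> psi g) (at_right 0)" "((\<lambda>s. psi (G s)) \<longlongrightarrow> psi g) (at_right 0)"
proof -
  show lim: "((\<lambda>s. psi (G s)) \<longlongrightarrow> psi g) (at_right 0)" using p G by (intro tendsto_spow) auto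
  have ev: "\<forall>\<^sub>F s in at_right 0. s \<in> {0<..<s0}" using s0 by (rule eventually_at_right_real)
  show "((\<lambda>s. w s / s) \<longlongrightarrow> psi g) (at_right 0)"
  proof (rule lhopital_right_0[OF w0, where g' = "\<lambda>_. 1" and f' = "\<lambda>s. psi (G s)"])
    show "\<forall>\<^sub>F x in at_right 0. (w has_real_derivative psi (G x)) (at x)"
      using ev by eventually_elim (use sol_deriv(2)[OF sol] in auto)
  qed (use lim in \<open>auto intro: eventually_mono[OF eventually_at_right_less] tendsto_ident_at\<close>)
qed

lemma source_linear_solution:
  "\<exists>k>0. \<exists>s0>0. \<exists>w G. sol (-1) {0<..<s0} w G \<and> ((\<lambda>s. w s / s) \<longlongrightarrow> k) (at_right 0) \<and> ((\<lambda>s. psi (G s)) \<longlongrightarrow> k) (at_right 0)"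
proof -
  define d where "d = m + q + 1"
  have d: "0 < d" using m q by (simp add: d_def)
  define K where "K = (d / (2 * c)) powr (1 / nu)"
  \<comment> \<open>half of the admissible flux; \<open>K\<close> is chosen so that the source contributes at most the other half\<close>
  define \<theta> where "\<theta> = K powr (p - 1) / 2"
  have K: "0 < K" using d c by (simp add: K_def)
  have th: "0 < \<theta>" using K by (simp add: \<theta>_def)
  have "K powr q = K powr nu * K powr (p - 1)" by (simp add: nu_def flip: powr_add)
  also have "K powr nu = d / (2 * c)" using d c nu_pos by (simp add: K_def powr_powr)
  finally have Kq: "c * K powr q / d = \<theta>" using c d by (simp add: \<theta>_def)
  have "\<exists>w G. sol (-1) {0<..<1} w G \<and> (\<forall>s\<in>{0<..<1}. 0 \<le> w s \<and> w s \<le> 0 + K * s powr 1 \<and> \<theta> \<le> G s \<and>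
      G s \<le> phi (K * (1 * s powr (1 - 1))))"
  proof (rule source_local_solution[where P = "\<lambda>x. - \<theta> * x powr d" and P' = "\<lambda>x. c * K powr q * x powr (m + q)"])
    fix x :: real assume x: "0 < x" "x \<le> 1"
    have "\<theta> * d = c * K powr q" using d by (simp flip: Kq)
    then have "- (c * K powr q * x powr (m + q)) = - \<theta> * (d * x powr (d - 1))" by (simp add: d_def flip: mult.assoc)
    then show "((\<lambda>x. - \<theta> * x powr d) has_real_derivative - (c * K powr q * x powr (m + q))) (at x)"
      using x by (auto intro!: derivative_eq_intros)
    show "c * x powr m * (0 + K * x powr 1) powr q \<le> c * K powr q * x powr (m + q)"
      using x K by (simp add: powr_mult powr_add)
    have "0 \<le> \<theta> * x powr d" using th by simp
    moreover have "phi (K * (1 * x powr (1 - 1))) = 2 * \<theta>" using x K by (simp add: \<theta>_def spow_pos)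
    ultimately show "\<theta> + (- \<theta> * x powr d) - (- \<theta> * 1 powr d) \<le> phi (K * (1 * x powr (1 - 1)))" by simp
  qed (use th K in auto)
  then obtain w G where w: "sol (-1) {0<..<1} w G" "\<And>s. s \<in> {0<..<1} \<Longrightarrow> 0 \<le> w s \<and> w s \<le> K * s"
    and Gb: "\<And>s. s \<in> {0<..<1} \<Longrightarrow> \<theta> \<le> G s \<and> G s \<le> phi K" by fastforce
  have Gm: "G y \<le> G x" if "0 < x" "x \<le> y" "y < 1" for x y
    by (rule nonpos_derivative_imp_antimono[where f = G and f' = "\<lambda>s. - 1 * (c * s powr m * w s powr q)"])
       (use that c in \<open>auto intro!: sol_deriv(3)[OF w(1), simplified] continuous_on_subset[OF sol_continuous(2)[OF w(1)]]\<close>)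
  have "\<exists>L\<ge>- phi K. ((\<lambda>s. - G s) \<longlongrightarrow> L) (at_right 0)"
    by (rule mono_bounded_below_tendsto_at_right[of 1]) (use Gm Gb in auto)
  then obtain L where "((\<lambda>s. - G s) \<longlongrightarrow> L) (at_right 0)" by blast
  then have G: "(G \<longlongrightarrow> - L) (at_right 0)" using tendsto_minus_cancel_left[of G] by blast
  have ev: "\<forall>\<^sub>F s in at_right 0. s \<in> {0<..<1::real}" by (rule eventually_at_right_real) simp
  have "\<theta> \<le> - L"
    by (rule tendsto_lowerbound[OF G]) (use ev Gb in \<open>auto elim!: eventually_mono\<close>)
  then have L: "0 < psi (- L)" using th by simp
  have "(w \<longlongrightarrow> 0) (at_right 0)"
  proof (rule tendsto_sandwich[OF _ _ tendsto_const])
    show "\<forall>\<^sub>F s in at_right 0. 0 \<le> w s" "\<forall>\<^sub>F s in at_right 0. w s \<le> K * s"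
      using ev w(2) by (auto elim!: eventually_mono)
    show "((\<lambda>s. K * s) \<longlongrightarrow> 0) (at_right 0)" by (intro tendsto_mult_right_zero tendsto_ident_at)
  qed
  from linear_asymptotics[OF zero_less_one w(1) this G] L w(1) show ?thesis using zero_less_one by blast
qed

text \<open>The flux is monotone and, by convexity, bounded below by \<open>phi k\<close>; so it has a positive limit at \<open>0\<close>.\<close>

lemma absorption_linear_solution:
  "\<exists>k>0. \<exists>s0>0. \<exists>w G. sol 1 {0<..<s0} w G \<and> ((\<lambda>s. w s / s) \<longlongrightarrow> k) (at_right 0) \<and> ((\<lambda>s. psi (G s)) \<longlongrightarrow> k) (at_right 0)"
proof -
  obtain w G k where k: "0 < k" and w: "sol 1 {0<..<1/2} w G"
    and wb: "\<And>s. s \<in> {0<..<1/2} \<Longrightarrow> k * s \<le> w s \<and> w s \<le> 2 * k * s"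
    using linear_solution_bounds by blast
  have Gm: "G x \<le> G y" if "0 < x" "x \<le> y" "y < 1/2" for x y
    by (rule nonneg_derivative_imp_mono[where f = G and f' = "\<lambda>s. 1 * (c * s powr m * w s powr q)"])
       (use that c in \<open>auto intro!: sol_deriv(3)[OF w, simplified] continuous_on_subset[OF sol_continuous(2)[OF w]]\<close>)
  have ev: "\<forall>\<^sub>F s in at_right 0. s \<in> {0<..<1/2::real}" by (rule eventually_at_right_real) simp
  have w0: "(w \<longlongrightarrow> 0) (at_right 0)"
  proof (rule tendsto_sandwich[OF _ _ tendsto_const])
    show "\<forall>\<^sub>F s in at_right 0. 0 \<le> w s" "\<forall>\<^sub>F s in at_right 0. w s \<le> 2 * k * s"
      using ev wb sol_deriv(1)[OF w] by (auto elim!: eventually_mono intro: less_imp_le)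
    show "((\<lambda>s. 2 * k * s) \<longlongrightarrow> 0) (at_right 0)" by (intro tendsto_mult_right_zero tendsto_ident_at)
  qed
  have Gb: "phi k \<le> G y" if y: "0 < y" "y < 1/2" for y
  proof -
    have "w y - psi (G y) * y \<le> w x - psi (G y) * x" if x: "0 < x" "x < y" for x
      by (rule nonpos_derivative_imp_antimono[where f = "\<lambda>s. w s - psi (G y) * s" and f' = "\<lambda>s. psi (G s) - psi (G y)"])
         (use x y Gm in \<open>auto intro!: derivative_eq_intros continuous_intros sol_deriv(2)[OF w]
            continuous_on_subset[OF sol_continuous(1)[OF w]]\<close>)
    then have "\<forall>\<^sub>F x in at_right 0. w y - psi (G y) * y \<le> w x - psi (G y) * x"
      using eventually_at_right_real[OF y(1)] by (auto elim!: eventually_mono)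
    moreover have "((\<lambda>x. w x - psi (G y) * x) \<longlongrightarrow> 0 - psi (G y) * 0) (at_right 0)"
      by (intro tendsto_intros w0)
    ultimately have "w y - psi (G y) * y \<le> 0 - psi (G y) * 0"
      by (intro tendsto_lowerbound[where F = "at_right 0"]) auto
    then have "w y \<le> psi (G y) * y" by simp
    moreover have "k * y \<le> w y" using wb[of y] y by simp
    ultimately have "k * y \<le> psi (G y) * y" by linarith
    then have "psi (phi k) \<le> psi (G y)" using y by simp
    then show ?thesis unfolding psi_le_iff .
  qed
  have "\<exists>L\<ge>phi k. (G \<longlongrightarrow> L) (at_right 0)"
    by (rule mono_bounded_below_tendsto_at_right[of "1/2"]) (use Gm Gb in auto)
  then obtain L where L: "phi k \<le> L" "(G \<longlongrightarrow> L) (at_right 0)" by blast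
  have "psi (phi k) \<le> psi L" using L(1) unfolding psi_le_iff .
  then have "0 < psi L" using k unfolding psi_phi by linarith
  moreover have "0 < (1/2::real)" by simp
  ultimately show ?thesis using linear_asymptotics[OF _ w w0 L(2)] w by blast
qed

text \<open>The scaling that leaves \<open>wst\<close> invariant. It changes the slope at \<open>0\<close> by the factor \<open>l powr (be + 1)\<close>, which is
  how every slope \<open>k > 0\<close> is reached from a single solution.\<close>

lemma scaling:
  assumes sol: "sol e {0<..<s0} w G" and l: "0 < l"
  shows "sol e {0<..<s0 / l} (\<lambda>s. l powr be * w (l * s)) (\<lambda>s. l powr ((be + 1) * (p - 1)) * G (l * s))"
  unfolding sol_def
proof (intro ballI conjI)
  fix s assume "s \<in> {0<..<s0 / l}"
  then have s: "0 < s" "l * s \<in> {0<..<s0}" using l by (auto simp: field_simps)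
  note d = sol_deriv[OF sol s(2)]
  have ls: "((\<lambda>s. l * s) has_real_derivative l) (at s)" by (auto intro!: derivative_eq_intros)
  show "0 < l powr be * w (l * s)" using d(1) l by simp
  have "psi (l powr ((be + 1) * (p - 1)) * G (l * s)) = l powr (be + 1) * psi (G (l * s))"
    using p by (simp add: spow_mult powr_powr)
  also have "l powr (be + 1) = l powr be * l" using l by (simp add: powr_add)
  finally have psi: "psi (l powr ((be + 1) * (p - 1)) * G (l * s)) = l powr be * (psi (G (l * s)) * l)" by simp
  show "((\<lambda>s. l powr be * w (l * s)) has_real_derivative psi (l powr ((be + 1) * (p - 1)) * G (l * s))) (at s)"
    unfolding psi by (rule DERIV_cmult[OF DERIV_chain2[OF d(2) ls]])
  have e: "(be + 1) * (p - 1) + 1 + m = be * q"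
  proof -
    have "be * nu = m + p" using nu_pos by (simp add: be_def)
    then show ?thesis by (simp add: nu_def algebra_simps)
  qed
  have "l powr ((be + 1) * (p - 1)) * (e * (c * (l * s) powr m * w (l * s) powr q) * l) =
      e * (c * s powr m * (w (l * s) powr q * l powr ((be + 1) * (p - 1) + 1 + m)))"
    using l s by (simp add: powr_mult powr_add mult_ac)
  also have "\<dots> = e * (c * s powr m * (l powr be * w (l * s)) powr q)"
    unfolding e using l d(1) by (simp add: powr_mult powr_powr mult_ac)
  finally have eq: "l powr ((be + 1) * (p - 1)) * (e * (c * (l * s) powr m * w (l * s) powr q) * l) =
      e * (c * s powr m * (l powr be * w (l * s)) powr q)" .
  show "((\<lambda>s. l powr ((be + 1) * (p - 1)) * G (l * s)) has_real_derivative
      e * (c * s powr m * (l powr be * w (l * s)) powr q)) (at s)"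
    by (rule DERIV_cong[OF DERIV_cmult[OF DERIV_chain2[OF d(3) ls]] eq])
qed

lemma linear_solution:
  assumes e: "e = 1 \<or> e = -1" and k: "0 < k"
  shows "\<exists>s0>0. \<exists>w G. sol e {0<..<s0} w G \<and> ((\<lambda>s. w s / s) \<longlongrightarrow> k) (at_right 0) \<and> ((\<lambda>s. psi (G s)) \<longlongrightarrow> k) (at_right 0)"
proof -
  have "\<exists>k>0. \<exists>s0>0. \<exists>w G. sol e {0<..<s0} w G \<and> ((\<lambda>s. w s / s) \<longlongrightarrow> k) (at_right 0) \<and> ((\<lambda>s. psi (G s)) \<longlongrightarrow> k) (at_right 0)"
    using e
  proof
    assume e: "e = 1" show ?thesis unfolding e by (rule absorption_linear_solution)
  next
    assume e: "e = -1" show ?thesis unfolding e by (rule source_linear_solution)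
  qed
  then obtain k0 s0 w G where k0: "0 < k0" and s0: "0 < s0" and w: "sol e {0<..<s0} w G"
    "((\<lambda>s. w s / s) \<longlongrightarrow> k0) (at_right 0)" "((\<lambda>s. psi (G s)) \<longlongrightarrow> k0) (at_right 0)"
    by blast
  define l where "l = (k / k0) powr (1 / (be + 1))"
  have l: "0 < l" using k k0 by (simp add: l_def)
  have lk: "l powr (be + 1) * k0 = k" using k k0 be_pos by (simp add: l_def powr_powr)
  have fl: "filterlim (\<lambda>s. l * s) (at_right 0) (at_right 0)"
    by (rule filterlim_times_pos[OF filterlim_ident l]) simp
  have "((\<lambda>s. l powr (be + 1) * (w (l * s) / (l * s))) \<longlongrightarrow> k) (at_right 0)"
    using tendsto_mult[OF tendsto_const filterlim_compose[OF w(2) fl], of "l powr (be + 1)"] by (simp add: lk)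
  moreover have "l powr (be + 1) * (w (l * s) / (l * s)) = l powr be * w (l * s) / s" for s
    using l by (simp add: powr_add)
  ultimately have 1: "((\<lambda>s. l powr be * w (l * s) / s) \<longlongrightarrow> k) (at_right 0)" by simp
  have "psi (l powr ((be + 1) * (p - 1)) * G (l * s)) = l powr (be + 1) * psi (G (l * s))" for s
    using p by (simp add: spow_mult powr_powr)
  then have 2: "((\<lambda>s. psi (l powr ((be + 1) * (p - 1)) * G (l * s))) \<longlongrightarrow> k) (at_right 0)"
    using tendsto_mult[OF tendsto_const filterlim_compose[OF w(3) fl], of "l powr (be + 1)"] by (simp add: lk)
  show ?thesis using scaling[OF w(1) l] 1 2 s0 l by (intro exI[of _ "s0 / l"]) (auto intro!: exI)
qed

text \<open>L'Hospital's rule applied to \<open>G / s powr (m + 1)\<close>; the denominator tends to infinity because \<open>m < - 1\<close>.\<close>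

lemma slope_at_regular_end:
  assumes s0: "0 < s0" and sol: "sol e {0<..<s0} w G" and w: "(w \<longlongrightarrow> C) (at_right 0)" and C: "0 < C"
  shows "((\<lambda>s. psi (G s) * s powr (1 - bex)) \<longlongrightarrow> psi (e * c * C powr q / (m + 1))) (at_right 0)"
proof -
  have ev: "\<forall>\<^sub>F s in at_right 0. s \<in> {0<..<s0}" using s0 by (rule eventually_at_right_real)
  have "((\<lambda>s. G s / s powr (m + 1)) \<longlongrightarrow> e * c * C powr q / (m + 1)) (at_right 0)"
  proof (rule lhopital_right_0_at_top[where f' = "\<lambda>s. e * (c * s powr m * w s powr q)" and g' = "\<lambda>s. (m + 1) * s powr m"])
    have "filterlim (\<lambda>s::real. inverse (s powr (- (m + 1)))) at_top (at_right 0)"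
      using m by (intro filterlim_inverse_at_top powr_tendsto_0_at_right)
        (auto intro: eventually_mono[OF eventually_at_right_less])
    then show "filterlim (\<lambda>s::real. s powr (m + 1)) at_top (at_right 0)" by (simp only: powr_minus inverse_inverse_eq)
    show "\<forall>\<^sub>F x in at_right 0. (m + 1) * x powr m \<noteq> 0"
      using ev by eventually_elim (use m in auto)
    show "\<forall>\<^sub>F x in at_right 0. (G has_real_derivative e * (c * x powr m * w x powr q)) (at x)"
      using ev by eventually_elim (use sol_deriv(3)[OF sol] in auto)
    show "\<forall>\<^sub>F x in at_right 0. ((\<lambda>s. s powr (m + 1)) has_real_derivative (m + 1) * x powr m) (at x)"
      using ev by eventually_elim (auto intro!: derivative_eq_intros)
    have "((\<lambda>s. e * c * w s powr q / (m + 1)) \<longlongrightarrow> e * c * C powr q / (m + 1)) (at_right 0)"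
      using C m by (intro tendsto_intros w) auto
    then show "((\<lambda>x. e * (c * x powr m * w x powr q) / ((m + 1) * x powr m)) \<longlongrightarrow> e * c * C powr q / (m + 1)) (at_right 0)"
    proof (rule Lim_transform_eventually)
      show "\<forall>\<^sub>F x in at_right 0. e * c * w x powr q / (m + 1) = e * (c * x powr m * w x powr q) / ((m + 1) * x powr m)"
        using ev by eventually_elim auto
    qed
  qed
  then have "((\<lambda>s. psi (G s / s powr (m + 1))) \<longlongrightarrow> psi (e * c * C powr q / (m + 1))) (at_right 0)"
    using p by (intro tendsto_spow) auto
  moreover have "psi (G s / s powr (m + 1)) = psi (G s) * s powr (1 - bex)" for s
  proof -
    have "psi (G s / s powr (m + 1)) = psi (s powr (- (m + 1)) * G s)" by (simp add: powr_minus divide_inverse mult.commute del: minus_add_distrib)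
    also have "\<dots> = s powr (- (m + 1) * (1 / (p - 1))) * psi (G s)" by (simp only: spow_mult powr_ge_zero powr_powr)
    also have "- (m + 1) * (1 / (p - 1)) = 1 - bex" using p by (simp add: bex_def field_simps)
    finally show ?thesis by (simp add: mult.commute)
  qed
  ultimately show ?thesis by simp
qed

end

section \<open>The radial equation\<close>

lemma flux_eq_spow: "flux p w r = spow (p - 1) (deriv w r)"
proof (cases "deriv w r = 0")
  case False
  have "\<bar>deriv w r\<bar> powr (p - 1) = \<bar>deriv w r\<bar> powr (p - 2) * \<bar>deriv w r\<bar>"
    using powr_mult_base[of "\<bar>deriv w r\<bar>" "p - 2"] by (simp add: mult.commute)
  then show ?thesis by (simp add: flux_def spow_def sgn_mult_abs mult.left_commute)
qed (simp add: flux_def)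

lemma pos_solution_subset: "pos_solution N p q \<sigma> \<epsilon> I w \<Longrightarrow> J \<subseteq> I \<Longrightarrow> pos_solution N p q \<sigma> \<epsilon> J w"
  by (auto simp: pos_solution_def)

locale radial_equation =
  fixes N p q \<sigma> :: real
  assumes rq: "p - 1 < q" and rp: "1 < p" and rs: "p < - \<sigma>" and rN: "- \<sigma> < N"
begin

text \<open>The exponent \<open>\<kappa>\<close> of the change of variable \<open>s = r powr (- \<kappa>)\<close>.\<close>

definition ka :: real where "ka = (N - p) / (p - 1)"

lemma ka_pos: "0 < ka" using rp rs rN by (simp add: ka_def)

sublocale emden_fowler p q "- 1 - (N + \<sigma>) / ka" "ka powr (- p)"
proof
  have "(p - 1) * ka = N - p" using rp by (simp add: ka_def)
  then have "(N + \<sigma>) / ka < p - 1" using ka_pos rs by (simp add: pos_divide_less_eq)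
  then show "- p < - 1 - (N + \<sigma>) / ka" by simp
  have "0 < (N + \<sigma>) / ka" using ka_pos rN by simp
  then show "- 1 - (N + \<sigma>) / ka < - 1" by simp
qed (use rp rq ka_pos in auto)

abbreviation mm :: real where "mm \<equiv> - 1 - (N + \<sigma>) / ka"

lemma ka_mm: "- ka * mm = N + \<sigma> + ka" using ka_pos by (simp add: field_simps)
lemma ka_p1: "(ka + 1) * (p - 1) = N - 1" using rp by (simp add: ka_def field_simps)

lemma powr_ka_inverse: "0 < r \<Longrightarrow> (r powr (- ka)) powr (- 1 / ka) = r"
  "0 < s \<Longrightarrow> (s powr (- 1 / ka)) powr (- ka) = s"
  using ka_pos by (auto simp: powr_powr)

text \<open>\<open>v\<close> is only required to agree with \<open>w (r powr (- ka))\<close> on \<open>R\<close>, so that it may be redefined elsewhere, such as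
  at the end point \<open>r\<^sub>0\<close>.\<close>

lemma sol_imp_pos_solution:
  assumes sol: "sol e I w G" and R: "open R" "\<And>r. r \<in> R \<Longrightarrow> 0 < r \<and> r powr (- ka) \<in> I"
    and v: "\<And>r. r \<in> R \<Longrightarrow> v r = w (r powr (- ka))"
  shows "pos_solution N p q \<sigma> (- e) R v"
    "\<And>r. r \<in> R \<Longrightarrow> deriv v r = - (ka * r powr (- ka - 1) * psi (G (r powr (- ka))))"
proof -
  have ds: "((\<lambda>r. r powr (- ka)) has_real_derivative - (ka * r powr (- ka - 1))) (at r)" if "r \<in> R" for r
    using R(2)[OF that] by (auto intro!: derivative_eq_intros)
  have dv: "(v has_real_derivative - (ka * r powr (- ka - 1) * psi (G (r powr (- ka))))) (at r)" if r: "r \<in> R" for r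
  proof (rule has_field_derivative_transform_within_open[OF _ R(1) r])
    show "((\<lambda>r. w (r powr (- ka))) has_real_derivative - (ka * r powr (- ka - 1) * psi (G (r powr (- ka))))) (at r)"
      using DERIV_chain2[OF sol_deriv(2)[OF sol] ds[OF r]] R(2)[OF r] by (simp add: mult.commute)
  qed (use v in auto)
  then show deriv: "deriv v r = - (ka * r powr (- ka - 1) * psi (G (r powr (- ka))))" if "r \<in> R" for r
    using that by (intro DERIV_imp_deriv)
  define f where "f = (\<lambda>r. - (ka powr (p - 1) * (r powr (- (N - 1)) * G (r powr (- ka)))))"
  have flux: "flux p v r = f r" if r: "r \<in> R" for r
  proof -
    have "flux p v r = - phi (ka * r powr (- ka - 1) * psi (G (r powr (- ka))))"
      unfolding flux_eq_spow deriv[OF r] by (rule spow_minus)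
    also have "phi (ka * r powr (- ka - 1) * psi (G (r powr (- ka)))) =
        (ka * r powr (- ka - 1)) powr (p - 1) * phi (psi (G (r powr (- ka))))"
      using ka_pos by (intro spow_mult) auto
    also have "(ka * r powr (- ka - 1)) powr (p - 1) = ka powr (p - 1) * r powr ((- ka - 1) * (p - 1))"
      by (simp only: powr_mult powr_powr)
    also have "(- ka - 1) * (p - 1) = - (N - 1)" using ka_p1 by (simp add: algebra_simps)
    finally show ?thesis by (simp add: f_def)
  qed
  show "pos_solution N p q \<sigma> (- e) R v"
    unfolding pos_solution_def
  proof (intro ballI conjI)
    fix r assume r: "r \<in> R"
    have r0: "0 < r" and rI: "r powr (- ka) \<in> I" using R(2)[OF r] by auto
    note d = sol_deriv[OF sol rI]
    show "0 < v r" using d(1) v[OF r] by simp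
    show "v differentiable (at r)" using dv[OF r] by (auto simp: real_differentiable_def)
    define G' where "G' = e * (ka powr (- p) * (r powr (- ka)) powr mm * w (r powr (- ka)) powr q)"
    define f' where "f' = - (ka powr (p - 1) * (- (N - 1) * r powr (- (N - 1) - 1) * G (r powr (- ka)) +
        G' * (- (ka * r powr (- ka - 1))) * r powr (- (N - 1))))"
    have "((\<lambda>r. r powr (- (N - 1))) has_real_derivative - (N - 1) * r powr (- (N - 1) - 1)) (at r)"
      using r0 by (auto intro!: derivative_eq_intros)
    from DERIV_minus[OF DERIV_cmult[OF DERIV_mult[OF this DERIV_chain2[OF d(3) ds[OF r]]], of "ka powr (p - 1)"]]
    have "(f has_real_derivative f') (at r)" unfolding f_def f'_def G'_def by simp
    then have df: "(flux p v has_real_derivative f') (at r)"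
      by (rule has_field_derivative_transform_within_open[OF _ R(1) r]) (use flux in auto)
    then show "flux p v differentiable (at r)" by (auto simp: real_differentiable_def)
    have rN: "(N - 1) / r * r powr (- (N - 1)) = (N - 1) * r powr (- (N - 1) - 1)"
    proof -
      have "r powr (- (N - 1) - 1) = r powr (- (N - 1)) / r" using r0 powr_diff[of r "- (N - 1)" 1] by simp
      then show ?thesis by (simp only: times_divide_eq_right times_divide_eq_left mult.commute)
    qed
    have "- f' - (N - 1) / r * f r = - (ka powr (p - 1) * ka) * (r powr (- ka - 1) * r powr (- (N - 1))) * G'
        + ka powr (p - 1) * G (r powr (- ka)) * ((N - 1) / r * r powr (- (N - 1)) - (N - 1) * r powr (- (N - 1) - 1))"
      unfolding f'_def f_def by (simp add: algebra_simps)
    also have "\<dots> = - (ka powr p) * r powr (- ka - N) * G'"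
    proof -
      have "r powr (- ka - 1) * r powr (- (N - 1)) = r powr ((- ka - 1) + (- (N - 1)))" by (rule powr_add[symmetric])
      also have "(- ka - 1) + (- (N - 1)) = - ka - N" by simp
      finally show ?thesis unfolding rN using ka_pos powr_mult_base[of ka "p - 1"] by (simp add: mult.commute)
    qed
    also have "G' = e * (ka powr (- p) * r powr (N + \<sigma> + ka) * w (r powr (- ka)) powr q)"
      unfolding G'_def powr_powr ka_mm ..
    also have "- (ka powr p) * r powr (- ka - N) * (e * (ka powr (- p) * r powr (N + \<sigma> + ka) * w (r powr (- ka)) powr q)) =
        - e * (ka powr p * ka powr (- p)) * (r powr (- ka - N) * r powr (N + \<sigma> + ka)) * w (r powr (- ka)) powr q"
      by simp
    also have "ka powr p * ka powr (- p) = 1" using ka_pos by (simp flip: powr_add)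
    also have "r powr (- ka - N) * r powr (N + \<sigma> + ka) = r powr \<sigma>" by (simp flip: powr_add)
    finally show "- deriv (flux p v) r - (N - 1) / r * flux p v r = - e * r powr \<sigma> * v r powr q"
      unfolding DERIV_imp_deriv[OF df] flux[OF r] v[OF r] by simp
  qed
qed

lemma pos_solution_imp_sol:
  assumes pos: "pos_solution N p q \<sigma> \<epsilon> R v"
    and I: "\<And>s. s \<in> I \<Longrightarrow> 0 < s \<and> s powr (- 1 / ka) \<in> R"
  shows "\<exists>G. sol (- \<epsilon>) I (\<lambda>s. v (s powr (- 1 / ka))) G"
proof
  define g where "g = (\<lambda>r. - (ka powr (1 - p) * (r powr (N - 1) * flux p v r)))"
  show "sol (- \<epsilon>) I (\<lambda>s. v (s powr (- 1 / ka))) (\<lambda>s. g (s powr (- 1 / ka)))"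
    unfolding sol_def
  proof (intro ballI conjI)
    fix s assume sI: "s \<in> I"
    define r where "r = s powr (- 1 / ka)"
    have s: "0 < s" and rR: "r \<in> R" using I[OF sI] by (auto simp: r_def)
    have r0: "0 < r" using s by (simp add: r_def)
    have sr: "s = r powr (- ka)" unfolding r_def using powr_ka_inverse(2)[OF s] by simp
    have dv: "(v has_real_derivative deriv v r) (at r)" and df: "(flux p v has_real_derivative deriv (flux p v) r) (at r)"
      and eq: "- deriv (flux p v) r - (N - 1) / r * flux p v r = \<epsilon> * r powr \<sigma> * v r powr q" and v0: "0 < v r"
      using pos rR unfolding pos_solution_def by (auto simp: DERIV_deriv_iff_real_differentiable)
    have "((\<lambda>s. s powr (- 1 / ka)) has_real_derivative - 1 / ka * s powr (- 1 / ka - 1)) (at s)"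
      using s by (auto intro!: derivative_eq_intros)
    also have "s powr (- 1 / ka - 1) = r powr (ka + 1)"
    proof -
      have "- ka * (- 1 / ka - 1) = ka + 1" using ka_pos by (simp add: field_simps)
      then show ?thesis unfolding sr by (simp only: powr_powr)
    qed
    finally have dr: "((\<lambda>s. s powr (- 1 / ka)) has_real_derivative - 1 / ka * r powr (ka + 1)) (at s)" .
    show "0 < v (s powr (- 1 / ka))" using v0 by (simp add: r_def)
    have "psi (g r) = - psi (ka powr (1 - p) * (r powr (N - 1) * phi (deriv v r)))"
      unfolding g_def flux_eq_spow by (rule spow_minus)
    also have "psi (ka powr (1 - p) * (r powr (N - 1) * phi (deriv v r))) =
        ka powr ((1 - p) * (1 / (p - 1))) * (r powr ((N - 1) * (1 / (p - 1))) * psi (phi (deriv v r)))"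
      by (simp only: spow_mult powr_ge_zero powr_powr)
    also have "(1 - p) * (1 / (p - 1)) = - 1" using rp by (simp add: field_simps)
    also have "(N - 1) * (1 / (p - 1)) = ka + 1" using rp by (simp add: ka_def field_simps)
    finally have psig: "psi (g r) = deriv v r * (- 1 / ka * r powr (ka + 1))"
      using ka_pos by (simp add: powr_minus field_simps)
    show "((\<lambda>s. v (s powr (- 1 / ka))) has_real_derivative psi (g (s powr (- 1 / ka)))) (at s)"
      using DERIV_chain2[OF dv[unfolded r_def] dr] psig by (simp add: r_def)
    have "((\<lambda>r. r powr (N - 1)) has_real_derivative (N - 1) * r powr (N - 1 - 1)) (at r)"
      using r0 by (auto intro!: derivative_eq_intros)
    from DERIV_minus[OF DERIV_cmult[OF DERIV_mult[OF this df], of "ka powr (1 - p)"]]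
    have "(g has_real_derivative - (ka powr (1 - p) * ((N - 1) * r powr (N - 1 - 1) * flux p v r + deriv (flux p v) r * r powr (N - 1)))) (at r)"
      unfolding g_def .
    also have "- (ka powr (1 - p) * ((N - 1) * r powr (N - 1 - 1) * flux p v r + deriv (flux p v) r * r powr (N - 1))) =
        ka powr (1 - p) * r powr (N - 1) * (- deriv (flux p v) r - (N - 1) / r * flux p v r)"
      using r0 powr_diff[of r "N - 1" 1] by (simp add: algebra_simps)
    also have "\<dots> = ka powr (1 - p) * r powr (N - 1) * (\<epsilon> * r powr \<sigma> * v r powr q)" unfolding eq ..
    finally have dg: "(g has_real_derivative ka powr (1 - p) * r powr (N - 1) * (\<epsilon> * r powr \<sigma> * v r powr q)) (at r)" .
    have "ka powr (1 - p) * r powr (N - 1) * (\<epsilon> * r powr \<sigma> * v r powr q) * (- 1 / ka * r powr (ka + 1)) =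
        - \<epsilon> * ((ka powr (1 - p) / ka) * (r powr (N - 1) * r powr \<sigma> * r powr (ka + 1)) * v r powr q)"
      by (simp add: mult_ac)
    also have "ka powr (1 - p) / ka = ka powr (- p)"
      using ka_pos powr_diff[of ka "1 - p" 1] by simp
    also have "r powr (N - 1) * r powr \<sigma> * r powr (ka + 1) = s powr mm"
      unfolding sr powr_powr ka_mm by (simp add: algebra_simps flip: powr_add)
    finally show "((\<lambda>s. g (s powr (- 1 / ka))) has_real_derivative
        - \<epsilon> * (ka powr - p * s powr mm * v (s powr (- 1 / ka)) powr q)) (at s)"
      using DERIV_chain2[OF dg[unfolded r_def] dr] by (simp add: r_def)
  qed
qed

lemma pos_solution_ball_imp_sol:
  assumes "pos_solution N p q \<sigma> \<epsilon> {0<..<\<rho>} v" "0 < \<rho>"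
  shows "\<exists>G. sol (- \<epsilon>) {\<rho> powr (- ka)<..} (\<lambda>s. v (s powr (- 1 / ka))) G"
proof (rule pos_solution_imp_sol[OF assms(1)])
  fix s assume "s \<in> {\<rho> powr (- ka)<..}"
  then have "\<rho> powr (- ka) < s" by simp
  moreover have "0 \<le> \<rho> powr (- ka)" by simp
  ultimately have s: "\<rho> powr (- ka) < s" "0 < s" by linarith+
  then have "s powr (- 1 / ka) < (\<rho> powr (- ka)) powr (- 1 / ka)"
    using ka_pos assms(2) by (intro powr_less_mono2_neg) auto
  then show "0 < s \<and> s powr (- 1 / ka) \<in> {0<..<\<rho>}" using s powr_ka_inverse(1)[OF assms(2)] by simp
qed

lemma no_local_source_solution: "0 < \<rho> \<Longrightarrow> \<not> pos_solution N p q \<sigma> 1 {0<..<\<rho>} v"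
  using pos_solution_ball_imp_sol[of 1 \<rho> v] no_source_solution[of "\<rho> powr (- ka)"] by auto

lemma nonglobal_source: "nonglobal N p q \<sigma> 1 I w"
  unfolding nonglobal_def
proof
  assume "\<exists>v. pos_solution N p q \<sigma> 1 {0<..} v \<and> (\<forall>r\<in>I. v r = w r)"
  then obtain v where "pos_solution N p q \<sigma> 1 {0<..} v" by blast
  then have "pos_solution N p q \<sigma> 1 {0<..<1} v" by (rule pos_solution_subset) auto
  then show False using no_local_source_solution[of 1 v] by simp
qed

text \<open>A global extension would be a solution on \<open>(0, \<infinity>)\<close> in \<open>s\<close>, and such solutions have nonpositive flux.\<close>

lemma nonglobal_increasing:
  assumes sol: "sol 1 {0<..<s0} W H" and s0: "0 < s0" and t: "t \<in> {0<..<s0}" "0 < H t"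
  shows "nonglobal N p q \<sigma> (- 1) {s0 powr (- 1 / ka)<..} (\<lambda>r. W (r powr (- ka)))"
  unfolding nonglobal_def
proof
  assume "\<exists>v. pos_solution N p q \<sigma> (- 1) {0<..} v \<and> (\<forall>r\<in>{s0 powr (- 1 / ka)<..}. v r = W (r powr (- ka)))"
  then obtain v where v: "pos_solution N p q \<sigma> (- 1) {0<..} v"
    "\<And>r. s0 powr (- 1 / ka) < r \<Longrightarrow> v r = W (r powr (- ka))" by auto
  have "\<exists>G. sol (- (- 1)) {0<..} (\<lambda>s. v (s powr (- 1 / ka))) G"
    by (rule pos_solution_imp_sol[OF v(1)]) auto
  then obtain G where G: "sol 1 {0<..} (\<lambda>s. v (s powr (- 1 / ka))) G" by auto
  have eq: "v (s powr (- 1 / ka)) = W s" if "s \<in> {0<..<s0}" for s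
  proof -
    have "s0 powr (- 1 / ka) < s powr (- 1 / ka)" using that ka_pos by (intro powr_less_mono2_neg) auto
    then show ?thesis using v(2) powr_ka_inverse(2)[of s] that by simp
  qed
  have "(W has_real_derivative psi (G t)) (at t)"
    by (rule has_field_derivative_transform_within_open[OF sol_deriv(2)[OF G] open_greaterThanLessThan t(1) eq])
       (use t in auto)
  then have "psi (G t) = psi (H t)" using DERIV_unique[OF _ sol_deriv(2)[OF sol t(1)]] by blast
  then have "phi (psi (G t)) = phi (psi (H t))" by simp
  then have "G t = H t" by simp
  moreover have "G t \<le> 0" using t by (intro G_nonpos[OF order_refl G]) auto
  ultimately show False using t(2) by simp
qed

section \<open>Limits under the change of variable\<close>

lemma powr_ka_at_top: "filterlim (\<lambda>r. r powr (- ka)) (at_right 0) at_top"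
  unfolding filterlim_at using powr_tendsto_0[of "- ka"] ka_pos
  by (auto intro: eventually_mono[OF eventually_gt_at_top[of 0]])

lemma powr_ka_at_0: "filterlim (\<lambda>r. r powr (- ka)) at_top (at_right 0)"
proof -
  have "filterlim (\<lambda>r::real. inverse (r powr ka)) at_top (at_right 0)"
    using ka_pos by (intro filterlim_inverse_at_top powr_tendsto_0_at_right)
      (auto intro: eventually_mono[OF eventually_at_right_less])
  then show ?thesis by (simp only: powr_minus)
qed

lemma powr_ka_at_1: "filterlim (\<lambda>r. r powr (- ka)) (at_left 1) (at_right 1)"
  "filterlim (\<lambda>r. r powr (- ka)) (at_right 1) (at_left 1)"
proof -
  have lim: "((\<lambda>r::real. r powr (- ka)) \<longlongrightarrow> 1 powr (- ka)) (at 1 within S)" for S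
    by (intro tendsto_intros) auto
  have l: "\<forall>\<^sub>F r in at_right 1. r powr (- ka) < (1::real)"
    using eventually_at_right_less[of 1]
  proof eventually_elim
    case (elim r)
    then show ?case using powr_less_mono2_neg[of "- ka" 1 r] ka_pos by simp
  qed
  have "\<forall>\<^sub>F r in at_left 1. r \<in> {1/2<..<1::real}" by (rule eventually_at_left_real) simp
  then have r: "\<forall>\<^sub>F r in at_left 1. (1::real) < r powr (- ka)"
  proof eventually_elim
    case (elim r)
    then show ?case using powr_less_mono2_neg[of "- ka" r 1] ka_pos by simp
  qed
  show "filterlim (\<lambda>r. r powr (- ka)) (at_left 1) (at_right 1)"
    unfolding filterlim_at using lim l by (auto elim: eventually_mono)
  show "filterlim (\<lambda>r. r powr (- ka)) (at_right 1) (at_left 1)"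
    unfolding filterlim_at using lim r by (auto elim: eventually_mono)
qed

section \<open>The explicit solution in the radial variable\<close>

lemma gam_eq: "gam p q \<sigma> = - (ka * be)"
proof -
  have "ka * (mm + p) = - (p + \<sigma>)"
  proof -
    have "ka * (mm + p) = ka * (p - 1) - (N + \<sigma>)" using ka_pos by (simp add: field_simps)
    also have "ka * (p - 1) = N - p" using rp by (simp add: ka_def)
    finally show ?thesis by simp
  qed
  then have "ka * be = - (p + \<sigma>) / nu" by (simp only: be_def times_divide_eq_right)
  then have "- (ka * be) = (p + \<sigma>) / nu" by (simp only: minus_divide_left minus_minus)
  moreover have "q + 1 - p = nu" by (simp add: nu_def)
  ultimately show ?thesis by (simp add: gam_def)
qed

lemma a_star_eq: "a_star N p q \<sigma> = ast"
proof -
  define g where "g = ka * be"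
  have g: "0 < g" using ka_pos be_pos by (simp add: g_def)
  define z where "z = be powr (p - 1) * ((be + 1) * (p - 1)) / ka powr (- p)"
  have z: "0 < z" unfolding z_def using be_pos rp ka_pos by simp
  have "(- 1) * \<bar>gam p q \<sigma>\<bar> powr (p - 2) * gam p q \<sigma> * (N - p - (p - 1) * gam p q \<sigma>) =
      g powr (p - 2) * g * (N - p + (p - 1) * g)" using g by (simp add: gam_eq g_def)
  also have "g powr (p - 2) * g = g powr (p - 1)" using g powr_mult_base[of g "p - 2"] by (simp add: mult.commute)
  also have "N - p + (p - 1) * g = ka * ((be + 1) * (p - 1))"
  proof -
    have "ka * (p - 1) = N - p" using rp by (simp add: ka_def)
    then have "N - p + (p - 1) * g = ka * (p - 1) + (p - 1) * (ka * be)" by (simp only: g_def)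
    then show ?thesis by (simp add: algebra_simps)
  qed
  also have "g powr (p - 1) * (ka * ((be + 1) * (p - 1))) = (ka * ka powr (p - 1)) * (be powr (p - 1) * ((be + 1) * (p - 1)))"
    using ka_pos be_pos by (simp add: g_def powr_mult)
  also have "ka * ka powr (p - 1) = ka powr p" using ka_pos powr_mult_base[of ka "p - 1"] by simp
  also have "ka powr p * (be powr (p - 1) * ((be + 1) * (p - 1))) = z"
    using ka_pos by (simp add: z_def powr_minus divide_inverse)
  finally have eq: "(- 1) * \<bar>gam p q \<sigma>\<bar> powr (p - 2) * gam p q \<sigma> * (N - p - (p - 1) * gam p q \<sigma>) = z" .
  have nu: "q - p + 1 = nu" by (simp add: nu_def)
  show ?thesis
    unfolding a_star_def eq nu
  proof (rule the_equality)
    have ast: "ast = z powr (1 / nu)" unfolding ast_def z_def ..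
    show "0 < ast \<and> ast powr nu = z" using ast_pos z nu_pos by (simp add: ast powr_powr)
    fix a assume "0 < a \<and> a powr nu = z"
    then have "z powr (1 / nu) = (a powr nu) powr (1 / nu)" "0 < a" by auto
    then show "a = ast" using nu_pos by (simp add: ast powr_powr)
  qed
qed

lemma w_star_eq: "w_star N p q \<sigma> r = wst (r powr (- ka))"
  by (simp add: w_star_def wst_def a_star_eq gam_eq powr_powr)

lemma asymp_equiv_w_star:
  assumes "((\<lambda>s. W s / wst s) \<longlongrightarrow> 1) F" "filterlim (\<lambda>r. r powr (- ka)) F F'"
    "\<forall>\<^sub>F r in F'. v r = W (r powr (- ka))"
  shows "v \<sim>[F'] w_star N p q \<sigma>"
proof (rule asymp_equivI')
  have "((\<lambda>r. W (r powr (- ka)) / wst (r powr (- ka))) \<longlongrightarrow> 1) F'"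
    using filterlim_compose[OF assms(1,2)] .
  then show "((\<lambda>r. v r / w_star N p q \<sigma> r) \<longlongrightarrow> 1) F'"
    by (rule Lim_transform_eventually) (use assms(3) in \<open>auto elim!: eventually_mono simp: w_star_eq\<close>)
qed

lemma w_star_solution: "pos_solution N p q \<sigma> (- 1) {0<..} (w_star N p q \<sigma>)"
  by (rule sol_imp_pos_solution(1)[OF wst_sol]) (auto simp: w_star_eq)

lemma w_star_tendsto_0: "(w_star N p q \<sigma> \<longlongrightarrow> 0) (at_right 0)"
  unfolding w_star_eq[abs_def] by (rule filterlim_compose[OF wst_tendsto_0 powr_ka_at_0])

lemma w_star_cusp:
  assumes "- gam p q \<sigma> < 1" "0 < \<rho>"
  shows "cusp_solution N p q \<sigma> (- 1) \<rho> (w_star N p q \<sigma>)"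
  unfolding cusp_solution_def
proof (intro conjI)
  define g where "g = - gam p q \<sigma>"
  have g: "0 < g" "g < 1" using assms ka_pos be_pos by (auto simp: gam_eq g_def)
  show "pos_solution N p q \<sigma> (- 1) {0<..<\<rho>} (w_star N p q \<sigma>)"
    by (rule pos_solution_subset[OF w_star_solution]) auto
  show "\<exists>c. (w_star N p q \<sigma> \<longlongrightarrow> c) (at_right 0)" using w_star_tendsto_0 by blast
  have d: "\<bar>deriv (w_star N p q \<sigma>) r\<bar> = ast * g * r powr (g - 1)" if "0 < r" for r
  proof -
    have "(w_star N p q \<sigma> has_real_derivative ast * (g * r powr (g - 1))) (at r)"
      unfolding w_star_def[abs_def] a_star_eq g_def using that by (auto intro!: derivative_eq_intros)
    then show ?thesis using ast_pos g by (simp add: DERIV_imp_deriv abs_mult)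
  qed
  have "filterlim (\<lambda>r::real. inverse (r powr (- (g - 1)))) at_top (at_right 0)"
    using g by (intro filterlim_inverse_at_top powr_tendsto_0_at_right)
      (auto intro: eventually_mono[OF eventually_at_right_less])
  then have "filterlim (\<lambda>r::real. r powr (g - 1)) at_top (at_right 0)" by (simp only: powr_minus inverse_inverse_eq)
  then have "filterlim (\<lambda>r. ast * g * r powr (g - 1)) at_top (at_right 0)"
    using ast_pos g by (intro filterlim_tendsto_pos_mult_at_top[OF tendsto_const]) auto
  then show "filterlim (\<lambda>r. \<bar>deriv (w_star N p q \<sigma>) r\<bar>) at_top (at_right 0)"
    by (rule filterlim_cong[THEN iffD1, rotated -1])
       (use d in \<open>auto intro: eventually_mono[OF eventually_at_right_less]\<close>)
qed

section \<open>Solutions of the radial equation\<close>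

lemma singular_behaviour_at_0:
  assumes "pos_solution N p q \<sigma> (- 1) {0<..<\<rho>} v" "0 < \<rho>"
  shows "v \<sim>[at_right 0] w_star N p q \<sigma>" "(v \<longlongrightarrow> 0) (at_right 0)"
proof -
  define W where "W = (\<lambda>s. v (s powr (- 1 / ka)))"
  obtain G where G: "sol 1 {\<rho> powr (- ka)<..} W G"
    using pos_solution_ball_imp_sol[OF assms] by (auto simp: W_def)
  have ev: "\<forall>\<^sub>F r in at_right 0. W (r powr (- ka)) = v r"
    using eventually_at_right_less[of 0]
    by eventually_elim (simp only: W_def powr_ka_inverse(1))
  show "v \<sim>[at_right 0] w_star N p q \<sigma>"
    using ev by (intro asymp_equiv_w_star[OF ratio_tendsto_1[OF _ G] powr_ka_at_0]) (auto elim: eventually_mono)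
  show "(v \<longlongrightarrow> 0) (at_right 0)"
    by (rule Lim_transform_eventually[OF filterlim_compose[OF w_tendsto_0[OF _ G] powr_ka_at_0] ev]) simp
qed

lemma exterior_interval:
  assumes "0 < s0" "s0 powr (- 1 / ka) < r" shows "0 < r \<and> r powr (- ka) \<in> {0<..<s0}"
proof -
  have r: "0 < r" using assms powr_gt_zero[of s0 "- 1 / ka"] by linarith
  have "r powr (- ka) < (s0 powr (- 1 / ka)) powr (- ka)"
    using assms ka_pos by (intro powr_less_mono2_neg) auto
  then show ?thesis using powr_ka_inverse(2)[OF assms(1)] r by simp
qed

text \<open>Up to sign, \<open>D\<close> is \<open>ka\<close> times the limit found in \<open>slope_at_regular_end\<close>; the powers of \<open>r\<close> match because
  \<open>- ka * (1 - bex) = - (\<sigma> + 1) / (p - 1) - ka - 1\<close>.\<close>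

lemma regular_at_infinity:
  assumes sol: "sol e {0<..<s0} w G" and s0: "0 < s0" and e: "e = 1 \<or> e = - 1" and w: "(w \<longlongrightarrow> 1) (at_right 0)"
  shows "\<exists>D>0. ((\<lambda>r. r powr (- ((\<sigma> + 1) / (p - 1))) * deriv (\<lambda>r. w (r powr (- ka))) r) \<longlongrightarrow> e * D) at_top"
    "((\<lambda>r. w (r powr (- ka))) \<longlongrightarrow> 1) at_top"
proof -
  show "((\<lambda>r. w (r powr (- ka))) \<longlongrightarrow> 1) at_top" by (rule filterlim_compose[OF w powr_ka_at_top])
  define L where "L = psi (ka powr (- p) / (- mm - 1))"
  have "0 < ka powr (- p) / (- mm - 1)" using m(2) c by (intro divide_pos_pos) linarith+
  then have L: "0 < L" unfolding L_def psi_pos_iff .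
  have "e * ka powr (- p) * 1 powr q / (mm + 1) = - (e * (ka powr (- p) / (- mm - 1)))"
    using m by (simp add: field_simps)
  moreover have "psi (- (e * (ka powr (- p) / (- mm - 1)))) = - e * L"
    using e by (auto simp: L_def spow_minus)
  ultimately have psiL: "psi (e * ka powr (- p) * 1 powr q / (mm + 1)) = - e * L" by metis
  have "((\<lambda>s. - ka * (psi (G s) * s powr (1 - bex))) \<longlongrightarrow> - ka * (- e * L)) (at_right 0)"
    using slope_at_regular_end[OF s0 sol w zero_less_one] unfolding psiL by (intro tendsto_mult[OF tendsto_const])
  from filterlim_compose[OF this powr_ka_at_top]
  have "((\<lambda>r. - ka * (psi (G (r powr (- ka))) * (r powr (- ka)) powr (1 - bex))) \<longlongrightarrow> e * (ka * L)) at_top"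
    by (simp add: mult_ac)
  moreover have "\<forall>\<^sub>F r in at_top. - ka * (psi (G (r powr (- ka))) * (r powr (- ka)) powr (1 - bex)) =
      r powr (- ((\<sigma> + 1) / (p - 1))) * deriv (\<lambda>r. w (r powr (- ka))) r"
    using eventually_gt_at_top[of "s0 powr (- 1 / ka)"]
  proof eventually_elim
    case (elim r)
    have d: "deriv (\<lambda>r. w (r powr (- ka))) r = - (ka * r powr (- ka - 1) * psi (G (r powr (- ka))))"
      by (rule sol_imp_pos_solution(2)[OF sol, of "{s0 powr (- 1 / ka)<..}"])
         (use exterior_interval[OF s0] elim in auto)
    have "- ka * (1 - bex) = - ((\<sigma> + 1) / (p - 1)) + (- ka - 1)"
    proof -
      have "ka * bex = (ka * (mm + p)) / (p - 1)" by (simp only: bex_def times_divide_eq_right)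
      also have "ka * (mm + p) = ka * (p - 1) - (N + \<sigma>)" using ka_pos by (simp add: field_simps)
      also have "ka * (p - 1) = N - p" using rp by (simp add: ka_def)
      also have "(N - p - (N + \<sigma>)) / (p - 1) = - ((\<sigma> + 1) / (p - 1)) - 1" using rp by (simp add: field_simps)
      finally show ?thesis by (simp add: algebra_simps)
    qed
    then have "(r powr (- ka)) powr (1 - bex) = r powr (- ((\<sigma> + 1) / (p - 1))) * r powr (- ka - 1)"
      by (simp only: powr_powr powr_add)
    then show ?case unfolding d by simp
  qed
  ultimately have "((\<lambda>r. r powr (- ((\<sigma> + 1) / (p - 1))) * deriv (\<lambda>r. w (r powr (- ka))) r) \<longlongrightarrow> e * (ka * L)) at_top"
    by (rule Lim_transform_eventually)
  moreover have "0 < ka * L" using ka_pos L by simp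
  ultimately show "\<exists>D>0. ((\<lambda>r. r powr (- ((\<sigma> + 1) / (p - 1))) * deriv (\<lambda>r. w (r powr (- ka))) r) \<longlongrightarrow> e * D) at_top"
    by blast
qed

lemma local_regular_at_infinity:
  assumes "\<epsilon> \<in> {1, - 1}"
  shows "\<exists>r0>0. \<exists>w. \<exists>C>0. \<exists>D>0.
            pos_solution N p q \<sigma> \<epsilon> {r0<..} w \<and> nonglobal N p q \<sigma> \<epsilon> {r0<..} w \<and>
            (w \<longlongrightarrow> C) at_top \<and>
            ((\<lambda>r. r powr (- ((\<sigma> + 1) / (p - 1))) * deriv w r) \<longlongrightarrow> - \<epsilon> * D) at_top"
proof -
  have \<epsilon>: "\<epsilon> = 1 \<or> \<epsilon> = - 1" using assms by auto
  have "\<exists>s0>0. \<exists>W H. sol (- \<epsilon>) {0<..<s0} W H \<and> (W \<longlongrightarrow> 1) (at_right 0) \<and>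
      nonglobal N p q \<sigma> \<epsilon> {s0 powr (- 1 / ka)<..} (\<lambda>r. W (r powr (- ka)))"
    using \<epsilon>
  proof
    assume e: "\<epsilon> = 1"
    show ?thesis using source_regular_solution nonglobal_source unfolding e by blast
  next
    assume e: "\<epsilon> = - 1"
    obtain W H t where "sol 1 {0<..<1} W H" "(W \<longlongrightarrow> 1) (at_right 0)" "t \<in> {0<..<1}" "0 < H t"
      using local_regular_increasing_solution by blast
    then show ?thesis using nonglobal_increasing[of 1 W H t] unfolding e
      by (intro exI[of _ 1] conjI exI[of _ W] exI[of _ H]) auto
  qed
  then obtain s0 W H where s0: "0 < s0" and sol: "sol (- \<epsilon>) {0<..<s0} W H" and lim: "(W \<longlongrightarrow> 1) (at_right 0)"
    and ng: "nonglobal N p q \<sigma> \<epsilon> {s0 powr (- 1 / ka)<..} (\<lambda>r. W (r powr (- ka)))" by blast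
  have "pos_solution N p q \<sigma> (- (- \<epsilon>)) {s0 powr (- 1 / ka)<..} (\<lambda>r. W (r powr (- ka)))"
    by (rule sol_imp_pos_solution(1)[OF sol]) (use exterior_interval[OF s0] in auto)
  moreover have "- \<epsilon> = 1 \<or> - \<epsilon> = - 1" using \<epsilon> by auto
  ultimately have pos: "pos_solution N p q \<sigma> \<epsilon> {s0 powr (- 1 / ka)<..} (\<lambda>r. W (r powr (- ka)))"
    and e: "- \<epsilon> = 1 \<or> - \<epsilon> = - 1" by simp_all
  note r = regular_at_infinity[OF sol s0 e lim]
  have "0 < s0 powr (- 1 / ka)" using s0 by simp
  then show ?thesis using pos ng r zero_less_one by blast
qed

lemma local_fundamental_at_infinity:
  assumes \<epsilon>: "\<epsilon> = 1 \<or> \<epsilon> = - 1" and k: "0 < k"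
  shows "\<exists>r0>0. \<exists>w. pos_solution N p q \<sigma> \<epsilon> {r0<..} w \<and> nonglobal N p q \<sigma> \<epsilon> {r0<..} w \<and>
            (w \<longlongrightarrow> 0) at_top \<and>
            ((\<lambda>r. r powr ((N - p) / (p - 1)) * w r) \<longlongrightarrow> k) at_top \<and>
            ((\<lambda>r. r powr ((N - 1) / (p - 1)) * deriv w r) \<longlongrightarrow> - (ka * k)) at_top"
proof -
  have "- \<epsilon> = 1 \<or> - \<epsilon> = - 1" using \<epsilon> by auto
  from linear_solution[OF this k] obtain s0 W G where s0: "0 < s0" and sol: "sol (- \<epsilon>) {0<..<s0} W G"
    and W: "((\<lambda>s. W s / s) \<longlongrightarrow> k) (at_right 0)" and G: "((\<lambda>s. psi (G s)) \<longlongrightarrow> k) (at_right 0)" by blast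
  define v where "v = (\<lambda>r. W (r powr (- ka)))"
  define r0 where "r0 = s0 powr (- 1 / ka)"
  have r0: "0 < r0" using s0 by (simp add: r0_def)
  have R: "0 < r \<and> r powr (- ka) \<in> {0<..<s0}" if "r \<in> {r0<..}" for r
    using exterior_interval[OF s0] that by (auto simp: r0_def)
  have "pos_solution N p q \<sigma> (- (- \<epsilon>)) {r0<..} v"
    by (rule sol_imp_pos_solution(1)[OF sol _ R]) (auto simp: v_def)
  then have pos: "pos_solution N p q \<sigma> \<epsilon> {r0<..} v" by simp
  have deriv: "deriv v r = - (ka * r powr (- ka - 1) * psi (G (r powr (- ka))))" if "r0 < r" for r
    by (rule sol_imp_pos_solution(2)[OF sol open_greaterThan R]) (use that in \<open>auto simp: v_def\<close>)
  have ng: "nonglobal N p q \<sigma> \<epsilon> {r0<..} v"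
    using \<epsilon>
  proof
    assume "\<epsilon> = 1" then show ?thesis using nonglobal_source by simp
  next
    assume e: "\<epsilon> = - 1"
    have "\<forall>\<^sub>F s in at_right 0. 0 < psi (G s)" using order_tendstoD(1)[OF G k] .
    moreover have "\<forall>\<^sub>F s in at_right 0. s \<in> {0<..<s0}" using s0 by (rule eventually_at_right_real)
    ultimately have "\<forall>\<^sub>F s in at_right 0. 0 < G s \<and> s \<in> {0<..<s0}" by eventually_elim auto
    then obtain t where "0 < G t" "t \<in> {0<..<s0}" using eventually_happens'[OF trivial_limit_at_right_real] by blast
    then show ?thesis using nonglobal_increasing[of s0 W G t] sol s0 unfolding e v_def r0_def by simp
  qed
  have "((\<lambda>s. W s / s * s) \<longlongrightarrow> k * 0) (at_right 0)" by (intro tendsto_mult W tendsto_ident_at)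
  then have "((\<lambda>s. W s / s * s) \<longlongrightarrow> 0) (at_right 0)" by simp
  then have "(W \<longlongrightarrow> 0) (at_right 0)"
  proof (rule Lim_transform_eventually)
    show "\<forall>\<^sub>F s in at_right 0. W s / s * s = W s"
      using eventually_at_right_less[of 0] by eventually_elim simp
  qed
  from filterlim_compose[OF this powr_ka_at_top] have v0: "(v \<longlongrightarrow> 0) at_top" by (simp add: v_def)
  have v1: "((\<lambda>r. r powr ((N - p) / (p - 1)) * v r) \<longlongrightarrow> k) at_top"
    using filterlim_compose[OF W powr_ka_at_top]
    by (rule Lim_transform_eventually) (auto simp: v_def ka_def[symmetric] powr_minus field_simps)
  have v2: "((\<lambda>r. r powr ((N - 1) / (p - 1)) * deriv v r) \<longlongrightarrow> - (ka * k)) at_top"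
  proof (rule Lim_transform_eventually)
    show "((\<lambda>r. - (ka * psi (G (r powr (- ka))))) \<longlongrightarrow> - (ka * k)) at_top"
      by (intro tendsto_intros filterlim_compose[OF G powr_ka_at_top])
    show "\<forall>\<^sub>F r in at_top. - (ka * psi (G (r powr (- ka)))) = r powr ((N - 1) / (p - 1)) * deriv v r"
      using eventually_gt_at_top[of r0]
    proof eventually_elim
      case (elim r)
      have "(N - 1) / (p - 1) = ka + 1" using rp by (simp add: ka_def field_simps)
      moreover have "r powr (ka + 1) * r powr (- ka - 1) = 1" using elim r0 by (simp flip: powr_add)
      ultimately show ?case unfolding deriv[OF elim] by (simp add: mult_ac)
    qed
  qed
  show ?thesis using r0 pos ng v0 v1 v2 by blast
qed

lemma global_regular:
  "\<exists>w. \<exists>C>0. \<exists>D>0.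
        pos_solution N p q \<sigma> (- 1) {0<..} w \<and>
        w \<sim>[at_right 0] w_star N p q \<sigma> \<and>
        (w \<longlongrightarrow> C) at_top \<and>
        ((\<lambda>r. r powr (- ((\<sigma> + 1) / (p - 1))) * deriv w r) \<longlongrightarrow> D) at_top"
proof -
  obtain W H where W: "sol 1 {0<..} W H" "(W \<longlongrightarrow> 1) (at_right 0)" using global_regular_solution by blast
  define v where "v = (\<lambda>r. W (r powr (- ka)))"
  have pos: "pos_solution N p q \<sigma> (- 1) {0<..} v"
    by (rule sol_imp_pos_solution(1)[OF W(1)]) (auto simp: v_def)
  have "v \<sim>[at_right 0] w_star N p q \<sigma>"
    by (rule singular_behaviour_at_0(1)[of 1]) (auto intro: pos_solution_subset[OF pos])
  moreover have "sol 1 {0<..<1} W H" by (rule sol_subset[OF W(1)]) auto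
  from regular_at_infinity[OF this zero_less_one _ W(2)] obtain D where "0 < D"
    "((\<lambda>r. r powr (- ((\<sigma> + 1) / (p - 1))) * deriv v r) \<longlongrightarrow> D) at_top" "(v \<longlongrightarrow> 1) at_top"
    by (auto simp: v_def)
  ultimately show ?thesis using pos zero_less_one by blast
qed

lemma exterior_interval_1: "1 < r \<Longrightarrow> 0 < r \<and> r powr (- ka) \<in> {0<..<1}"
  using exterior_interval[of 1 r] by simp

lemma exterior_vanishing:
  "\<exists>r0>0. \<exists>w.
        pos_solution N p q \<sigma> (- 1) {r0<..} w \<and>
        w r0 = 0 \<and> (w \<longlongrightarrow> 0) (at_right r0) \<and>
        w \<sim>[at_top] w_star N p q \<sigma>"
proof -
  obtain W H where W: "sol 1 {0<..<1} W H" "((\<lambda>s. W s / wst s) \<longlongrightarrow> 1) (at_right 0)" "(W \<longlongrightarrow> 0) (at_left 1)"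
    using singular_solution_vanishing by blast
  define v where "v = (\<lambda>r. if 1 < r then W (r powr (- ka)) else 0)"
  have "pos_solution N p q \<sigma> (- 1) {1<..} v"
    by (rule sol_imp_pos_solution(1)[OF W(1)]) (use exterior_interval_1 in \<open>auto simp: v_def\<close>)
  moreover have "v 1 = 0" by (simp add: v_def)
  moreover have "(v \<longlongrightarrow> 0) (at_right 1)"
    using filterlim_compose[OF W(3) powr_ka_at_1(1)]
    by (rule Lim_transform_eventually) (auto simp: v_def intro: eventually_mono[OF eventually_at_right_less])
  moreover have "v \<sim>[at_top] w_star N p q \<sigma>"
    by (rule asymp_equiv_w_star[OF W(2) powr_ka_at_top])
       (auto simp: v_def intro: eventually_mono[OF eventually_gt_at_top[of 1]])
  ultimately show ?thesis using zero_less_one by blast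
qed

lemma exterior_blow_up:
  "\<exists>r0>0. \<exists>w.
        pos_solution N p q \<sigma> (- 1) {r0<..} w \<and>
        filterlim w at_top (at_right r0) \<and>
        w \<sim>[at_top] w_star N p q \<sigma>"
proof -
  obtain W H where W: "sol 1 {0<..<1} W H" "((\<lambda>s. W s / wst s) \<longlongrightarrow> 1) (at_right 0)" "filterlim W at_top (at_left 1)"
    using singular_solution_blowing_up by blast
  define v where "v = (\<lambda>r. W (r powr (- ka)))"
  have "pos_solution N p q \<sigma> (- 1) {1<..} v"
    by (rule sol_imp_pos_solution(1)[OF W(1)]) (use exterior_interval_1 in \<open>auto simp: v_def\<close>)
  moreover have "filterlim v at_top (at_right 1)"
    unfolding v_def by (rule filterlim_compose[OF W(3) powr_ka_at_1(1)])
  moreover have "v \<sim>[at_top] w_star N p q \<sigma>"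
    by (rule asymp_equiv_w_star[OF W(2) powr_ka_at_top]) (simp add: v_def)
  ultimately show ?thesis using zero_less_one by blast
qed

text \<open>An extension beyond \<open>r = 1\<close> would be continuous, hence bounded, at \<open>1\<close>.\<close>

lemma interior_blow_up:
  "\<exists>r0>0. \<exists>w.
        pos_solution N p q \<sigma> (- 1) {0<..<r0} w \<and> nonglobal N p q \<sigma> (- 1) {0<..<r0} w \<and>
        w \<sim>[at_right 0] w_star N p q \<sigma> \<and>
        filterlim w at_top (at_left r0)"
proof -
  obtain W H where W: "sol 1 {1<..} W H" "filterlim W at_top (at_right 1)"
    using decaying_solution_blowing_up by blast
  define v where "v = (\<lambda>r. W (r powr (- ka)))"
  have R: "0 < r \<and> r powr (- ka) \<in> {1<..}" if "r \<in> {0<..<1}" for r :: real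
    using that powr_less_mono2_neg[of "- ka" r 1] ka_pos by simp
  have pos: "pos_solution N p q \<sigma> (- 1) {0<..<1} v"
    by (rule sol_imp_pos_solution(1)[OF W(1) _ R]) (auto simp: v_def)
  have lim: "filterlim v at_top (at_left 1)"
    unfolding v_def by (rule filterlim_compose[OF W(2) powr_ka_at_1(2)])
  have "nonglobal N p q \<sigma> (- 1) {0<..<1} v"
    unfolding nonglobal_def
  proof
    assume "\<exists>u. pos_solution N p q \<sigma> (- 1) {0<..} u \<and> (\<forall>r\<in>{0<..<1}. u r = v r)"
    then obtain u where u: "pos_solution N p q \<sigma> (- 1) {0<..} u" "\<And>r. r \<in> {0<..<1} \<Longrightarrow> u r = v r" by blast
    have "u differentiable (at 1)" using u(1) by (simp add: pos_solution_def)
    then have "isCont u 1" using differentiable_imp_continuous_within by blast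
    then have "(u \<longlongrightarrow> u 1) (at_left 1)" by (auto simp: isCont_def intro: tendsto_within_subset)
    moreover have "\<forall>\<^sub>F r in at_left 1. u r = v r"
    proof -
      have "\<forall>\<^sub>F r in at_left 1. r \<in> {0<..<1::real}" by (rule eventually_at_left_real) simp
      then show ?thesis by eventually_elim (use u(2) in auto)
    qed
    ultimately have "(v \<longlongrightarrow> u 1) (at_left 1)" by (rule Lim_transform_eventually)
    then show False using not_tendsto_and_filterlim_at_infinity[OF trivial_limit_at_left_real _ filterlim_at_top_imp_at_infinity[OF lim]] by blast
  qed
  moreover have "v \<sim>[at_right 0] w_star N p q \<sigma>" by (rule singular_behaviour_at_0(1)[OF pos]) simp
  ultimately show ?thesis using pos lim zero_less_one by blast
qed

end

theorem theorem4p15: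
  fixes N p q \<sigma> :: real
  assumes "q > p - 1" and "p - 1 > 0" and "p < - \<sigma>" and "- \<sigma> < N"
  shows
    "((\<forall>\<rho>>0. \<forall>c w. \<not> C0_regular N p q \<sigma> 1 \<rho> c w) \<and>
      (\<forall>\<rho>>0. \<forall>c w. C0_regular N p q \<sigma> (-1) \<rho> c w \<longrightarrow>
          c = 0 \<and> w \<sim>[at_right 0] w_star N p q \<sigma>)) \<and>
     (\<forall>\<epsilon>\<in>{1, -1}.
        (\<exists>r0>0. \<exists>w. \<exists>C>0. \<exists>D>0.
            pos_solution N p q \<sigma> \<epsilon> {r0<..} w \<and> nonglobal N p q \<sigma> \<epsilon> {r0<..} w \<and>
            (w \<longlongrightarrow> C) at_top \<and>
            ((\<lambda>r. r powr (- ((\<sigma> + 1) / (p - 1))) * deriv w r) \<longlongrightarrow> - \<epsilon> * D) at_top) \<and>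
        (\<exists>c::real \<Rightarrow> real. \<forall>k>0. c k > 0 \<and> (\<exists>r0>0. \<exists>w.
            pos_solution N p q \<sigma> \<epsilon> {r0<..} w \<and> nonglobal N p q \<sigma> \<epsilon> {r0<..} w \<and>
            (w \<longlongrightarrow> 0) at_top \<and>
            ((\<lambda>r. r powr ((N - p) / (p - 1)) * w r) \<longlongrightarrow> k) at_top \<and>
            ((\<lambda>r. r powr ((N - 1) / (p - 1)) * deriv w r) \<longlongrightarrow> - c k) at_top))) \<and>
     (pos_solution N p q \<sigma> (-1) {0<..} (w_star N p q \<sigma>) \<and>
      (w_star N p q \<sigma> \<longlongrightarrow> 0) (at_right 0) \<and>
      (- gam p q \<sigma> < 1 \<longrightarrow> (\<forall>\<rho>>0. cusp_solution N p q \<sigma> (-1) \<rho> (w_star N p q \<sigma>)))) \<and>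
     (\<exists>w. \<exists>C>0. \<exists>D>0.
        pos_solution N p q \<sigma> (-1) {0<..} w \<and>
        w \<sim>[at_right 0] w_star N p q \<sigma> \<and>
        (w \<longlongrightarrow> C) at_top \<and>
        ((\<lambda>r. r powr (- ((\<sigma> + 1) / (p - 1))) * deriv w r) \<longlongrightarrow> D) at_top) \<and>
     (\<exists>r0>0. \<exists>w.
        pos_solution N p q \<sigma> (-1) {r0<..} w \<and>
        w r0 = 0 \<and> (w \<longlongrightarrow> 0) (at_right r0) \<and>
        w \<sim>[at_top] w_star N p q \<sigma>) \<and>
     (\<exists>r0>0. \<exists>w.
        pos_solution N p q \<sigma> (-1) {r0<..} w \<and>
        filterlim w at_top (at_right r0) \<and>
        w \<sim>[at_top] w_star N p q \<sigma>) \<and>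
     (\<exists>r0>0. \<exists>w.
        pos_solution N p q \<sigma> (-1) {0<..<r0} w \<and> nonglobal N p q \<sigma> (-1) {0<..<r0} w \<and>
        w \<sim>[at_right 0] w_star N p q \<sigma> \<and>
        filterlim w at_top (at_left r0)) \<and>
     (\<forall>r0>0. \<not> (\<exists>w. pos_solution N p q \<sigma> 1 {0<..<r0} w))"
proof -
  interpret radial_equation N p q \<sigma>
    using assms by unfold_locales auto
  have 1: "\<not> C0_regular N p q \<sigma> 1 \<rho> c w" if "0 < \<rho>" for \<rho> c w
    using no_local_source_solution[OF that] by (simp add: C0_regular_def)
  have 2: "c = 0 \<and> w \<sim>[at_right 0] w_star N p q \<sigma>" if "0 < \<rho>" "C0_regular N p q \<sigma> (- 1) \<rho> c w" for \<rho> c w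
    using singular_behaviour_at_0[of \<rho> w] that tendsto_unique[OF trivial_limit_at_right_real]
    by (auto simp: C0_regular_def)
  have 3: "(\<exists>c::real \<Rightarrow> real. \<forall>k>0. c k > 0 \<and> (\<exists>r0>0. \<exists>w.
            pos_solution N p q \<sigma> \<epsilon> {r0<..} w \<and> nonglobal N p q \<sigma> \<epsilon> {r0<..} w \<and>
            (w \<longlongrightarrow> 0) at_top \<and>
            ((\<lambda>r. r powr ((N - p) / (p - 1)) * w r) \<longlongrightarrow> k) at_top \<and>
            ((\<lambda>r. r powr ((N - 1) / (p - 1)) * deriv w r) \<longlongrightarrow> - c k) at_top))" if "\<epsilon> \<in> {1, - 1}" for \<epsilon>
    using local_fundamental_at_infinity[of \<epsilon>] ka_pos that by (intro exI[of _ "\<lambda>k. ka * k"]) auto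
  have 4: "\<not> (\<exists>w. pos_solution N p q \<sigma> 1 {0<..<r0} w)" if "0 < r0" for r0
    using no_local_source_solution[OF that] by blast
  show ?thesis
    by (intro conjI allI impI ballI; (rule 1 2[THEN conjunct1] 2[THEN conjunct2] 3 4 local_regular_at_infinity
          w_star_solution w_star_tendsto_0 w_star_cusp global_regular
          exterior_vanishing exterior_blow_up interior_blow_up)?; assumption?)
qed

end
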